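(* Let $N\in2\mathbb N$, $N\ge8$, and $\sigma\ge\frac54$ be given, where $N_1=\sigma N\in2\mathbb N$. Further let $m\in\mathbb N\setminus\{1\}$ with $2m\ll N_1$ and $\beta=2\pi m(1-\frac{1}{2\sigma})$. Then the $C(\mathbb T)$-error constant of the $\sinh$-type window function $\varphi_{\sinh}$ can be estimated by $$e_\sigma(\varphi_{\sinh})\le\Big[40\,m^{3/2}+3\Big(1-\frac{1}{2\sigma}\Big)^{-3/2}\Big]\Big(1-\frac1\sigma\Big)^{3/4}e^{-2\pi m\sqrt{1-1/\sigma}},$$ i.e., the $\sinh$-type window function $\varphi_{\sinh}$ is convenient for NFFT.
   Context: $\mathbb N=\{1,2,\dots\}$, $I_N:=\{-N/2,\dots,N/2-1\}$ for $N\in2\mathbb N$, $\mathbb T=\mathbb R/\mathbb Z$, and $C(\mathbb T)$ is the Banach space of continuous 1-periodic functions with the sup-norm $\|\cdot\|_{C(\mathbb T)}$. Here $\sigma$ is the oversampling factor, $m$ the truncation parameter and $\beta$ the shape parameter; $2m\ll N_1$ means that $2m$ is much smaller than $N_1$. The Fourier transform is $\hat\varphi(v):=\int_{\mathbb R}\varphi(x)e^{-2\pi i vx}\,dx$. NFFT denotes the nonequispaced fast Fourier transform, an approximate fast algorithm, based on a window function, for computing the values of a trigonometric polynomial $\sum_{k\in I_N}c_k e^{2\pi i kx}$ at finitely many nonequispaced nodes. Let $I:=\big(-\frac{m}{N_1},\frac{m}{N_1}\big)$. The $\sinh$-type window function is $$\varphi_{\sinh}(x):=\frac{1}{\sinh\beta}\sinh\big(\beta\sqrt{1-(N_1x/m)^2}\big)\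 \text{ for } x\in I,\qquad\varphi_{\sinh}(x):=0\ \text{ for } x\in\mathbb R\setminus I.$$ $\Phi_{m,N_1}$ is the set of all continuous window functions $\varphi:\mathbb R\to[0,1]$ that are even with support $\bar I$, are decreasing on $[0,m/N_1]$ with $\varphi(0)=1$, and satisfy $\hat\varphi(v)>0$ for all $v\in[-N/2,N/2]$; the function $\varphi_{\sinh}$ belongs to $\Phi_{m,N_1}$. The $C(\mathbb T)$-error constant of a window function $\varphi$ is $$e_\sigma(\varphi):=\sup_{N\in2\mathbb N}e_{\sigma,N}(\varphi),\qquad e_{\sigma,N}(\varphi):=\max_{n\in I_N}\Big\|\sum_{r\in\mathbb Z\setminus\{0\}}\frac{\hat\varphi(n+rN_1)}{\hat\varphi(n)}\,e^{2\pi i rN_1\,\cdot}\Big\|_{C(\mathbb T)}.$$ A continuous window function $\varphi\in\Phi_{m,N_1}$ is called convenient for NFFT if $e_\sigma(\varphi)\ll1$ for conveniently chosen oversampling factor $\sigma>1$. *)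

theory Defs
  imports "HOL-Analysis.Analysis"
begin

definition fourier :: "(real \<Rightarrow> real) \<Rightarrow> real \<Rightarrow> complex" where
  "fourier \<phi> v =
     (LINT x|lborel. of_real (\<phi> x) * exp (- 2 * of_real pi * \<i> * of_real v * of_real x))"

definition sinh_window :: "nat \<Rightarrow> real \<Rightarrow> nat \<Rightarrow> real \<Rightarrow> real" where
  "sinh_window m \<beta> N\<^sub>1 x =
     (if x \<in> {- (real m / real N\<^sub>1)<..<real m / real N\<^sub>1}
      then 1 / sinh \<beta> * sinh (\<beta> * sqrt (1 - (real N\<^sub>1 * x / real m)\<^sup>2))
      else 0)"

text \<open>The class depends on \<open>N\<close> as well, through the frequency range \<open>[-N/2, N/2]\<close>.
  Positivity of the complex number \<open>fourier \<phi> v\<close> means that it is real and positive.\<close>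

definition window_class :: "nat \<Rightarrow> nat \<Rightarrow> nat \<Rightarrow> (real \<Rightarrow> real) set" where
  "window_class m N N\<^sub>1 = {\<phi>.
     continuous_on UNIV \<phi> \<and>
     range \<phi> \<subseteq> {0..1} \<and>
     (\<forall>x. \<phi> (- x) = \<phi> x) \<and>
     closure {x. \<phi> x \<noteq> 0} = {- (real m / real N\<^sub>1)..real m / real N\<^sub>1} \<and>
     antimono_on {0..real m / real N\<^sub>1} \<phi> \<and>
     \<phi> 0 = 1 \<and>
     (\<forall>v\<in>{- (real N / 2)..real N / 2}. fourier \<phi> v \<in> \<real> \<and> 0 < Re (fourier \<phi> v))}"

text \<open>\<open>C(\<real>/\<int>)\<close> is the closed subspace of 1-periodic functions of the Banach space
  \<open>real \<Rightarrow>\<^sub>C complex\<close> of bounded continuous functions with the sup-norm; the following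
  is \<open>x \<mapsto> c exp (2\<pi>ikx)\<close> as an element of it. The factor \<open>c\<close> is included because that space
  is only a real normed space in the library.\<close>

context includes bcontfun.lifting
begin

lift_definition trig_monom :: "complex \<Rightarrow> int \<Rightarrow> (real \<Rightarrow>\<^sub>C complex)" is
  "\<lambda>c k x. c * exp (2 * of_real pi * \<i> * of_int k * of_real x)"
proof (rule bcontfun_normI)
  fix c :: complex and k :: int
  show "continuous_on UNIV (\<lambda>x::real. c * exp (2 * of_real pi * \<i> * of_int k * of_real x))"
    by (intro continuous_intros)
  show "norm (c * exp (2 * of_real pi * \<i> * of_int k * of_real x)) \<le> norm c" for x :: real
    by (simp add: norm_mult)
qed

end

definition alias_term :: "(real \<Rightarrow> real) \<Rightarrow> nat \<Rightarrow> int \<Rightarrow> int \<Rightarrow> (real \<Rightarrow>\<^sub>C complex)" where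
  "alias_term \<phi> N\<^sub>1 n r =
     trig_monom (fourier \<phi> (of_int (n + r * int N\<^sub>1)) / fourier \<phi> (of_int n)) (r * int N\<^sub>1)"

text \<open>Since \<open>infsum\<close> is \<open>0\<close> for a family that is not summable, a divergent series is
  explicitly given the norm \<open>\<infinity>\<close>. An upper bound thus includes convergence in \<open>C(\<real>/\<int>)\<close>.\<close>

definition alias_norm :: "(real \<Rightarrow> real) \<Rightarrow> nat \<Rightarrow> int \<Rightarrow> ereal" where
  "alias_norm \<phi> N\<^sub>1 n =
     (if alias_term \<phi> N\<^sub>1 n summable_on (UNIV - {0})
      then ereal (norm (\<Sum>\<^sub>\<infinity>r\<in>UNIV - {0}. alias_term \<phi> N\<^sub>1 n r))
      else \<infinity>)"

definition index_set :: "nat \<Rightarrow> int set" where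
  "index_set N = {- (int N div 2)..int N div 2 - 1}"

definition error_constant_at :: "nat \<Rightarrow> nat \<Rightarrow> (real \<Rightarrow> real) \<Rightarrow> ereal" where
  "error_constant_at N N\<^sub>1 \<phi> = Max (alias_norm \<phi> N\<^sub>1 ` index_set N)"

text \<open>The pairs of even positive integers \<open>N\<close> and \<open>N\<^sub>1 = \<sigma>N\<close>. The series above consists of
  1-periodic functions only if \<open>\<sigma>N\<close> is an integer, so \<open>N\<close> ranges over those values.\<close>

definition grid_sizes :: "real \<Rightarrow> (nat \<times> nat) set" where
  "grid_sizes \<sigma> =
     {(N, N\<^sub>1). 0 < N \<and> even N \<and> 0 < N\<^sub>1 \<and> even N\<^sub>1 \<and> real N\<^sub>1 = \<sigma> * real N}"

text \<open>As \<open>N\<close> varies, so does \<open>N\<^sub>1 = \<sigma>N\<close> and with it the window function; the window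
  function is therefore a family \<open>\<phi>\<close> indexed by \<open>N\<^sub>1\<close>.\<close>

definition error_constant :: "real \<Rightarrow> (nat \<Rightarrow> real \<Rightarrow> real) \<Rightarrow> ereal" where
  "error_constant \<sigma> \<phi> = (SUP (N, N\<^sub>1)\<in>grid_sizes \<sigma>. error_constant_at N N\<^sub>1 (\<phi> N\<^sub>1))"

text \<open>The informal requirement that the error constant be much smaller than \<open>1\<close> is made
  precise by a tolerance \<open>\<epsilon>\<close>; \<open>\<sigma>\<close> is the chosen oversampling factor.\<close>

definition convenient_for_NFFT :: "real \<Rightarrow> real \<Rightarrow> nat \<Rightarrow> (nat \<Rightarrow> real \<Rightarrow> real) \<Rightarrow> bool" where
  "convenient_for_NFFT \<epsilon> \<sigma> m \<phi> \<longleftrightarrow>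
     1 < \<sigma> \<and>
     (\<forall>(N, N\<^sub>1)\<in>grid_sizes \<sigma>. \<phi> N\<^sub>1 \<in> window_class m N N\<^sub>1) \<and>
     error_constant \<sigma> \<phi> < ereal \<epsilon>"

end

theory Submission
  imports Defs "HOL-Complex_Analysis.Cauchy_Integral_Theorem" "HOL-Real_Asymp.Real_Asymp"
begin

text \<open>Let \<open>a = 1 / (2 * \<sigma>)\<close>, so \<open>0 < a \<le> 2 / 5\<close>, and for a frequency \<open>n\<close> let \<open>u = n / N\<^sub>1\<close>,
so \<open>\<bar>u\<bar> \<le> a\<close>. The Fourier transform of the window is explicit: with the entire function \<open>bessel\<close>
for which \<open>bessel (y\<^sup>2) = I\<^sub>1(y) / y\<close> and \<open>bessel (- (x\<^sup>2)) = J\<^sub>1(x) / x\<close>, the quotient of the transforms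
at \<open>n + r * N\<^sub>1\<close> and \<open>n\<close> is the quotient of the values of \<open>bessel\<close> at
\<open>(2 * pi * m)\<^sup>2 * ((1 - a)\<^sup>2 - (r + u)\<^sup>2)\<close> and \<open>(2 * pi * m)\<^sup>2 * ((1 - a)\<^sup>2 - u\<^sup>2)\<close>
(\<open>fourier_sinh_window\<close>). The numerators oscillate and decay like \<open>r powr (- 3 / 2)\<close>; the denominator is
exponentially large. It is smallest for \<open>\<bar>u\<bar> = a\<close>, where its argument is \<open>y\<^sup>2\<close> with
\<open>y = 2 * pi * m * sqrt (1 - 1 / \<sigma>)\<close>, and there it is \<open>exp y / (sqrt (2 * pi) * y powr (3 / 2))\<close> up to a
factor close to \<open>1\<close> (\<open>bessel_lower_bound\<close>, \<open>bessel_factor\<close>). This gives the exponential and the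
power \<open>(1 - 1 / \<sigma>) powr (3 / 4)\<close> in the claim.

What remains is a bound for the sum of the numerators that is uniform in the position \<open>\<theta>\<close>
(\<open>alias_total_bound\<close>): after multiplication by \<open>4 * pi\<^sup>2 * m powr (3 / 2)\<close> it must not exceed
\<open>(40 * m powr (3 / 2) + 3) * bessel_factor y\<close>. There is little room. As \<open>\<sigma>\<close> tends to infinity, both terms
with \<open>r = \<plusminus>1\<close> tend to \<open>1 / 2\<close> and add up to \<open>cos \<theta>\<close>, which for \<open>\<theta> = 0\<close> already uses
\<open>4 * pi\<^sup>2 = 39.478...\<close> out of \<open>40\<close>. The argument has two stages.

The limit case \<open>a = u = 0\<close> (\<open>base_series_bounds\<close>). By a contour shift \<open>J\<^sub>1\<close> equals its leading
cosine up to the relative error \<open>3 / (8 * x)\<close> (\<open>bessel_asymptotic\<close>), so the terms with \<open>\<bar>r\<bar> \<ge> 2\<close> are,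
up to a small total error, proportional to \<open>weight r * cos (phase) * cos (r * \<theta>)\<close> with \<open>weight r = (r\<^sup>2 - 1) powr (- 3 / 4)\<close>.
For \<open>m \<ge> 8\<close> the sum of the weights is small enough. For \<open>m = 2, ..., 7\<close> the phases have to be used:
the coefficients with \<open>r \<le> 10\<close> are enclosed numerically, the later ones are bounded through the size of the
weights or, once they are monotone and of one sign, by Abel summation. Near \<open>\<theta> = 0\<close> and \<open>\<theta> = pi\<close>
only the value of the series at that end matters, because its growth away from the end is paid for by the
decrease of \<open>\<bar>cos \<theta>\<bar>\<close>; this is the content of \<open>phase_bound\<close>.

The case \<open>a > 0\<close>. At least one of the two terms with \<open>r = \<plusminus>1\<close> is damped by at least \<open>0.0546 * min Z 3\<close>, where
\<open>Z = (2 * pi * m)\<^sup>2 * (2 * a - a\<^sup>2)\<close> (\<open>near_terms\<close>). If \<open>Z \<ge> 3\<close>, this damping leaves room for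
bounding the other terms by their absolute values. If \<open>Z < 3\<close>, then \<open>a\<close> is at most \<open>1 / 100\<close>, the remaining
terms differ from the limit case by \<open>O(m * a)\<close> because \<open>bessel\<close> has a Lipschitz bound of the same decay
(\<open>bessel_lipschitz\<close>), and this is less than what the damping, of order \<open>m\<^sup>2 * a\<close>, gains.

The bound so obtained is less than \<open>43 * m\<^sup>2 * exp (- (14 / 5 * m))\<close>, which is less than \<open>1\<close> for \<open>m \<ge> 2\<close> and tends
to \<open>0\<close>; hence the window is convenient.\<close>

section \<open>The Bessel quotient and its integral representations\<close>

text \<open>The power series of \<open>I\<^sub>1(y) / y\<close> in the variable \<open>z = y\<^sup>2\<close>. Using one entire function of \<open>z\<close> for
\<open>I\<^sub>1(y) / y\<close> and, at negative \<open>z = - (x\<^sup>2)\<close>, for \<open>J\<^sub>1(x) / x\<close> avoids case distinctions, since the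
Fourier transform of the window passes from one regime to the other.\<close>

definition bessel :: "real \<Rightarrow> real" where
  "bessel z = (\<Sum>n. z ^ n / (4 ^ n * fact n * fact (Suc n))) / 2"

lemma bessel_sums: "(\<lambda>n. z ^ n / (4 ^ n * fact n * fact (Suc n)) / 2) sums bessel z"
proof -
  have "summable (\<lambda>n. z ^ n / (4 ^ n * fact n * fact (Suc n)))"
  proof (rule summable_comparison_test')
    show "summable (\<lambda>n. inverse (fact n) * \<bar>z\<bar> ^ n)" by (rule summable_exp)
    fix n :: nat
    have "1 \<le> (4::real) ^ n * fact (Suc n)"
      using mult_mono[of 1 "(4::real) ^ n" 1 "fact (Suc n)"]
      by (simp only: mult_1_left fact_ge_1 one_le_power) simp
    then have "fact n * 1 \<le> fact n * ((4::real) ^ n * fact (Suc n))"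
      by (intro mult_left_mono) auto
    then have "\<bar>z\<bar> ^ n / (fact n * (4 ^ n * fact (Suc n))) \<le> \<bar>z\<bar> ^ n / (fact n * 1)"
      by (intro divide_left_mono mult_pos_pos) auto
    then show "norm (z ^ n / (4 ^ n * fact n * fact (Suc n))) \<le> inverse (fact n) * \<bar>z\<bar> ^ n"
      by (simp add: power_abs abs_mult field_simps)
  qed
  then show ?thesis
    unfolding bessel_def by (intro sums_divide summable_sums)
qed

lemma bessel_mono:
  assumes "0 \<le> y" "y \<le> z" shows "bessel y \<le> bessel z"
  using assms by (intro sums_le[OF _ bessel_sums bessel_sums] divide_right_mono power_mono) auto

lemma bessel_ge_half:
  assumes "0 \<le> z" shows "1 / 2 \<le> bessel z"
proof -
  have "(\<lambda>n. if n = 0 then 1 / 2 else 0) sums (1 / 2 :: real)"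
    using sums_single[of 0 "\<lambda>_. 1 / 2 :: real"] by simp
  then show ?thesis
    using assms by (intro sums_le[OF _ _ bessel_sums]) auto
qed

lemma integral_sums:
  fixes f :: "nat \<Rightarrow> real \<Rightarrow> real"
  assumes cont: "\<And>n. continuous_on {a..b} (f n)"
    and bound: "\<And>n s. s \<in> {a..b} \<Longrightarrow> \<bar>f n s\<bar> \<le> B n"
    and "summable B"
    and sums: "\<And>s. s \<in> {a..b} \<Longrightarrow> (\<lambda>n. f n s) sums F s"
  shows "(\<lambda>n. integral {a..b} (f n)) sums integral {a..b} F"
proof -
  have "uniform_limit {a..b} (\<lambda>n s. \<Sum>i<n. f i s) (\<lambda>s. suminf (\<lambda>i. f i s)) sequentially"
    using bound \<open>summable B\<close> by (intro Weierstrass_m_test) auto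
  then have lim: "uniform_limit {a..b} (\<lambda>n s. \<Sum>i<n. f i s) F sequentially"
    by (rule uniform_limit_cong'[THEN iffD1, rotated -1]) (use sums in \<open>auto simp: sums_iff\<close>)
  obtain I J where I: "\<And>n. ((\<lambda>s. \<Sum>i<n. f i s) has_integral I n) {a..b}"
    and J: "(F has_integral J) {a..b}" and IJ: "I \<longlonglongrightarrow> J"
    by (rule uniform_limit_integral[OF lim]) (use cont in \<open>auto intro!: continuous_on_sum\<close>)
  have "I = (\<lambda>n. \<Sum>i<n. integral {a..b} (f i))"
  proof
    fix n
    show "I n = (\<Sum>i<n. integral {a..b} (f i))"
    using integral_unique[OF I[of n]] integral_sum[of "{..<n}" f "{a..b}"] cont
      by (simp add: integrable_continuous_interval)
  qed
  then show ?thesis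
    using IJ J by (simp add: sums_def integral_unique)
qed

abbreviation semicircle :: "real \<Rightarrow> real" where "semicircle s \<equiv> sqrt (1 - s\<^sup>2)"

lemma semicircle_nonneg: "s \<in> {-1..1} \<Longrightarrow> s\<^sup>2 \<le> 1" for s :: real
  by (auto simp: abs_square_le_1)

lemma semicircle_power_le: "s \<in> {-1..1} \<Longrightarrow> \<bar>semicircle s ^ n\<bar> \<le> 1"
  using semicircle_nonneg[of s] by (simp add: power_abs power_le_one)

text \<open>A Beta integral. The recursions in both indices come from \<open>semicircle\<^sup>2 = 1 - s\<^sup>2\<close> and from integration by
parts, which together determine all moments from the area of the half disc.\<close>

definition moment :: "nat \<Rightarrow> nat \<Rightarrow> real" where
  "moment j k = integral {-1..1} (\<lambda>s. s ^ (2 * j) * semicircle s ^ (2 * k + 1))"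

lemma moment_has_integral:
  "((\<lambda>s. s ^ (2 * j) * semicircle s ^ (2 * k + 1)) has_integral moment j k) {-1..1}"
  unfolding moment_def
  by (intro integrable_integral integrable_continuous_interval continuous_intros)

lemma moment_Suc_right: "moment j (Suc k) = moment j k - moment (Suc j) k"
proof -
  have "moment j (Suc k) = integral {-1..1}
      (\<lambda>s. s ^ (2 * j) * semicircle s ^ (2 * k + 1) - s ^ (2 * Suc j) * semicircle s ^ (2 * k + 1))"
    unfolding moment_def
  proof (rule integral_cong)
    fix s :: real assume "s \<in> {-1..1}"
    then have "semicircle s ^ 2 = 1 - s\<^sup>2" using semicircle_nonneg[of s] by simp
    then have "semicircle s ^ (2 * Suc k + 1) = (1 - s\<^sup>2) * semicircle s ^ (2 * k + 1)"
      by (simp add: power2_eq_square)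
    moreover have "s ^ (2 * Suc j) = s ^ (2 * j) * s\<^sup>2" by (simp add: power2_eq_square)
    ultimately show "s ^ (2 * j) * semicircle s ^ (2 * Suc k + 1)
        = s ^ (2 * j) * semicircle s ^ (2 * k + 1) - s ^ (2 * Suc j) * semicircle s ^ (2 * k + 1)"
      by (simp only: left_diff_distrib right_diff_distrib mult_1_left mult_ac)
  qed
  also have "\<dots> = moment j k - moment (Suc j) k"
    by (intro integral_unique has_integral_diff moment_has_integral)
  finally show ?thesis .
qed

lemma semicircle_deriv:
  assumes "s \<in> {-1<..<1}"
  shows "(semicircle has_real_derivative - s / semicircle s) (at s)"
proof -
  have "s\<^sup>2 < 1" using assms by (auto simp: abs_square_less_1)
  then show ?thesis
    by (auto intro!: derivative_eq_intros simp: field_simps)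
qed

lemma moment_by_parts: "(2 * real k + 3) * moment (Suc j) k = (2 * real j + 1) * moment j (Suc k)"
proof -
  let ?g = "\<lambda>s. (2 * real j + 1) * (s ^ (2 * j) * semicircle s ^ (2 * Suc k + 1))
              - (2 * real k + 3) * (s ^ (2 * Suc j) * semicircle s ^ (2 * k + 1))"
  have 1: "(?g has_integral (2 * real j + 1) * moment j (Suc k) - (2 * real k + 3) * moment (Suc j) k) {-1..1}"
    by (intro has_integral_diff has_integral_mult_right moment_has_integral)
  have "(?g has_integral (1 ^ (2 * j + 1) * semicircle 1 ^ (2 * k + 3)
      - (- 1) ^ (2 * j + 1) * semicircle (- 1) ^ (2 * k + 3))) {-1..1}"
  proof (rule fundamental_theorem_of_calculus_interior)
    show "continuous_on {-1..1} (\<lambda>s. s ^ (2 * j + 1) * semicircle s ^ (2 * k + 3))"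
      by (intro continuous_intros)
    fix s :: real assume s: "s \<in> {-1<..<1}"
    then have "s\<^sup>2 < 1" by (auto simp: abs_square_less_1)
    then have pos: "semicircle s > 0" by simp
    have "((\<lambda>s. s ^ (2 * j + 1) * semicircle s ^ (2 * k + 3)) has_real_derivative
        real (2 * j + 1) * s ^ (2 * j) * semicircle s ^ (2 * k + 3)
        + s ^ (2 * j + 1) * (real (2 * k + 3) * semicircle s ^ (2 * k + 2) * (- s / semicircle s))) (at s)"
      by (rule DERIV_cong[OF DERIV_mult[OF DERIV_power[OF DERIV_ident] DERIV_power[OF semicircle_deriv[OF s]]]])
        simp
    also have "real (2 * j + 1) * s ^ (2 * j) * semicircle s ^ (2 * k + 3)
        + s ^ (2 * j + 1) * (real (2 * k + 3) * semicircle s ^ (2 * k + 2) * (- s / semicircle s)) = ?g s"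
      using pos by (simp add: field_simps eval_nat_numeral)
    finally show "((\<lambda>s. s ^ (2 * j + 1) * semicircle s ^ (2 * k + 3)) has_vector_derivative ?g s) (at s)"
      by (simp only: has_real_derivative_iff_has_vector_derivative)
  qed simp
  moreover have "semicircle 1 = 0" "semicircle (- 1) = 0" "(0::real) ^ (2 * k + 3) = 0" by simp_all
  ultimately have "(?g has_integral 0) {-1..1}" by (simp only: mult_zero_right diff_self)
  with 1 show ?thesis by (metis (no_types, lifting) has_integral_unique eq_iff_diff_eq_0)
qed

lemma moment_0_0: "moment 0 0 = pi / 2"
proof -
  have "(semicircle has_integral ((1 * semicircle 1 + arcsin 1) / 2 - (-1 * semicircle (-1) + arcsin (-1)) / 2)) {-1..1}"
  proof (rule fundamental_theorem_of_calculus_interior)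
    show "continuous_on {-1..1} (\<lambda>s. (s * semicircle s + arcsin s) / 2)"
      by (intro continuous_intros) auto
    fix s :: real assume s: "s \<in> {-1<..<1}"
    then have "s\<^sup>2 < 1" by (auto simp: abs_square_less_1)
    then have pos: "semicircle s > 0" and sq: "semicircle s * semicircle s = 1 - s * s" by (simp_all add: power2_eq_square)
    have "((\<lambda>s. (s * semicircle s + arcsin s) / 2) has_real_derivative
        (s * (- s / semicircle s) + semicircle s + inverse (semicircle s)) / 2) (at s)"
      using s by (intro DERIV_cong[OF DERIV_cdivide[OF DERIV_add[OF
            DERIV_mult[OF DERIV_ident semicircle_deriv[OF s]] DERIV_arcsin]]]) auto
    also have "(s * (- s / semicircle s) + semicircle s + inverse (semicircle s)) / 2 = semicircle s"
      using pos sq by (simp add: field_simps)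
    finally show "((\<lambda>s. (s * semicircle s + arcsin s) / 2) has_vector_derivative semicircle s) (at s)"
      by (simp only: has_real_derivative_iff_has_vector_derivative)
  qed simp
  then show ?thesis unfolding moment_def by (intro integral_unique) simp
qed

lemma moment_eq:
  "moment j k = pi * fact (2 * j) * fact (2 * k + 1) / (2 * 4 ^ (j + k) * fact j * fact k * fact (Suc (j + k)))"
proof -
  have R: "moment (Suc j) k = (2 * j + 1) / (2 * j + 2 * k + 4) * moment j k" for j k
    using moment_by_parts[of k j] moment_Suc_right[of j k] by (simp add: field_simps)
  have S: "moment j (Suc k) = (2 * k + 3) / (2 * j + 2 * k + 4) * moment j k" for j k
    unfolding moment_Suc_right R by (simp add: field_simps)
  have K: "moment 0 k = pi * fact (2 * k + 1) / (2 * 4 ^ k * fact k * fact (Suc k))"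
  proof (induction k)
    case 0
    then show ?case by (simp add: moment_0_0)
  next
    case (Suc k)
    have f: "fact (2 * Suc k + 1) = (2 * real k + 3) * (2 * (k + 1)) * fact (2 * k + 1)"
      "fact (Suc (Suc k)) = (real k + 2) * fact (Suc k)" "fact (Suc k) = (real k + 1) * fact k"
      by (simp_all add: algebra_simps)
    show ?case
      unfolding S Suc.IH f(1,2) unfolding f(3)
      by (simp add: divide_simps del: fact_Suc) (simp add: algebra_simps del: fact_Suc)
  qed
  show ?thesis
  proof (induction j)
    case 0
    then show ?case by (simp add: K)
  next
    case (Suc j)
    have f: "fact (2 * Suc j) = (2 * real j + 1) * (2 * (j + 1)) * fact (2 * j)"
      "fact (Suc (Suc j + k)) = (real j + k + 2) * fact (Suc (j + k))" "fact (Suc j) = (real j + 1) * fact j"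
      by (simp_all add: algebra_simps)
    show ?case
      unfolding R Suc.IH f by (simp add: divide_simps del: fact_Suc) (simp add: algebra_simps del: fact_Suc)
  qed
qed

text \<open>Every integral of the semicircle against an even power series can be done termwise. The two instances below are the
Poisson integrals of \<open>J\<^sub>1\<close> and \<open>I\<^sub>1\<close>.\<close>

lemma integral_semicircle_power_series:
  assumes sums: "\<And>s. s \<in> {-1..1} \<Longrightarrow> (\<lambda>n. z ^ n / fact (2 * n) * s ^ (2 * n)) sums F s"
  shows "integral {-1..1} (\<lambda>s. semicircle s * F s) = pi * bessel z"
proof -
  let ?f = "\<lambda>n s. z ^ n / fact (2 * n) * (s ^ (2 * n) * semicircle s ^ (2 * 0 + 1))"
  have "summable (\<lambda>n. \<bar>z\<bar> ^ n / fact (2 * n))"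
  proof (rule summable_comparison_test')
    show "summable (\<lambda>n. inverse (fact n) * \<bar>z\<bar> ^ n)" by (rule summable_exp)
    fix n :: nat
    have "fact n \<le> (fact (2 * n) :: real)" by (rule fact_mono) simp
    then show "norm (\<bar>z\<bar> ^ n / fact (2 * n)) \<le> inverse (fact n) * \<bar>z\<bar> ^ n"
      using mult_right_mono[of "inverse (fact (2 * n))" "inverse (fact n :: real)" "\<bar>z\<bar> ^ n"]
      by (simp add: divide_inverse mult.commute[of _ "inverse _"] del: mult_le_cancel_right)
  qed
  then have "(\<lambda>n. integral {-1..1} (?f n)) sums integral {-1..1} (\<lambda>s. semicircle s * F s)"
  proof (intro integral_sums)
    fix n and s :: real assume s: "s \<in> {-1..1}"
    have "\<bar>s ^ (2 * n) * semicircle s ^ (2 * 0 + 1)\<bar> \<le> 1"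
      using s semicircle_power_le[OF s, of 1] unfolding abs_mult
      by (intro mult_le_one) (auto simp: power_abs power_le_one)
    then show "\<bar>?f n s\<bar> \<le> \<bar>z\<bar> ^ n / fact (2 * n)"
      unfolding abs_mult[of "z ^ n / fact (2 * n)"] using mult_left_mono[of _ 1 "\<bar>z ^ n / fact (2 * n)\<bar>"]
      by (fastforce simp: power_abs)
  next
    fix s :: real assume s: "s \<in> {-1..1}"
    show "(\<lambda>n. ?f n s) sums (semicircle s * F s)"
      using sums_mult[OF sums[OF s], of "semicircle s"] by (simp add: mult_ac)
  qed (auto intro!: continuous_intros)
  moreover have "integral {-1..1} (?f n) = pi * (z ^ n / (4 ^ n * fact n * fact (Suc n)) / 2)" for n
  proof -
    have "integral {-1..1} (?f n) = z ^ n / fact (2 * n) * moment n 0"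
      by (intro integral_unique has_integral_mult_right moment_has_integral)
    also have "\<dots> = pi * (z ^ n / (4 ^ n * fact n * fact (Suc n)) / 2)"
      by (simp add: moment_eq divide_simps del: fact_Suc)
    finally show ?thesis .
  qed
  ultimately show ?thesis
    using sums_mult[OF bessel_sums, of pi z] sums_unique2 by (simp del: fact_Suc)
qed

lemma integral_semicircle_cos: "integral {-1..1} (\<lambda>s. semicircle s * cos (x * s)) = pi * bessel (- (x\<^sup>2))"
proof (rule integral_semicircle_power_series)
  fix s :: real
  show "(\<lambda>n. (- (x\<^sup>2)) ^ n / fact (2 * n) * s ^ (2 * n)) sums cos (x * s)"
    using cos_paired[of "x * s"]
    by (simp add: power_mult_distrib power_mult power_minus[of "x\<^sup>2"] mult.assoc)
qed

lemma sums_even_part: "(\<lambda>n. x ^ (2 * n) / fact (2 * n)) sums cosh x" for x :: real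
proof -
  have "(\<lambda>n. (\<lambda>n. if even n then x ^ n /\<^sub>R fact n else 0) (2 * n)) sums cosh x"
    by (subst sums_mono_reindex) (auto simp: strict_mono_def cosh_converges elim!: evenE)
  then show ?thesis by (simp add: divide_inverse mult.commute)
qed

lemma sums_odd_part: "(\<lambda>n. x ^ (2 * n + 1) / fact (2 * n + 1)) sums sinh x" for x :: real
proof -
  have "(\<lambda>n. (\<lambda>n. if even n then 0 else x ^ n /\<^sub>R fact n) (2 * n + 1)) sums sinh x"
    by (subst sums_mono_reindex) (auto simp: strict_mono_def sinh_converges elim!: oddE)
  then show ?thesis by (simp add: divide_inverse mult.commute del: fact_Suc)
qed

lemma integral_semicircle_cosh: "integral {-1..1} (\<lambda>s. semicircle s * cosh (y * s)) = pi * bessel (y\<^sup>2)"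
proof (rule integral_semicircle_power_series)
  fix s :: real
  show "(\<lambda>n. (y\<^sup>2) ^ n / fact (2 * n) * s ^ (2 * n)) sums cosh (y * s)"
    using sums_even_part[of "y * s"] by (simp add: power_mult_distrib power_mult)
qed

text \<open>The Fourier transform of the window, on its own scale. Expanding both factors, integrating the Cauchy product
termwise and inserting the moments leaves the binomial expansion of \<open>(\<beta>\<^sup>2 - w\<^sup>2) ^ n\<close>; this is why the
transform depends on \<open>\<beta>\<^sup>2 - w\<^sup>2\<close> alone.\<close>

lemma integral_sinh_semicircle_cos:
  "integral {-1..1} (\<lambda>s. sinh (\<beta> * semicircle s) * cos (w * s)) = pi * \<beta> * bessel (\<beta>\<^sup>2 - w\<^sup>2)"
proof -
  define a where "a k s = (\<beta> * semicircle s) ^ (2 * k + 1) / fact (2 * k + 1)" for k and s :: real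
  define b where "b j s = (- 1) ^ j / fact (2 * j) * (w * s) ^ (2 * j)" for j and s :: real
  define A where "A k = \<bar>\<beta>\<bar> ^ (2 * k + 1) / fact (2 * k + 1)" for k
  define B where "B j = \<bar>w\<bar> ^ (2 * j) / fact (2 * j)" for j
  have aA: "\<bar>a k s\<bar> \<le> A k" and bB: "\<bar>b k s\<bar> \<le> B k" if "s \<in> {-1..1}" for k s
  proof -
    have "\<bar>a k s\<bar> = A k * \<bar>semicircle s ^ (2 * k + 1)\<bar>"
      unfolding a_def A_def by (simp add: abs_mult power_mult_distrib power_abs)
    also have "\<dots> \<le> A k"
      using that semicircle_power_le[OF that, of "2 * k + 1"] unfolding A_def by (intro mult_left_le) auto
    finally show "\<bar>a k s\<bar> \<le> A k" .
    have "\<bar>b k s\<bar> = B k * \<bar>s\<bar> ^ (2 * k)"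
      unfolding b_def B_def by (simp add: abs_mult power_mult_distrib power_abs)
    also have "\<dots> \<le> B k"
      using that unfolding B_def by (intro mult_left_le power_le_one) auto
    finally show "\<bar>b k s\<bar> \<le> B k" .
  qed
  have A: "summable A" and B: "summable B"
    using sums_odd_part[of "\<bar>\<beta>\<bar>"] sums_even_part[of "\<bar>w\<bar>"]
    unfolding A_def B_def by (auto simp: sums_iff simp del: fact_Suc)
  have nn: "0 \<le> A k" "0 \<le> B k" for k unfolding A_def B_def by auto
  let ?f = "\<lambda>n s. \<Sum>k\<le>n. a k s * b (n - k) s"
  have "summable (\<lambda>n. \<Sum>k\<le>n. A k * B (n - k))"
    using Cauchy_product_sums[of A B] A B nn by (auto simp: sums_iff)
  then have "(\<lambda>n. integral {-1..1} (?f n)) sums integral {-1..1} (\<lambda>s. sinh (\<beta> * semicircle s) * cos (w * s))"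
  proof (intro integral_sums)
    fix n and s :: real assume s: "s \<in> {-1..1}"
    have "\<bar>?f n s\<bar> \<le> (\<Sum>k\<le>n. \<bar>a k s * b (n - k) s\<bar>)" by (rule sum_abs)
    also have "\<dots> \<le> (\<Sum>k\<le>n. A k * B (n - k))"
      unfolding abs_mult by (intro sum_mono mult_mono aA bB s nn) auto
    finally show "\<bar>?f n s\<bar> \<le> (\<Sum>k\<le>n. A k * B (n - k))" .
  next
    fix s :: real assume s: "s \<in> {-1..1}"
    have "summable (\<lambda>k. norm (a k s))" "summable (\<lambda>k. norm (b k s))"
      using aA[OF s] bB[OF s] summable_comparison_test'[OF A, of 0 "\<lambda>k. norm (a k s)"]
        summable_comparison_test'[OF B, of 0 "\<lambda>k. norm (b k s)"] by auto
    moreover have "(\<lambda>k. a k s) sums sinh (\<beta> * semicircle s)" "(\<lambda>k. b k s) sums cos (w * s)"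
      unfolding a_def b_def by (rule sums_odd_part cos_paired)+
    ultimately show "(\<lambda>n. ?f n s) sums (sinh (\<beta> * semicircle s) * cos (w * s))"
      using Cauchy_product_sums[of "\<lambda>k. a k s" "\<lambda>k. b k s"] by (simp add: sums_iff)
  qed (auto simp: a_def b_def intro!: continuous_intros)
  moreover have "integral {-1..1} (?f n)
      = pi * \<beta> * ((\<beta>\<^sup>2 - w\<^sup>2) ^ n / (4 ^ n * fact n * fact (Suc n)) / 2)" for n
  proof -
    have ab: "a k s * b (n - k) s = (\<beta> ^ (2 * k + 1) / fact (2 * k + 1) * ((- 1) ^ (n - k) * w ^ (2 * (n - k)) / fact (2 * (n - k))))
        * (s ^ (2 * (n - k)) * semicircle s ^ (2 * k + 1))" for k s
      unfolding a_def b_def by (simp add: power_mult_distrib mult_ac)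
    have "integral {-1..1} (?f n) = (\<Sum>k\<le>n.
      (\<beta> ^ (2 * k + 1) / fact (2 * k + 1) * ((- 1) ^ (n - k) * w ^ (2 * (n - k)) / fact (2 * (n - k))))
        * moment (n - k) k)"
      unfolding ab by (intro integral_unique has_integral_sum has_integral_mult_right moment_has_integral) auto
    also have "\<dots> = (\<Sum>k\<le>n. pi * \<beta> / (2 * 4 ^ n * fact n * fact (Suc n)) *
        (of_nat (n choose k) * (\<beta>\<^sup>2) ^ k * (- (w\<^sup>2)) ^ (n - k)))"
    proof (rule sum.cong)
      fix k assume "k \<in> {..n}"
      then have k: "k \<le> n" by simp
      have w: "(- 1) ^ (n - k) * w ^ (2 * (n - k)) = (- (w\<^sup>2)) ^ (n - k)"
        by (simp add: power_mult power_minus[of "w\<^sup>2"])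
      have ch: "real (n choose k) = fact n / (fact k * fact (n - k))"
        using k by (rule binomial_fact)
      show "(\<beta> ^ (2 * k + 1) / fact (2 * k + 1) * ((- 1) ^ (n - k) * w ^ (2 * (n - k)) / fact (2 * (n - k)))) * moment (n - k) k
        = pi * \<beta> / (2 * 4 ^ n * fact n * fact (Suc n)) * (of_nat (n choose k) * (\<beta>\<^sup>2) ^ k * (- (w\<^sup>2)) ^ (n - k))"
        unfolding w moment_eq ch using k by (simp add: divide_simps power_mult del: fact_Suc)
    qed simp
    also have "\<dots> = pi * \<beta> / (2 * 4 ^ n * fact n * fact (Suc n)) * (\<beta>\<^sup>2 + - (w\<^sup>2)) ^ n"
      unfolding sum_distrib_left[symmetric] binomial_ring ..
    finally show ?thesis by (simp add: mult_ac del: fact_Suc)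
  qed
  ultimately show ?thesis
    using sums_mult[OF bessel_sums, of "pi * \<beta>" "\<beta>\<^sup>2 - w\<^sup>2"] sums_unique2 by (simp del: fact_Suc)
qed

section \<open>Exponential moments and a lower bound for the modified Bessel function\<close>

lemma has_integral_powr_exp:
  fixes s x :: real
  assumes "0 < s" "0 < x"
  shows "((\<lambda>q. q powr (s - 1) * exp (- x * q)) has_integral Gamma s / x powr s) {0..}"
proof -
  let ?h = "\<lambda>q. indicator {0..} q * (q powr (s - 1) * exp (- x * q))"
  have *: "?h (0 + 1 / x * q) = x powr (1 - s) * (indicator {0..} q * q powr (s - 1) / exp q)" for q
  proof (cases "0 \<le> q")
    case True
    then have "(q / x) powr (s - 1) = x powr (1 - s) * q powr (s - 1)"
      using assms by (simp add: powr_divide powr_diff field_simps)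
    then show ?thesis using True assms by (simp add: exp_minus field_simps)
  next
    case False
    then show ?thesis using assms by (simp add: zero_le_divide_iff)
  qed
  have "(\<integral>\<^sup>+q. ?h q \<partial>lborel) = ennreal \<bar>1 / x\<bar> * (\<integral>\<^sup>+q. ?h (0 + 1 / x * q) \<partial>lborel)"
    using assms by (intro nn_integral_real_affine) auto
  also have "(\<integral>\<^sup>+q. ?h (0 + 1 / x * q) \<partial>lborel)
      = ennreal (x powr (1 - s)) * (\<integral>\<^sup>+q. ennreal (indicator {0..} q * q powr (s - 1) / exp q) \<partial>lborel)"
    unfolding * by (subst nn_integral_cmult[symmetric]) (auto simp: ennreal_mult[symmetric])
  also have "(\<integral>\<^sup>+q. ennreal (indicator {0..} q * q powr (s - 1) / exp q) \<partial>lborel) = ennreal (Gamma s)"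
    using Gamma_conv_nn_integral_real[OF assms(1)] by simp
  also have "ennreal \<bar>1 / x\<bar> * (ennreal (x powr (1 - s)) * ennreal (Gamma s)) = ennreal (Gamma s / x powr s)"
    using assms Gamma_real_pos[OF assms(1)]
    by (simp add: ennreal_mult[symmetric] powr_diff field_simps)
  finally have "(?h has_integral Gamma s / x powr s) UNIV"
    using assms Gamma_real_pos[OF assms(1)]
    by (intro nn_integral_has_integral) (auto simp: indicator_def)
  moreover have "?h = (\<lambda>q. if q \<in> {0..} then q powr (s - 1) * exp (- x * q) else 0)"
    by (auto simp: fun_eq_iff)
  ultimately show ?thesis
    by (simp only: has_integral_restrict_UNIV)
qed

text \<open>The value of the Laplace integral of \<open>sqrt (2 * q) * q ^ k\<close> over the half line, which is the
\<open>k\<close>-th term of every asymptotic expansion below.\<close>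

definition exp_moment :: "nat \<Rightarrow> real \<Rightarrow> real" where
  "exp_moment k x = sqrt (pi / 2) * pochhammer (3 / 2) k / (x * sqrt x * x ^ k)"

lemma pos_not_nonpos_Ints: "0 < r \<Longrightarrow> r \<notin> \<int>\<^sub>\<le>\<^sub>0" for r :: real
  by (auto elim!: nonpos_Ints_cases)

lemma has_integral_exp_moment:
  assumes "0 < x"
  shows "((\<lambda>q. sqrt (2 * q) * q ^ k * exp (- x * q)) has_integral exp_moment k x) {0..}"
proof -
  have "Gamma (3 / 2 + of_nat k) = pochhammer (3 / 2) k * Gamma (3 / 2 :: real)"
  proof -
    have "Gamma (3 / 2 :: real) \<noteq> 0" by (rule less_imp_neq[symmetric]) simp
    then show ?thesis
      using pochhammer_Gamma[of "3 / 2 :: real" k] pos_not_nonpos_Ints[of "3 / 2"]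
      by (auto simp: field_simps)
  qed
  moreover have "Gamma (3 / 2 :: real) = sqrt pi / 2"
    using Gamma_plus1[of "1 / 2 :: real"] pos_not_nonpos_Ints[of "1 / 2"] by (auto simp: Gamma_one_half_real)
  moreover have "x powr (3 / 2 + real k) = x * sqrt x * x ^ k"
    using assms powr_add[of x 1 "1 / 2"] by (simp add: powr_add powr_realpow powr_half_sqrt)
  moreover have "sqrt 2 * (sqrt pi / 2) = sqrt (pi / 2)"
    using real_sqrt_mult[of 2 2] by (simp add: real_sqrt_divide field_simps)
  then have "sqrt 2 * (pochhammer (3 / 2) k * (sqrt pi / 2)) = sqrt (pi / 2) * pochhammer (3 / 2) k"
    by (metis mult.commute mult.assoc)
  ultimately have "sqrt 2 * (Gamma (3 / 2 + real k) / x powr (3 / 2 + real k)) = exp_moment k x"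
    by (simp only: exp_moment_def times_divide_eq_right)
  moreover have "((\<lambda>q. sqrt 2 * (q powr (3 / 2 + real k - 1) * exp (- x * q)))
      has_integral sqrt 2 * (Gamma (3 / 2 + real k) / x powr (3 / 2 + real k))) {0..}"
    using assms by (intro has_integral_mult_right has_integral_powr_exp) auto
  ultimately show ?thesis
  proof (elim has_integral_eq_rhs[rotated] has_integral_eq[rotated] subst)
    fix q :: real assume "q \<in> {0..}"
    then have "0 \<le> q" by simp
    then have "q powr (1 / 2 + real k) = sqrt q * q ^ k"
      by (cases "q = 0") (simp_all add: powr_add powr_realpow powr_half_sqrt)
    then show "sqrt 2 * (q powr (3 / 2 + real k - 1) * exp (- x * q)) = sqrt (2 * q) * q ^ k * exp (- x * q)"
      by (simp add: real_sqrt_mult)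
  qed
qed

text \<open>Substituting \<open>s = 1 - q\<close> in the Poisson integral of \<open>I\<^sub>1\<close> gives a Laplace integral over \<open>{0..2}\<close>
with density \<open>sqrt (2 * q) * sqrt (1 - q / 2)\<close>. A cubic minorant of the second root yields the first terms of the
asymptotic series; beyond \<open>q = 2\<close> the minorant is negative, so the integral may be extended to the half line.\<close>

lemma bessel_lower_bound:
  assumes "0 < y"
  shows "exp y / (sqrt (2 * pi) * (y * sqrt y)) * (1 - 3 / (8 * y) - 15 / (128 * y\<^sup>2) - 315 / (512 * y ^ 3))
    \<le> bessel (y\<^sup>2)"
proof -
  let ?f = "\<lambda>q. semicircle (1 - q) * exp (- y * q)"
  let ?P = "\<lambda>q::real. 1 - q / 4 - q\<^sup>2 / 32 - 3 * q ^ 3 / 64"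
  have cosh: "((\<lambda>s. semicircle s * cosh (y * s)) has_integral pi * bessel (y\<^sup>2)) {-1..1}"
    unfolding integral_semicircle_cosh[symmetric]
    by (intro integrable_integral integrable_continuous_interval continuous_intros)
  define I where "I = integral {-1..1} (\<lambda>s. semicircle s * exp (y * s))"
  have I: "((\<lambda>s. semicircle s * exp (y * s)) has_integral I) {-1..1}"
    unfolding I_def by (intro integrable_integral integrable_continuous_interval continuous_intros)
  have "((\<lambda>s. semicircle (- s) * exp (y * - s)) has_integral I) {-1..1}"
    using has_integral_reflect_real[of "\<lambda>s. semicircle s * exp (y * s)" I 1 "-1"] I by simp
  from has_integral_divide[OF has_integral_add[OF I this], of 2]
  have "((\<lambda>s. semicircle s * cosh (y * s)) has_integral I) {-1..1}"
    by (simp add: cosh_field_def algebra_simps add_divide_distrib)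
  with cosh have I_eq: "I = pi * bessel (y\<^sup>2)" by (rule has_integral_unique[rotated])
  have "((\<lambda>q. semicircle (-1 * q + 1) * exp (y * (-1 * q + 1))) has_integral I) ((\<lambda>x. (1 / -1) *\<^sub>R x + - ((1 / -1) *\<^sub>R 1)) ` {-1..1})"
    using has_integral_affinity[of "\<lambda>s. semicircle s * exp (y * s)" I "-1" 1 "-1" 1] I by simp
  moreover have "(\<lambda>x. (1 / -1) *\<^sub>R x + - ((1 / -1) *\<^sub>R 1)) ` {-1..1} = {0..2::real}"
  proof -
    have "(\<lambda>x. (1 / -1) *\<^sub>R x + - ((1 / -1) *\<^sub>R 1)) = (\<lambda>x::real. 1 - x)" by (auto simp: fun_eq_iff)
    then show ?thesis by (simp only: image_diff_atLeastAtMost) simp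
  qed
  ultimately have "((\<lambda>q. exp y * ?f q) has_integral I) {0..2}"
    by (simp add: exp_add exp_diff exp_minus algebra_simps divide_inverse)
  from has_integral_mult_right[OF this, of "exp (- y)"]
  have f: "(?f has_integral exp (- y) * I) {0..2}"
    by (simp add: exp_minus field_simps)
  then have upper: "((\<lambda>q. if q \<in> {0..2} then ?f q else 0) has_integral exp (- y) * I) {0..}"
    by (subst has_integral_restrict) auto
  have "((\<lambda>q. sqrt (2 * q) * q ^ 0 * exp (- y * q) - 1 / 4 * (sqrt (2 * q) * q ^ 1 * exp (- y * q))
      - 1 / 32 * (sqrt (2 * q) * q ^ 2 * exp (- y * q)) - 3 / 64 * (sqrt (2 * q) * q ^ 3 * exp (- y * q)))
      has_integral exp_moment 0 y - 1 / 4 * exp_moment 1 y - 1 / 32 * exp_moment 2 y - 3 / 64 * exp_moment 3 y) {0..}"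
    using assms by (intro has_integral_diff has_integral_mult_right has_integral_exp_moment) auto
  from this upper have "exp_moment 0 y - 1 / 4 * exp_moment 1 y - 1 / 32 * exp_moment 2 y - 3 / 64 * exp_moment 3 y \<le> exp (- y) * I"
  proof (rule has_integral_le)
    fix q :: real assume "q \<in> {0..}"
    then have q: "0 \<le> q" by simp
    have eq: "sqrt (2 * q) * q ^ 0 * exp (- y * q) - 1 / 4 * (sqrt (2 * q) * q ^ 1 * exp (- y * q))
      - 1 / 32 * (sqrt (2 * q) * q ^ 2 * exp (- y * q)) - 3 / 64 * (sqrt (2 * q) * q ^ 3 * exp (- y * q))
      = sqrt (2 * q) * ?P q * exp (- y * q)"
      by (simp add: algebra_simps)
    show "sqrt (2 * q) * q ^ 0 * exp (- y * q) - 1 / 4 * (sqrt (2 * q) * q ^ 1 * exp (- y * q))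
      - 1 / 32 * (sqrt (2 * q) * q ^ 2 * exp (- y * q)) - 3 / 64 * (sqrt (2 * q) * q ^ 3 * exp (- y * q))
      \<le> (if q \<in> {0..2} then ?f q else 0)"
    proof (cases "q \<le> 2")
      case True
      have "semicircle (1 - q) = sqrt (2 * q * (1 - q / 2))"
        by (rule arg_cong[of _ _ sqrt]) (simp add: power2_eq_square algebra_simps)
      then have c: "semicircle (1 - q) = sqrt (2 * q) * sqrt (1 - q / 2)"
        by (simp only: real_sqrt_mult)
      \<comment> \<open>the binomial series of \<open>sqrt (1 - q / 2)\<close> to second order; its cubic coefficient \<open>1 / 128\<close> is replaced by \<open>3 / 64\<close>, which makes \<open>?P 2 = 0\<close>, so that \<open>?P\<close> is a lower bound up to the end point\<close>
      have "?P q \<le> sqrt (1 - q / 2)"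
      proof (rule real_le_rsqrt)
        have "1 - q / 2 - (?P q)\<^sup>2 = (q / 2) ^ 3 * (40 - 25 * (q / 2) - 6 * (q / 2) ^ 2 - 9 * (q / 2) ^ 3) / 64"
          by (simp add: field_simps eval_nat_numeral)
        moreover have "(q / 2) ^ 2 \<le> 1" "(q / 2) ^ 3 \<le> 1"
          using True q by (auto intro!: power_le_one)
        then have "0 \<le> (q / 2) ^ 3 * (40 - 25 * (q / 2) - 6 * (q / 2) ^ 2 - 9 * (q / 2) ^ 3) / 64"
          using True q by (intro divide_nonneg_pos mult_nonneg_nonneg zero_le_power) linarith+
        ultimately show "(?P q)\<^sup>2 \<le> 1 - q / 2" by linarith
      qed
      then show ?thesis
        unfolding eq using True q c by (simp add: mult_left_mono mult_right_mono)
    next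
      case False
      have "2 ^ 2 \<le> q ^ 2" "2 ^ 3 \<le> q ^ 3" using False by (intro power_mono; simp)+
      then have "?P q \<le> 0" using False by simp
      then show ?thesis
        unfolding eq using False q by (simp add: mult_nonneg_nonpos mult_nonpos_nonneg)
    qed
  qed
  also have "exp_moment 0 y - 1 / 4 * exp_moment 1 y - 1 / 32 * exp_moment 2 y - 3 / 64 * exp_moment 3 y
      = sqrt (pi / 2) / (y * sqrt y) * (1 - 3 / (8 * y) - 15 / (128 * y\<^sup>2) - 315 / (512 * y ^ 3))"
    using assms by (simp add: exp_moment_def eval_nat_numeral pochhammer_Suc field_simps)
  finally have "exp y * (sqrt (pi / 2) / (y * sqrt y) * (1 - 3 / (8 * y) - 15 / (128 * y\<^sup>2) - 315 / (512 * y ^ 3)))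
      \<le> exp y * (exp (- y) * I)"
    by (intro mult_left_mono) auto
  also have "exp y * (exp (- y) * I) = pi * bessel (y\<^sup>2)"
    unfolding I_eq by (simp add: exp_minus)
  finally have "exp y * (sqrt (pi / 2) / (y * sqrt y)
      * (1 - 3 / (8 * y) - 15 / (128 * y\<^sup>2) - 315 / (512 * y ^ 3))) / pi \<le> pi * bessel (y\<^sup>2) / pi"
    by (rule divide_right_mono) simp
  then have "exp y * (sqrt (pi / 2) / (y * sqrt y)) / pi
      * (1 - 3 / (8 * y) - 15 / (128 * y\<^sup>2) - 315 / (512 * y ^ 3)) \<le> bessel (y\<^sup>2)"
    by simp
  moreover have "exp y * (sqrt (pi / 2) / (y * sqrt y)) / pi = exp y / (sqrt (2 * pi) * (y * sqrt y))"
  proof -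
    have "sqrt (pi / 2) * sqrt (2 * pi) = pi" by (simp add: real_sqrt_mult[symmetric])
    then show ?thesis using assms by (simp add: field_simps)
  qed
  ultimately show ?thesis by (simp only:)
qed

section \<open>Asymptotics of the Bessel function by a contour shift\<close>

lemma continuous_on_csqrt_comp:
  fixes g :: "complex \<Rightarrow> complex"
  assumes "continuous_on S g" and "\<And>z. z \<in> S \<Longrightarrow> g z \<notin> \<real>\<^sub>\<le>\<^sub>0 \<or> g z = 0"
  shows "continuous_on S (\<lambda>z. csqrt (g z))"
  unfolding continuous_on_def
proof
  fix z assume z: "z \<in> S"
  have g: "(g \<longlongrightarrow> g z) (at z within S)"
    using assms(1) z by (auto simp: continuous_on_def)
  show "((\<lambda>z. csqrt (g z)) \<longlongrightarrow> csqrt (g z)) (at z within S)"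
  proof (cases "g z = 0")
    case True
    have "((\<lambda>z. sqrt (norm (g z))) \<longlongrightarrow> sqrt (norm (g z))) (at z within S)"
      by (intro tendsto_intros g)
    then have "((\<lambda>z. norm (csqrt (g z))) \<longlongrightarrow> 0) (at z within S)"
      using True by (simp only: norm_csqrt norm_zero real_sqrt_zero)
    then have "((\<lambda>z. csqrt (g z)) \<longlongrightarrow> 0) (at z within S)"
      by (rule tendsto_norm_zero_cancel)
    then show ?thesis using True by simp
  next
    case False
    then have "isCont csqrt (g z)" using assms(2)[OF z] by (simp add: continuous_at_csqrt)
    then show ?thesis by (rule isCont_tendsto_compose[OF _ g])
  qed
qed

text \<open>The value of \<open>csqrt (1 - z\<^sup>2)\<close> on the vertical ray \<open>z = 1 + \<i> * q\<close>, without its constant phase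
\<open>cis (- pi / 4)\<close>.\<close>

definition hankel_kernel :: "real \<Rightarrow> complex" where
  "hankel_kernel q = of_real (sqrt (2 * q)) * csqrt (1 + \<i> * of_real q / 2)"

lemma continuous_hankel_kernel [continuous_intros]: "continuous_on S hankel_kernel"
proof -
  have "1 + \<i> * of_real q / 2 \<notin> \<real>\<^sub>\<le>\<^sub>0" for q :: real
    by (auto simp: complex_nonpos_Reals_iff)
  then show ?thesis
    unfolding hankel_kernel_def
    by (intro continuous_intros continuous_on_compose2[OF continuous_on_csqrt]) auto
qed

lemma csqrt_right_half_line:
  assumes "0 \<le> q"
  defines "w \<equiv> csqrt (1 + \<i> * of_real q / 2)"
  shows "w\<^sup>2 = 1 + \<i> * of_real q / 2" and "1 \<le> Re w" and "0 \<le> Im w"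
    and "norm (w - 1) \<le> q / 4"
proof -
  let ?z = "1 + \<i> * of_real q / 2"
  show sq: "w\<^sup>2 = ?z" unfolding w_def by simp
  have "1 \<le> cmod ?z" using complex_Re_le_cmod[of ?z] by simp
  then show Re: "1 \<le> Re w" unfolding w_def by simp
  have "Re w * Im w = q / 4"
    using arg_cong[OF sq, of Im] by (simp add: power2_eq_square mult.commute)
  then have "0 \<le> Re w * Im w" using assms(1) by simp
  then show "0 \<le> Im w" using Re by (simp add: zero_le_mult_iff)
  have "(w - 1) * (w + 1) = \<i> * of_real q / 2"
    using sq by (simp add: algebra_simps power2_eq_square)
  then have "norm (w - 1) * norm (w + 1) = q / 2"
    using assms(1) by (metis norm_mult norm_ii mult_1 norm_of_real abs_of_nonneg norm_divide norm_numeral)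
  moreover have "2 \<le> norm (w + 1)"
    using complex_Re_le_cmod[of "w + 1"] Re by simp
  ultimately have "norm (w - 1) * 2 \<le> q / 2"
    by (metis mult_left_mono norm_ge_zero)
  then show "norm (w - 1) \<le> q / 4" by simp
qed

lemma hankel_kernel_approx:
  assumes "0 \<le> q"
  shows "norm (hankel_kernel q - of_real (sqrt (2 * q))) \<le> sqrt (2 * q) * (q / 4)"
    and "norm (hankel_kernel q) \<le> sqrt (2 * q) * (1 + q / 4)"
proof -
  define w where "w = csqrt (1 + \<i> * of_real q / 2)"
  have w: "norm (w - 1) \<le> q / 4" unfolding w_def by (rule csqrt_right_half_line[OF assms])
  have "hankel_kernel q - of_real (sqrt (2 * q)) = of_real (sqrt (2 * q)) * (w - 1)"
    by (simp add: hankel_kernel_def w_def algebra_simps)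
  then show "norm (hankel_kernel q - of_real (sqrt (2 * q))) \<le> sqrt (2 * q) * (q / 4)"
    using mult_left_mono[OF w, of "sqrt (2 * q)"] assms by (simp add: norm_mult)
  have "norm w \<le> 1 + q / 4" using w norm_triangle_sub[of w 1] by simp
  then show "norm (hankel_kernel q) \<le> sqrt (2 * q) * (1 + q / 4)"
    using assms unfolding hankel_kernel_def w_def[symmetric] by (simp add: norm_mult mult_left_mono)
qed

definition hankel :: "real \<Rightarrow> real \<Rightarrow> complex" where
  "hankel x Y = integral {0..Y} (\<lambda>q. hankel_kernel q * of_real (exp (- x * q)))"

lemma hankel_has_integral:
  "((\<lambda>q. hankel_kernel q * of_real (exp (- x * q))) has_integral hankel x Y) {0..Y}"
  unfolding hankel_def
  by (intro integrable_integral integrable_continuous_interval continuous_intros)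

lemma csqrt_right_edge:
  assumes "0 \<le> q"
  shows "csqrt (1 - (Complex 1 q)\<^sup>2) = cis (- pi / 4) * hankel_kernel q"
proof (cases "q = 0")
  case True
  then show ?thesis by (simp add: hankel_kernel_def complex_eq_iff power2_eq_square)
next
  case False
  define w where "w = csqrt (1 + \<i> * of_real q / 2)"
  note w = csqrt_right_half_line[OF assms, folded w_def]
  have hk: "hankel_kernel q = of_real (sqrt (2 * q)) * w" by (simp add: hankel_kernel_def w_def)
  have "(cis (- pi / 4))\<^sup>2 = - \<i>" by (simp add: Complex.DeMoivre complex_eq_iff)
  then have "(cis (- pi / 4) * hankel_kernel q)\<^sup>2 = - \<i> * (of_real (2 * q) * (1 + \<i> * of_real q / 2))"
    unfolding hk power_mult_distrib w(1) using assms by (simp add: of_real_power[symmetric] del: of_real_power)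
  also have "\<dots> = 1 - (Complex 1 q)\<^sup>2"
    by (simp add: complex_eq_iff power2_eq_square)
  finally have "(cis (- pi / 4) * hankel_kernel q)\<^sup>2 = 1 - (Complex 1 q)\<^sup>2" .
  moreover have "0 < Re (cis (- pi / 4) * hankel_kernel q)"
  proof -
    have "Re (cis (- pi / 4) * hankel_kernel q) = sqrt (2 * q) * (sqrt 2 / 2 * (Re w + Im w))"
      unfolding hk by (simp add: cos_45 sin_45 algebra_simps)
    moreover have "0 < sqrt (2 * q) * (sqrt 2 / 2 * (Re w + Im w))"
      using w(2,3) assms False by simp
    ultimately show ?thesis by (simp only:)
  qed
  ultimately show ?thesis by (intro csqrt_unique) auto
qed

text \<open>The integrand \<open>csqrt (1 - z\<^sup>2) * exp (\<i> * x * z)\<close> of the Poisson integral is moved from \<open>{0..1}\<close> to the other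
three sides of the rectangle of height \<open>Y\<close>. The ray over \<open>1\<close> gives a Laplace integral, the left side gives
only an imaginary part, and the top side is exponentially small.\<close>

lemma bessel_contour:
  assumes "0 < x" "0 < Y"
  shows "\<bar>bessel (- (x\<^sup>2)) - 2 / pi * Re (cis (x - 3 * pi / 4) * hankel x Y)\<bar> \<le> (2 + Y) * exp (- x * Y)"
proof -
  define f where "f z = csqrt (1 - z\<^sup>2) * exp (\<i> * of_real x * z)" for z
  let ?R = "cbox 0 (Complex 1 Y)"
  \<comment> \<open>the branch points \<open>\<plusminus>1\<close> and the cuts of the root touch the rectangle only in the corner \<open>1\<close>, where the root is still continuous\<close>
  have good: "1 - z\<^sup>2 \<notin> \<real>\<^sub>\<le>\<^sub>0 \<or> 1 - z\<^sup>2 = 0" if "z \<in> ?R" for z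
  proof -
    have z: "0 \<le> Re z" "Re z \<le> 1" "0 \<le> Im z" using that by (auto simp: in_cbox_complex_iff)
    have "(Re z)\<^sup>2 \<le> 1" using z by (simp add: power_le_one)
    moreover have "\<not> (Im z)\<^sup>2 \<le> - 1" using zero_le_power2[of "Im z"] by linarith
    ultimately show ?thesis
      using z \<open>\<not> (Im z)\<^sup>2 \<le> - 1\<close> by (auto simp: complex_nonpos_Reals_iff complex_eq_iff power2_eq_square)
  qed
  have contf: "continuous_on ?R f"
    unfolding f_def using good by (intro continuous_intros continuous_on_csqrt_comp) auto
  have "(f has_contour_integral 0) (rectpath 0 (Complex 1 Y))"
  proof (rule Cauchy_theorem_convex[OF contf])
    show "f field_differentiable at z" if "z \<in> interior ?R - {}" for z
    proof -
      have z: "0 < Re z" "Re z < 1" "0 < Im z" using that by (auto simp: in_box_complex_iff)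
      then have "1 - z\<^sup>2 \<notin> \<real>\<^sub>\<le>\<^sub>0"
        using zero_le_square[of "Im z"] unfolding complex_nonpos_Reals_iff power2_eq_square
        by auto
      then show ?thesis
        unfolding f_def
        by (intro field_differentiable_mult field_differentiable_compose[of "\<lambda>z. 1 - z\<^sup>2" _ csqrt, unfolded o_def]
            field_differentiable_at_csqrt field_differentiable_compose[of "\<lambda>z. \<i> * of_real x * z" _ exp, unfolded o_def]
            derivative_intros field_differentiable_within_exp)
    qed
    show "path_image (rectpath 0 (Complex 1 Y)) \<subseteq> ?R"
      using assms by (intro path_image_rectpath_subset_cbox) auto
  qed auto
  then have zero: "(f has_contour_integral 0) (linepath 0 1 +++ linepath 1 (Complex 1 Y)
      +++ linepath (Complex 1 Y) (Complex 0 Y) +++ linepath (Complex 0 Y) 0)"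
    by (simp add: rectpath_def Let_def one_complex.code zero_complex.code)
  have seg: "f contour_integrable_on linepath a b" if "a \<in> ?R" "b \<in> ?R" for a b
    using that by (intro contour_integrable_continuous_linepath continuous_on_subset[OF contf])
      (simp add: closed_segment_subset)
  have corners: "0 \<in> ?R" "1 \<in> ?R" "Complex 1 Y \<in> ?R" "Complex 0 Y \<in> ?R"
    using assms by (auto simp: in_cbox_complex_iff)
  obtain I1 I2 I3 I4 where I1: "(f has_contour_integral I1) (linepath 0 1)"
    and I2: "(f has_contour_integral I2) (linepath 1 (Complex 1 Y))"
    and I3: "(f has_contour_integral I3) (linepath (Complex 1 Y) (Complex 0 Y))"
    and I4: "(f has_contour_integral I4) (linepath (Complex 0 Y) 0)"
    using seg corners unfolding contour_integrable_on_def by metis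
  have "(f has_contour_integral (I1 + (I2 + (I3 + I4)))) (linepath 0 1 +++ linepath 1 (Complex 1 Y)
      +++ linepath (Complex 1 Y) (Complex 0 Y) +++ linepath (Complex 0 Y) 0)"
    by (intro has_contour_integral_join I1 I2 I3 I4 valid_path_join) auto
  with zero have sum0: "I1 + (I2 + (I3 + I4)) = 0"
    by (rule has_contour_integral_unique[rotated])
  have 1: "Re I1 = pi / 2 * bessel (- (x\<^sup>2))"
  proof -
    have "((\<lambda>s. f (of_real s)) has_integral I1) {0..1}"
      using I1 by (subst (asm) has_contour_integral_linepath_Reals_iff) auto
    from has_integral_linear[OF this bounded_linear_Re]
    have "((\<lambda>s. Re (f (of_real s))) has_integral Re I1) {0..1}" by (simp add: o_def)
    then have right: "((\<lambda>s. semicircle s * cos (x * s)) has_integral Re I1) {0..1}"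
    proof (rule has_integral_eq[rotated])
      fix s :: real assume "s \<in> {0..1}"
      then have "0 \<le> 1 - s\<^sup>2" by (simp add: power_le_one)
      then have "csqrt (of_real (1 - s\<^sup>2)) = of_real (semicircle s)" by (subst csqrt_of_real_nonneg) auto
      moreover have "exp (\<i> * of_real x * of_real s) = cis (x * s)" by (simp add: cis_conv_exp mult.assoc)
      ultimately have "f (of_real s) = of_real (semicircle s) * cis (x * s)" by (simp add: f_def)
      then show "Re (f (of_real s)) = semicircle s * cos (x * s)" by simp
    qed
    have "((\<lambda>s. semicircle (- s) * cos (x * - s)) has_integral Re I1) {-1..0}"
      using has_integral_reflect_real[of "\<lambda>s. semicircle s * cos (x * s)" "Re I1" 1 0] right by simp
    then have "((\<lambda>s. semicircle s * cos (x * s)) has_integral Re I1) {-1..0}" by simp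
    from has_integral_combine[OF _ _ this right]
    have "integral {-1..1} (\<lambda>s. semicircle s * cos (x * s)) = Re I1 + Re I1" by (intro integral_unique) simp
    then show ?thesis by (simp add: integral_semicircle_cos)
  qed
  have 2: "I2 = \<i> * (cis (x - pi / 4) * hankel x Y)"
  proof -
    have "((\<lambda>q. f (Complex 1 q)) has_integral (- \<i> * I2)) {0..Y}"
      using I2 assms by (subst (asm) has_contour_integral_linepath_same_Re_iff[where c = 1 and a = 0 and b = Y]) auto
    moreover have "((\<lambda>q. f (Complex 1 q)) has_integral cis (x - pi / 4) * hankel x Y) {0..Y}"
    proof (rule has_integral_eq[OF _ has_integral_mult_right[OF hankel_has_integral]])
      fix q assume "q \<in> {0..Y}"
      then have q: "0 \<le> q" by simp
      have "exp (\<i> * of_real x * Complex 1 q) = cis x * of_real (exp (- x * q))"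
        by (simp add: complex_eq_iff Re_exp Im_exp)
      moreover have "cis (x - pi / 4) = cis (- pi / 4) * cis x" by (simp add: cis_mult)
      ultimately show "cis (x - pi / 4) * (hankel_kernel q * of_real (exp (- x * q))) = f (Complex 1 q)"
        unfolding f_def csqrt_right_edge[OF q] by simp
    qed
    ultimately have "- \<i> * I2 = cis (x - pi / 4) * hankel x Y" by (rule has_integral_unique)
    then show ?thesis by (metis (no_types, lifting) i_squared mult.assoc mult_minus_left mult_minus1 minus_minus)
  qed
  have 3: "norm I3 \<le> (2 + Y) * exp (- x * Y)"
  proof -
    have "norm I3 \<le> ((2 + Y) * exp (- x * Y)) * norm (Complex 0 Y - Complex 1 Y)"
    proof (rule has_contour_integral_bound_linepath[OF I3])
      fix z assume "z \<in> closed_segment (Complex 1 Y) (Complex 0 Y)"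
      then have z: "0 \<le> Re z" "Re z \<le> 1" "Im z = Y"
        by (auto simp: closed_segment_def) (simp add: algebra_simps)
      have "norm z \<le> \<bar>Re z\<bar> + \<bar>Im z\<bar>" by (rule cmod_le)
      then have "norm z \<le> 1 + Y" using z assms by simp
      then have "norm (z\<^sup>2) \<le> (1 + Y)\<^sup>2" unfolding norm_power by (intro power_mono) auto
      then have "norm (1 - z\<^sup>2) \<le> (2 + Y)\<^sup>2"
        using norm_triangle_ineq4[of 1 "z\<^sup>2"] assms by (simp add: power2_eq_square algebra_simps)
      then have root: "norm (csqrt (1 - z\<^sup>2)) \<le> 2 + Y"
        using assms by (simp add: norm_csqrt real_le_lsqrt)
      have expn: "norm (exp (\<i> * of_real x * z)) = exp (- x * Y)"
        using z by simp
      show "norm (f z) \<le> (2 + Y) * exp (- x * Y)"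
        unfolding f_def norm_mult expn by (rule mult_right_mono[OF root]) simp
    qed (use assms in auto)
    also have "norm (Complex 0 Y - Complex 1 Y) = 1" by (simp add: cmod_def)
    finally show ?thesis by simp
  qed
  \<comment> \<open>on the imaginary axis the root and the exponential are real, so the integral is imaginary\<close>
  have 4: "Re I4 = 0"
  proof -
    have "(f has_contour_integral (- I4)) (linepath 0 (Complex 0 Y))"
      using has_contour_integral_reversepath[OF _ I4] by simp
    then have "((\<lambda>q. f (Complex 0 q)) has_integral (- \<i> * - I4)) {0..Y}"
      using assms by (subst (asm) has_contour_integral_linepath_same_Re_iff[where c = 0 and a = 0 and b = Y]) auto
    from has_integral_linear[OF this bounded_linear_Im]
    have "((\<lambda>q. Im (f (Complex 0 q))) has_integral Re I4) {0..Y}" by (simp add: o_def)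
    moreover have "Im (f (Complex 0 q)) = 0" for q
    proof -
      have "1 - (Complex 0 q)\<^sup>2 = of_real (1 + q\<^sup>2)" by (simp add: complex_eq_iff power2_eq_square)
      then have "csqrt (1 - (Complex 0 q)\<^sup>2) = of_real (sqrt (1 + q\<^sup>2))"
        by (simp only:) (subst csqrt_of_real_nonneg, auto)
      moreover have "exp (\<i> * of_real x * Complex 0 q) = of_real (exp (- x * q))"
        by (simp add: complex_eq_iff Re_exp Im_exp)
      ultimately show ?thesis unfolding f_def by simp
    qed
    ultimately show ?thesis using has_integral_unique[OF _ has_integral_0] by fastforce
  qed
  have "\<i> * cis (x - pi / 4) = - cis (x - 3 * pi / 4)"
  proof -
    have "x - pi / 4 = x - 3 * pi / 4 + pi / 2" by simp
    then have "cis (x - pi / 4) = cis (x - 3 * pi / 4) * \<i>"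
      using cis_mult[of "x - 3 * pi / 4" "pi / 2"] by simp
    then show ?thesis by (simp only: mult.left_commute[of \<i> _ \<i>] i_squared) simp
  qed
  then have "I2 = - (cis (x - 3 * pi / 4) * hankel x Y)"
    unfolding 2 by (simp add: mult.assoc[symmetric])
  moreover define H where "H = Re (cis (x - 3 * pi / 4) * hankel x Y)"
  ultimately have "Re I2 = - H" by simp
  then have "pi / 2 * bessel (- (x\<^sup>2)) - H = - Re I3"
    using arg_cong[OF sum0, of Re] 1 4 by simp
  then have "bessel (- (x\<^sup>2)) - 2 / pi * H = - (2 / pi) * Re I3"
    by (simp add: field_simps) (simp flip: distrib_left)
  then have "\<bar>bessel (- (x\<^sup>2)) - 2 / pi * Re (cis (x - 3 * pi / 4) * hankel x Y)\<bar> = 2 / pi * \<bar>Re I3\<bar>"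
    unfolding H_def[symmetric] by (simp add: abs_mult)
  also have "\<dots> \<le> 1 * norm I3"
    using pi_ge_two by (intro mult_mono abs_Re_le_cmod) auto
  also have "\<dots> \<le> (2 + Y) * exp (- x * Y)" using 3 by simp
  finally show ?thesis .
qed

text \<open>The truncated Laplace integrals of the contour argument are compared with complete ones, whose values are known.\<close>

lemma integral_norm_le_half_line:
  fixes f :: "real \<Rightarrow> 'a::euclidean_space"
  assumes f: "(f has_integral I) {0..Y}" and g: "(g has_integral G) {0..}"
    and le: "\<And>q. 0 \<le> q \<Longrightarrow> norm (f q) \<le> g q"
  shows "norm I \<le> G"
proof -
  have gY: "g integrable_on {0..Y}"
    using g by (intro integrable_on_subinterval[of g "{0..}"]) (auto simp: has_integral_integrable)
  have "norm (integral {0..Y} f) \<le> integral {0..Y} g"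
    using f gY le by (intro integral_norm_bound_integral) (auto simp: has_integral_integrable)
  also have "\<dots> \<le> integral {0..} g"
    using gY g le by (intro integral_subset_le) (auto simp: has_integral_integrable intro: order_trans[OF norm_ge_zero])
  finally show ?thesis using f g by (simp add: integral_unique)
qed

text \<open>The amplitude of the leading cosine in the large argument asymptotics of \<open>J\<^sub>1(x) / x\<close>.\<close>

definition amplitude :: "real \<Rightarrow> real" where "amplitude x = sqrt (2 / pi) / (x * sqrt x)"

lemma amplitude_pos: "0 < x \<Longrightarrow> 0 < amplitude x"
  by (simp add: amplitude_def)

lemma exp_moment_amplitude: "2 / pi * exp_moment k x = amplitude x * (pochhammer (3 / 2) k / x ^ k)"
proof -
  have "2 / pi * sqrt (pi / 2) = sqrt (2 / pi)"
    by (intro real_sqrt_unique[symmetric]) (auto simp: power_mult_distrib power_divide power2_eq_square)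
  then have "2 / pi * exp_moment k x = sqrt (2 / pi) * pochhammer (3 / 2) k / (x * sqrt x * x ^ k)"
    unfolding exp_moment_def by (metis times_divide_eq_right mult.assoc)
  then show ?thesis by (simp add: amplitude_def)
qed

lemma hankel_main_limit:
  assumes "0 < x"
  shows "(\<lambda>k. integral {0..real (Suc k)} (\<lambda>q. sqrt (2 * q) * exp (- x * q))) \<longlonglongrightarrow> exp_moment 0 x"
proof -
  let ?g = "\<lambda>q. sqrt (2 * q) * exp (- x * q)"
  have g: "(?g has_integral exp_moment 0 x) {0..}" using has_integral_exp_moment[OF assms, of 0] by simp
  have "(\<lambda>k. integral {0..} (\<lambda>q. if q \<in> {0..real (Suc k)} then ?g q else 0)) \<longlonglongrightarrow> integral {0..} ?g"
  proof (rule dominated_convergence(2))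
    show "(\<lambda>q. if q \<in> {0..real (Suc k)} then ?g q else 0) integrable_on {0..}" for k
      using integrable_restrict_Int[of "{0..real (Suc k)}" ?g "{0..}"]
      by (auto intro!: integrable_continuous_interval continuous_intros simp: Int_absorb2)
    show "?g integrable_on {0..}" using g by (rule has_integral_integrable)
    show "(\<lambda>k. if q \<in> {0..real (Suc k)} then ?g q else 0) \<longlonglongrightarrow> ?g q" if "q \<in> {0..}" for q
    proof (rule tendsto_eventually)
      have "eventually (\<lambda>k. q \<le> real k) sequentially"
        using eventually_ge_at_top[of "nat \<lceil>q\<rceil>"] by eventually_elim linarith
      then show "eventually (\<lambda>k. (if q \<in> {0..real (Suc k)} then ?g q else 0) = ?g q) sequentially"
        by eventually_elim (use that in auto)
    qed
  qed auto
  moreover have "integral {0..} (\<lambda>q. if q \<in> {0..real (Suc k)} then ?g q else 0) = integral {0..real (Suc k)} ?g" for k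
    using integral_restrict_Int[of "{0..}" "{0..real (Suc k)}" ?g] by (auto simp: Int_absorb1 Int_absorb2)
  ultimately show ?thesis using integral_unique[OF g] by simp
qed

lemma top_edge_limit:
  assumes "0 < x"
  shows "(\<lambda>k. (2 + real (Suc k)) * exp (- x * real (Suc k))) \<longlonglongrightarrow> 0"
proof -
  have "((\<lambda>Y. (2 + Y) * exp (- x * Y)) \<longlongrightarrow> 0) at_top" using assms by real_asymp
  then show ?thesis
    by (rule filterlim_compose) (rule filterlim_compose[OF filterlim_real_sequentially filterlim_Suc])
qed

text \<open>Replacing the kernel by \<open>sqrt (2 * q)\<close> costs at most a factor \<open>q / 4\<close> under the integral, which turns the moment of order
\<open>0\<close> into that of order \<open>1\<close>; then the height of the rectangle tends to infinity.\<close>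

lemma bessel_asymptotic:
  assumes "0 < x"
  shows "\<bar>bessel (- (x\<^sup>2)) - amplitude x * cos (x - 3 * pi / 4)\<bar> \<le> amplitude x * (3 / (8 * x))"
proof -
  define A where "A Y = integral {0..Y} (\<lambda>q. sqrt (2 * q) * exp (- x * q))" for Y
  define ph where "ph = x - 3 * pi / 4"
  have "\<bar>bessel (- (x\<^sup>2)) - 2 / pi * (cos ph * A Y)\<bar> \<le> amplitude x * (3 / (8 * x)) + (2 + Y) * exp (- x * Y)"
    if "0 < Y" for Y
  proof -
    have A: "((\<lambda>q. of_real (sqrt (2 * q) * exp (- x * q))) has_integral complex_of_real (A Y)) {0..Y}"
      unfolding A_def by (intro has_integral_of_real integrable_integral integrable_continuous_interval continuous_intros)
    have "norm (hankel x Y - of_real (A Y)) \<le> 1 / 4 * exp_moment 1 x"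
    proof (rule integral_norm_le_half_line[OF has_integral_diff[OF hankel_has_integral A]
            has_integral_mult_right[OF has_integral_exp_moment[OF assms]]])
      fix q :: real assume q: "0 \<le> q"
      have "hankel_kernel q * of_real (exp (- x * q)) - of_real (sqrt (2 * q) * exp (- x * q))
          = (hankel_kernel q - of_real (sqrt (2 * q))) * of_real (exp (- x * q))"
        by (simp add: algebra_simps)
      then have "norm (hankel_kernel q * of_real (exp (- x * q)) - of_real (sqrt (2 * q) * exp (- x * q)))
          = norm (hankel_kernel q - of_real (sqrt (2 * q))) * exp (- x * q)"
        by (simp add: norm_mult)
      also have "\<dots> \<le> sqrt (2 * q) * (q / 4) * exp (- x * q)"
        by (intro mult_right_mono hankel_kernel_approx q) simp
      finally show "norm (hankel_kernel q * of_real (exp (- x * q)) - of_real (sqrt (2 * q) * exp (- x * q)))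
        \<le> 1 / 4 * (sqrt (2 * q) * q ^ 1 * exp (- x * q))" by simp
    qed
    then have "norm (cis ph * (hankel x Y - of_real (A Y))) \<le> 1 / 4 * exp_moment 1 x"
      by (simp add: norm_mult)
    then have "\<bar>Re (cis ph * (hankel x Y - of_real (A Y)))\<bar> \<le> 1 / 4 * exp_moment 1 x"
      using abs_Re_le_cmod order_trans by blast
    moreover have "Re (cis ph * (hankel x Y - of_real (A Y))) = Re (cis ph * hankel x Y) - cos ph * A Y"
      by (simp add: algebra_simps)
    ultimately have "\<bar>Re (cis ph * hankel x Y) - cos ph * A Y\<bar> \<le> 1 / 4 * exp_moment 1 x"
      by (simp only:)
    then have "2 / pi * \<bar>Re (cis ph * hankel x Y) - cos ph * A Y\<bar> \<le> 2 / pi * (1 / 4 * exp_moment 1 x)"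
      by (rule mult_left_mono) simp
    also have "\<dots> = amplitude x * (3 / (8 * x))" using exp_moment_amplitude[of 1 x] by simp
    finally have "\<bar>2 / pi * Re (cis ph * hankel x Y) - 2 / pi * (cos ph * A Y)\<bar> \<le> amplitude x * (3 / (8 * x))"
      unfolding right_diff_distrib[symmetric] abs_mult by simp
    then show ?thesis using bessel_contour[OF assms that] unfolding ph_def by linarith
  qed
  from this[of "real (Suc _)"]
  have "\<bar>bessel (- (x\<^sup>2)) - 2 / pi * (cos ph * A (real (Suc k)))\<bar>
      \<le> amplitude x * (3 / (8 * x)) + (2 + real (Suc k)) * exp (- x * real (Suc k))" for k
    by (simp only: of_nat_0_less_iff zero_less_Suc)
  moreover have "(\<lambda>k. \<bar>bessel (- (x\<^sup>2)) - 2 / pi * (cos ph * A (real (Suc k)))\<bar>)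
      \<longlonglongrightarrow> \<bar>bessel (- (x\<^sup>2)) - 2 / pi * (cos ph * exp_moment 0 x)\<bar>"
    unfolding A_def by (intro tendsto_intros hankel_main_limit assms)
  moreover have "(\<lambda>k. amplitude x * (3 / (8 * x)) + (2 + real (Suc k)) * exp (- x * real (Suc k)))
      \<longlonglongrightarrow> amplitude x * (3 / (8 * x)) + 0"
    by (intro tendsto_intros top_edge_limit assms)
  ultimately have "\<bar>bessel (- (x\<^sup>2)) - 2 / pi * (cos ph * exp_moment 0 x)\<bar> \<le> amplitude x * (3 / (8 * x)) + 0"
    by (intro LIMSEQ_le) auto
  moreover have "2 / pi * (cos ph * exp_moment 0 x) = amplitude x * cos ph"
    using exp_moment_amplitude[of 0 x] by (simp add: field_simps)
  ultimately show ?thesis by (simp add: ph_def)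
qed

lemma norm_cis_diff: "norm (cis a - cis b) \<le> \<bar>a - b\<bar>"
proof -
  have "(norm (cis a - cis b))\<^sup>2 = (cos a - cos b)\<^sup>2 + (sin a - sin b)\<^sup>2"
    by (simp add: cmod_power2)
  also have "\<dots> = ((cos a)\<^sup>2 + (sin a)\<^sup>2) + ((cos b)\<^sup>2 + (sin b)\<^sup>2) - 2 * (cos a * cos b + sin a * sin b)"
    by (simp add: power2_eq_square algebra_simps)
  also have "\<dots> = 2 - 2 * cos (2 * ((a - b) / 2))"
    unfolding nonzero_mult_div_cancel_left[OF zero_neq_numeral[symmetric]] times_divide_eq_right
    using cos_diff[of a b] by simp
  also have "\<dots> = 4 * (sin ((a - b) / 2))\<^sup>2"
    unfolding cos_double_sin by simp
  also have "\<dots> \<le> 4 * ((a - b) / 2)\<^sup>2"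
    using abs_sin_x_le_abs_x[of "(a - b) / 2"] by (intro mult_left_mono iffD1[OF abs_le_square_iff]) auto
  also have "\<dots> = \<bar>a - b\<bar>\<^sup>2" by (simp add: power_divide)
  finally show ?thesis by (rule power2_le_imp_le) simp
qed

lemma exp_diff_bound:
  fixes x y q \<xi> :: real
  assumes "\<xi> \<le> x" "\<xi> \<le> y" "0 \<le> q"
  shows "\<bar>exp (- x * q) - exp (- y * q)\<bar> \<le> \<bar>x - y\<bar> * (q * exp (- \<xi> * q))"
proof -
  have *: "exp (- x * q) - exp (- y * q) \<le> (y - x) * (q * exp (- \<xi> * q))" if "\<xi> \<le> x" "x \<le> y" for x y
  proof -
    have "exp (- x * q) - exp (- y * q) = exp (- x * q) * (1 - exp (- ((y - x) * q)))"
      by (simp add: algebra_simps exp_add[symmetric] exp_diff[symmetric])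
    also have "\<dots> \<le> exp (- \<xi> * q) * ((y - x) * q)"
    proof (rule mult_mono)
      show "1 - exp (- ((y - x) * q)) \<le> (y - x) * q" using exp_ge_add_one_self[of "- ((y - x) * q)"] by simp
    qed (use that assms in \<open>auto intro!: mult_right_mono mult_nonneg_nonneg\<close>)
    finally show ?thesis by (simp add: mult_ac)
  qed
  have mono: "exp (- y * q) \<le> exp (- x * q)" if "x \<le> y" for x y
    using that assms(3) by (simp add: mult_right_mono)
  show ?thesis using *[of x y] *[of y x] mono[of x y] mono[of y x] assms by (cases "x \<le> y") auto
qed

text \<open>Two values of the function are compared through their Laplace integrals, so that the difference keeps the decay
\<open>x powr (- 3 / 2)\<close> of the function itself. A bound on the derivative would need asymptotics of another Bessel function.\<close>

lemma bessel_lipschitz: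
  assumes "0 < \<xi>" "\<xi> \<le> x" "\<xi> \<le> y"
  shows "\<bar>bessel (- (x\<^sup>2)) - bessel (- (y\<^sup>2))\<bar>
    \<le> amplitude \<xi> * (1 + 15 / (8 * \<xi>) + 15 / (16 * \<xi>\<^sup>2)) * \<bar>x - y\<bar>"
proof -
  define C where "C = amplitude \<xi> * (1 + 15 / (8 * \<xi>) + 15 / (16 * \<xi>\<^sup>2)) * \<bar>x - y\<bar>"
  have pos: "0 < x" "0 < y" using assms by auto
  have "\<bar>bessel (- (x\<^sup>2)) - bessel (- (y\<^sup>2))\<bar> \<le> C + ((2 + Y) * exp (- x * Y) + (2 + Y) * exp (- y * Y))"
    if "0 < Y" for Y
  proof -
    have h: "norm (hankel x Y) \<le> exp_moment 0 \<xi> + 1 / 4 * exp_moment 1 \<xi>"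
    proof (rule integral_norm_le_half_line[OF hankel_has_integral has_integral_add[OF
            has_integral_exp_moment[OF assms(1)] has_integral_mult_right[OF has_integral_exp_moment[OF assms(1)]]]])
      fix q :: real assume q: "0 \<le> q"
      have "norm (hankel_kernel q) * exp (- x * q) \<le> sqrt (2 * q) * (1 + q / 4) * exp (- \<xi> * q)"
        using assms q by (intro mult_mono hankel_kernel_approx) (auto intro: mult_right_mono)
      then show "norm (hankel_kernel q * of_real (exp (- x * q)))
          \<le> sqrt (2 * q) * q ^ 0 * exp (- \<xi> * q) + 1 / 4 * (sqrt (2 * q) * q ^ 1 * exp (- \<xi> * q))"
        by (simp add: norm_mult algebra_simps)
    qed
    have d: "norm (hankel x Y - hankel y Y) \<le> \<bar>x - y\<bar> * (exp_moment 1 \<xi> + 1 / 4 * exp_moment 2 \<xi>)"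
    proof (rule integral_norm_le_half_line[OF has_integral_diff[OF hankel_has_integral hankel_has_integral]
          has_integral_mult_right[OF has_integral_add[OF
            has_integral_exp_moment[OF assms(1)] has_integral_mult_right[OF has_integral_exp_moment[OF assms(1)]]]]])
      fix q :: real assume q: "0 \<le> q"
      have "hankel_kernel q * of_real (exp (- x * q)) - hankel_kernel q * of_real (exp (- y * q))
          = hankel_kernel q * of_real (exp (- x * q) - exp (- y * q))" by (simp add: algebra_simps)
      then have "norm (hankel_kernel q * of_real (exp (- x * q)) - hankel_kernel q * of_real (exp (- y * q)))
          = norm (hankel_kernel q) * \<bar>exp (- x * q) - exp (- y * q)\<bar>"
        by (simp only: norm_mult norm_of_real)
      also have "\<dots> \<le> sqrt (2 * q) * (1 + q / 4) * (\<bar>x - y\<bar> * (q * exp (- \<xi> * q)))"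
        using assms q by (intro mult_mono hankel_kernel_approx exp_diff_bound) auto
      also have "\<dots> = \<bar>x - y\<bar> * (sqrt (2 * q) * q ^ 1 * exp (- \<xi> * q) + 1 / 4 * (sqrt (2 * q) * q ^ 2 * exp (- \<xi> * q)))"
        by (simp add: algebra_simps power2_eq_square)
      finally show "norm (hankel_kernel q * of_real (exp (- x * q)) - hankel_kernel q * of_real (exp (- y * q)))
        \<le> \<bar>x - y\<bar> * (sqrt (2 * q) * q ^ 1 * exp (- \<xi> * q) + 1 / 4 * (sqrt (2 * q) * q ^ 2 * exp (- \<xi> * q)))" .
    qed
    let ?c = "\<lambda>x. cis (x - 3 * pi / 4)"
    have "?c x * hankel x Y - ?c y * hankel y Y
        = (?c x - ?c y) * hankel x Y + ?c y * (hankel x Y - hankel y Y)" by (simp add: algebra_simps)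
    then have "norm (?c x * hankel x Y - ?c y * hankel y Y)
        \<le> norm (?c x - ?c y) * norm (hankel x Y) + norm (hankel x Y - hankel y Y)"
      by (metis norm_triangle_ineq norm_mult norm_cis mult_1)
    also have "\<dots> \<le> \<bar>x - y\<bar> * (exp_moment 0 \<xi> + 1 / 4 * exp_moment 1 \<xi>) + \<bar>x - y\<bar> * (exp_moment 1 \<xi> + 1 / 4 * exp_moment 2 \<xi>)"
      using norm_cis_diff[of "x - 3 * pi / 4" "y - 3 * pi / 4"] by (intro add_mono mult_mono h d) auto
    also have "\<dots> = \<bar>x - y\<bar> * (exp_moment 0 \<xi> + 5 / 4 * exp_moment 1 \<xi> + 1 / 4 * exp_moment 2 \<xi>)"
      by (simp add: algebra_simps)
    finally have "\<bar>Re (?c x * hankel x Y - ?c y * hankel y Y)\<bar>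
        \<le> \<bar>x - y\<bar> * (exp_moment 0 \<xi> + 5 / 4 * exp_moment 1 \<xi> + 1 / 4 * exp_moment 2 \<xi>)"
      using abs_Re_le_cmod order_trans by blast
    then have "\<bar>Re (?c x * hankel x Y) - Re (?c y * hankel y Y)\<bar>
        \<le> \<bar>x - y\<bar> * (exp_moment 0 \<xi> + 5 / 4 * exp_moment 1 \<xi> + 1 / 4 * exp_moment 2 \<xi>)"
      by (simp only: minus_complex.sel)
    then have "2 / pi * \<bar>Re (?c x * hankel x Y) - Re (?c y * hankel y Y)\<bar>
        \<le> 2 / pi * (\<bar>x - y\<bar> * (exp_moment 0 \<xi> + 5 / 4 * exp_moment 1 \<xi> + 1 / 4 * exp_moment 2 \<xi>))"
      by (rule mult_left_mono) simp
    also have "\<dots> = \<bar>x - y\<bar> * (2 / pi * exp_moment 0 \<xi> + 5 / 4 * (2 / pi * exp_moment 1 \<xi>) + 1 / 4 * (2 / pi * exp_moment 2 \<xi>))"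
      by (simp only: ring_distribs mult_ac)
    also have "\<dots> = C"
      unfolding exp_moment_amplitude C_def by (simp add: pochhammer_Suc eval_nat_numeral algebra_simps)
    finally have "\<bar>2 / pi * Re (?c x * hankel x Y) - 2 / pi * Re (?c y * hankel y Y)\<bar> \<le> C"
      unfolding right_diff_distrib[symmetric] abs_mult by simp
    then show ?thesis using bessel_contour[OF pos(1) that] bessel_contour[OF pos(2) that] by linarith
  qed
  from this[of "real (Suc _)"]
  have "\<bar>bessel (- (x\<^sup>2)) - bessel (- (y\<^sup>2))\<bar>
      \<le> C + ((2 + real (Suc k)) * exp (- x * real (Suc k)) + (2 + real (Suc k)) * exp (- y * real (Suc k)))" for k
    by (simp only: of_nat_0_less_iff zero_less_Suc)
  moreover have "(\<lambda>k. C + ((2 + real (Suc k)) * exp (- x * real (Suc k)) + (2 + real (Suc k)) * exp (- y * real (Suc k))))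
      \<longlonglongrightarrow> C + (0 + 0)"
    by (intro tendsto_intros top_edge_limit pos)
  ultimately have "\<bar>bessel (- (x\<^sup>2)) - bessel (- (y\<^sup>2))\<bar> \<le> C + (0 + 0)"
    by (intro LIMSEQ_le_const) auto
  then show ?thesis by (simp add: C_def)
qed

section \<open>Weights, phases and tail estimates\<close>

text \<open>Up to the common factor \<open>2 * pi\<^sup>2 * m powr (3 / 2)\<close>, the amplitude at \<open>x = 2 * pi * m * sqrt (r\<^sup>2 - 1)\<close>, the
argument of the alias term \<open>r\<close> in the limit \<open>\<sigma> \<rightarrow> \<infinity>\<close>.\<close>

definition weight :: "nat \<Rightarrow> real" where "weight r = ((real r)\<^sup>2 - 1) powr (- 3 / 4)"

text \<open>The difference between \<open>2 * pi * m * r\<close>, a multiple of \<open>2 * pi\<close>, and the argument of the alias term; it tends to \<open>0\<close> as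
\<open>r\<close> grows, so that the phases of the terms settle.\<close>

definition phase_lag :: "nat \<Rightarrow> real \<Rightarrow> real" where "phase_lag m x = 2 * pi * real m * (x - sqrt (x\<^sup>2 - 1))"

text \<open>The leading part of the alias term \<open>r\<close> in the limit \<open>\<sigma> \<rightarrow> \<infinity>\<close>, on the scale of the weights.\<close>

definition phase_coeff :: "nat \<Rightarrow> nat \<Rightarrow> real" where
  "phase_coeff m r = weight r * cos (phase_lag m (real r) + 3 * pi / 4)"

lemma weight_nonneg: "0 \<le> weight r"
  by (simp add: weight_def)

lemma phase_coeff_le_weight: "\<bar>phase_coeff m r\<bar> \<le> weight r"
  using mult_left_mono[OF abs_cos_le_one weight_nonneg] by (simp add: phase_coeff_def abs_mult weight_nonneg)

text \<open>Comparison with a telescoping series: \<open>(r\<^sup>2 - 1) powr (3 / 4)\<close> is at least \<open>r * sqrt (r - 1)\<close>, whose reciprocal is at most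
a difference of values of \<open>2 / sqrt r\<close>.\<close>

lemma weight_telescope:
  assumes "2 \<le> r"
  shows "weight r \<le> 2 / sqrt (real r - 1) - 2 / sqrt (real r)"
proof -
  define a where "a = sqrt (real r - 1)"
  define b where "b = sqrt (real r)"
  have pos: "0 < a" "a \<le> b" and sq: "a\<^sup>2 = real r - 1" "b\<^sup>2 = real r"
    using assms by (auto simp: a_def b_def)
  have "((real r)\<^sup>2 - 1) powr (3 / 4) \<ge> a * real r"
  proof -
    have "2 \<le> real r" using assms by simp
    moreover from this have "3 \<le> (real r)\<^sup>2 - 1" using power_mono[of 2 "real r" 2] by simp
    \<comment> \<open>after division by \<open>(r - 1)\<^sup>2\<close>, what remains of the fourth power of the claim is a polynomial inequality that already holds for \<open>r = 2\<close>\<close>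
    ultimately have "2 * 3 \<le> real r * ((real r)\<^sup>2 - 1)" by (intro mult_mono) auto
    then have "real r ^ 4 \<le> (real r - 1) * (real r + 1) ^ 3"
      by (simp add: algebra_simps eval_nat_numeral)
    then have "(real r - 1) ^ 2 * real r ^ 4 \<le> (real r - 1) ^ 2 * ((real r - 1) * (real r + 1) ^ 3)"
      by (intro mult_left_mono) auto
    also have "\<dots> = ((real r)\<^sup>2 - 1) ^ 3" by (simp add: algebra_simps eval_nat_numeral)
    finally have "(real r - 1) ^ 2 * real r ^ 4 \<le> ((real r)\<^sup>2 - 1) ^ 3" .
    moreover have "a ^ 4 = (a\<^sup>2)\<^sup>2" by (simp only: power_mult[symmetric]) simp
    ultimately have *: "(a * real r) ^ 4 \<le> ((real r)\<^sup>2 - 1) ^ 3"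
      by (simp only: power_mult_distrib sq(1))
    have "0 < (real r)\<^sup>2 - 1" using assms by (simp add: power_strict_mono)
    then have "(((real r)\<^sup>2 - 1) powr (3 / 4)) ^ 4 = ((real r)\<^sup>2 - 1) ^ 3"
      using powr_realpow[of "(real r)\<^sup>2 - 1" 3] by (simp add: powr_power)
    with * have "(a * real r) ^ 4 \<le> (((real r)\<^sup>2 - 1) powr (3 / 4)) ^ 4" by simp
    then show ?thesis using pos by (subst (asm) power_mono_iff) auto
  qed
  then have "weight r \<le> 1 / (a * real r)"
    unfolding weight_def minus_divide_left[symmetric] powr_minus
    using pos assms by (simp add: inverse_eq_divide frac_le)
  also have "\<dots> \<le> 2 / a - 2 / b"
  proof -
    have "b - a = 1 / (b + a)" using sq pos by (simp add: field_simps power2_eq_square)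
    also have "\<dots> \<ge> 1 / (2 * b)" using pos by (intro divide_left_mono) auto
    finally have "2 * (1 / (2 * b)) / (a * b) \<le> 2 * (b - a) / (a * b)"
      using pos by (intro divide_right_mono mult_left_mono) auto
    moreover have "real r = b * b" using sq(2) by (simp add: power2_eq_square)
    then have "2 * (1 / (2 * b)) / (a * b) = 1 / (a * real r)" using pos by simp
    moreover have "2 * (b - a) / (a * b) = 2 / a - 2 / b" using pos by (simp add: field_simps)
    ultimately show ?thesis by (simp only:)
  qed
  finally show ?thesis by (simp add: a_def b_def)
qed

lemma telescope_tail:
  assumes "2 \<le> R"
  shows "(\<lambda>k. 2 / sqrt (real (k + R) - 1) - 2 / sqrt (real (k + R))) sums (2 / sqrt (real R - 1))"
proof -
  have "filterlim (\<lambda>k. real (k + R) - 1) at_top sequentially"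
    by (intro filterlim_at_top_mono[OF filterlim_real_sequentially]) (use assms in auto)
  then have "(\<lambda>k. 2 / sqrt (real (k + R) - 1)) \<longlonglongrightarrow> 0"
    by (intro real_tendsto_divide_at_top[OF tendsto_const] filterlim_compose[OF sqrt_at_top])
  from telescope_sums'[OF this]
  have "(\<lambda>n. 2 / sqrt (real (n + R) - 1) - 2 / sqrt (real (Suc n + R) - 1)) sums (2 / sqrt (real (0 + R) - 1) - 0)" .
  then show ?thesis by (simp add: algebra_simps)
qed

lemma weight_tail:
  assumes "2 \<le> R"
  shows "summable (\<lambda>k. weight (k + R))" and "(\<Sum>k. weight (k + R)) \<le> 2 / sqrt (real R - 1)"
proof -
  note t = telescope_tail[OF assms]
  have le: "weight (k + R) \<le> 2 / sqrt (real (k + R) - 1) - 2 / sqrt (real (k + R))" for k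
    using assms by (intro weight_telescope) auto
  show s: "summable (\<lambda>k. weight (k + R))"
    using le weight_nonneg by (intro summable_comparison_test'[OF sums_summable[OF t]]) auto
  show "(\<Sum>k. weight (k + R)) \<le> 2 / sqrt (real R - 1)"
    using suminf_le[OF le s sums_summable[OF t]] sums_unique[OF t] by simp
qed

lemma weight_summable: "summable weight"
  using weight_tail(1)[of 2] summable_iff_shift[of weight 2] by simp

lemma weight_power4:
  assumes "2 \<le> r" shows "weight r ^ 4 = 1 / ((real r)\<^sup>2 - 1) ^ 3"
proof -
  have n: "0 < (real r)\<^sup>2 - 1" using assms by simp
  then have "weight r ^ 4 = ((real r)\<^sup>2 - 1) powr (- 3)"
    unfolding weight_def by (simp add: powr_power)
  then show ?thesis
    using n powr_realpow[of "(real r)\<^sup>2 - 1" 3] by (simp add: powr_minus_divide)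
qed

text \<open>Bounds by rationals reduce to arithmetic with rationals after taking fourth powers.\<close>

lemma weight_bounds:
  assumes "2 \<le> r"
  shows "0 < l \<Longrightarrow> l ^ 4 * (real (r\<^sup>2 - 1)) ^ 3 \<le> 1 \<Longrightarrow> l \<le> weight r"
    and "0 < u \<Longrightarrow> 1 \<le> u ^ 4 * (real (r\<^sup>2 - 1)) ^ 3 \<Longrightarrow> weight r \<le> u"
proof -
  define n where "n = (real r)\<^sup>2 - 1"
  have "1 < r\<^sup>2" using assms by (intro one_less_power) auto
  then have n: "real (r\<^sup>2 - 1) = n" "0 < n"
    by (auto simp: n_def of_nat_diff simp flip: of_nat_power)
  have w4: "weight r ^ 4 = 1 / n ^ 3" unfolding n_def by (rule weight_power4[OF assms])
  show "l \<le> weight r" if "0 < l" "l ^ 4 * (real (r\<^sup>2 - 1)) ^ 3 \<le> 1"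
  proof -
    have "l ^ 4 \<le> weight r ^ 4" using that n unfolding w4 n(1) by (simp add: field_simps)
    then show ?thesis using that(1) weight_nonneg by (subst (asm) power_mono_iff) auto
  qed
  show "weight r \<le> u" if "0 < u" "1 \<le> u ^ 4 * (real (r\<^sup>2 - 1)) ^ 3"
  proof -
    have "weight r ^ 4 \<le> u ^ 4" using that n unfolding w4 n(1) by (simp add: field_simps)
    then show ?thesis using that(1) weight_nonneg by (subst (asm) power_mono_iff) auto
  qed
qed

lemma Abel_bound:
  fixes e a :: "nat \<Rightarrow> real"
  assumes anti: "\<And>k. e (Suc k) \<le> e k" and nonneg: "\<And>k. 0 \<le> e k"
    and part: "\<And>n. \<bar>\<Sum>k<n. a k\<bar> \<le> S" and sm: "summable (\<lambda>k. e k * a k)"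
  shows "\<bar>\<Sum>k. e k * a k\<bar> \<le> e 0 * S"
proof -
  define A where "A n = (\<Sum>k<n. a k)" for n
  have by_parts: "(\<Sum>k<n. e k * a k) = e n * A n + (\<Sum>k<n. (e k - e (Suc k)) * A (Suc k))" for n
    by (induction n) (simp_all add: A_def algebra_simps)
  have part': "\<bar>A n\<bar> \<le> S" for n using part unfolding A_def .
  have fin: "\<bar>\<Sum>k<n. e k * a k\<bar> \<le> e 0 * S" for n
  proof -
    have 1: "\<bar>e n * A n\<bar> \<le> e n * S"
      unfolding abs_mult using mult_left_mono[OF part'[of n] nonneg[of n]] nonneg[of n] by simp
    have 2: "\<bar>(e k - e (Suc k)) * A (Suc k)\<bar> \<le> (e k - e (Suc k)) * S" for k
    proof -
      have "0 \<le> e k - e (Suc k)" using anti[of k] by simp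
      then show ?thesis unfolding abs_mult using mult_left_mono[OF part'[of "Suc k"]] by simp
    qed
    have "\<bar>\<Sum>k<n. e k * a k\<bar> \<le> \<bar>e n * A n\<bar> + \<bar>\<Sum>k<n. (e k - e (Suc k)) * A (Suc k)\<bar>"
      unfolding by_parts by (rule abs_triangle_ineq)
    also have "\<dots> \<le> e n * S + (\<Sum>k<n. (e k - e (Suc k)) * S)"
      by (intro add_mono[OF 1] order_trans[OF sum_abs] sum_mono 2)
    also have "(\<Sum>k<n. (e k - e (Suc k)) * S) = (e 0 - e n) * S"
      by (simp add: sum_distrib_right[symmetric] sum_lessThan_telescope' del: sum.lessThan_Suc)
    finally show ?thesis by (simp add: algebra_simps)
  qed
  have "(\<lambda>n. \<bar>\<Sum>k<n. e k * a k\<bar>) \<longlonglongrightarrow> \<bar>\<Sum>k. e k * a k\<bar>"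
    using sm by (intro tendsto_rabs summable_LIMSEQ)
  then show ?thesis by (rule LIMSEQ_le_const2) (use fin in auto)
qed

lemma Dirichlet_kernel_bound:
  assumes "0 < sin (\<theta> / 2)"
  shows "\<bar>\<Sum>k<n. cos (real (k + M) * \<theta>)\<bar> \<le> 1 / sin (\<theta> / 2)"
proof -
  have "2 * sin (\<theta> / 2) * (\<Sum>k<n. cos (real (k + M) * \<theta>))
      = sin ((real (n + M) - 1 / 2) * \<theta>) - sin ((real M - 1 / 2) * \<theta>)"
  proof (induction n)
    case (Suc n)
    define x where "x = real (n + M) * \<theta>"
    have "(real (Suc n + M) - 1 / 2) * \<theta> = x + \<theta> / 2" "(real (n + M) - 1 / 2) * \<theta> = x - \<theta> / 2"
      by (simp_all add: x_def algebra_simps)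
    then have "sin ((real (Suc n + M) - 1 / 2) * \<theta>) - sin ((real (n + M) - 1 / 2) * \<theta>)
        = 2 * sin (\<theta> / 2) * cos x"
      by (simp only: sin_add sin_diff) simp
    with Suc show ?case by (simp only: sum.lessThan_Suc distrib_left x_def)
  qed simp
  from arg_cong[OF this, of abs] have "2 * sin (\<theta> / 2) * \<bar>\<Sum>k<n. cos (real (k + M) * \<theta>)\<bar>
      = \<bar>sin ((real (n + M) - 1 / 2) * \<theta>) - sin ((real M - 1 / 2) * \<theta>)\<bar>"
    unfolding abs_mult using assms by (simp only: abs_of_pos abs_numeral)
  also have "\<dots> \<le> 1 + 1"
    by (intro order_trans[OF abs_triangle_ineq4] add_mono abs_sin_le_one)
  finally show ?thesis using assms by (simp add: field_simps)
qed

lemma phase_coeff_cos_summable: "summable (\<lambda>k. phase_coeff m (k + M) * cos (real (k + M) * \<theta>))"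
proof (rule summable_comparison_test'[where g = "\<lambda>k. weight (k + M)"])
  show "summable (\<lambda>k. weight (k + M))" using weight_summable by simp
  show "norm (phase_coeff m (k + M) * cos (real (k + M) * \<theta>)) \<le> weight (k + M)" for k
    using mult_mono[OF phase_coeff_le_weight abs_cos_le_one weight_nonneg abs_ge_zero]
    by (simp add: abs_mult)
qed

text \<open>The tail bound that ignores signs. It is uniform in \<open>\<theta>\<close> and \<open>m\<close>.\<close>

lemma phase_coeff_tail_triangle:
  assumes "2 \<le> M"
  shows "\<bar>\<Sum>k. phase_coeff m (k + M) * cos (real (k + M) * \<theta>)\<bar> \<le> 2 / sqrt (real M - 1)"
proof -
  have le: "norm (phase_coeff m (k + M) * cos (real (k + M) * \<theta>)) \<le> weight (k + M)" for k
    using mult_mono[OF phase_coeff_le_weight abs_cos_le_one weight_nonneg abs_ge_zero]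
    by (simp add: abs_mult)
  have "norm (\<Sum>k. phase_coeff m (k + M) * cos (real (k + M) * \<theta>)) \<le> (\<Sum>k. weight (k + M))"
    by (rule norm_suminf_le[OF le weight_tail(1)[OF assms]])
  then show ?thesis using weight_tail(2)[OF assms] by simp
qed

text \<open>Abel summation against the cosines, for tails whose coefficients are monotone and of one sign. It is much better than the
triangle inequality except where \<open>sin (\<theta> / 2)\<close> is small.\<close>

lemma phase_coeff_tail_Abel:
  assumes "\<And>r. M \<le> r \<Longrightarrow> phase_coeff m r \<le> phase_coeff m (Suc r)" and "\<And>r. M \<le> r \<Longrightarrow> phase_coeff m r \<le> 0"
    and "0 < sin (\<theta> / 2)"
  shows "\<bar>\<Sum>k. phase_coeff m (k + M) * cos (real (k + M) * \<theta>)\<bar> \<le> - phase_coeff m M / sin (\<theta> / 2)"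
proof -
  have "\<bar>\<Sum>k. - phase_coeff m (k + M) * cos (real (k + M) * \<theta>)\<bar> \<le> - phase_coeff m (0 + M) * (1 / sin (\<theta> / 2))"
  proof (rule Abel_bound)
    show "summable (\<lambda>k. - phase_coeff m (k + M) * cos (real (k + M) * \<theta>))"
      using summable_minus[OF phase_coeff_cos_summable] by simp
    show "- phase_coeff m (Suc k + M) \<le> - phase_coeff m (k + M)" for k using assms(1)[of "k + M"] by simp
    show "0 \<le> - phase_coeff m (k + M)" for k using assms(2)[of "k + M"] by simp
  qed (rule Dirichlet_kernel_bound[OF assms(3)])
  then show ?thesis using suminf_minus[OF phase_coeff_cos_summable[of m M \<theta>]] by simp
qed

lemma phase_lag_antimono:
  assumes "1 \<le> x" "x \<le> y" shows "phase_lag m y \<le> phase_lag m x"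
proof -
  have conv: "z - sqrt (z\<^sup>2 - 1) = 1 / (z + sqrt (z\<^sup>2 - 1))" if "1 \<le> z" for z :: real
  proof -
    have "0 \<le> sqrt (z\<^sup>2 - 1)" "(sqrt (z\<^sup>2 - 1))\<^sup>2 = z\<^sup>2 - 1" using that by auto
    moreover define q where "q = sqrt (z\<^sup>2 - 1)"
    ultimately have "0 \<le> q" "q\<^sup>2 = z\<^sup>2 - 1" by simp_all
    then have "(z - q) * (z + q) = 1" "0 < z + q"
      using that by (simp_all add: power2_eq_square algebra_simps)
    then show ?thesis unfolding q_def[symmetric] by (simp add: eq_divide_eq)
  qed
  have "0 \<le> x\<^sup>2 - 1" "x\<^sup>2 \<le> y\<^sup>2" using assms by (auto intro: power_mono)
  then have "1 / (y + sqrt (y\<^sup>2 - 1)) \<le> 1 / (x + sqrt (x\<^sup>2 - 1))"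
    using assms by (intro divide_left_mono add_mono mult_pos_pos add_pos_nonneg) auto
  from mult_left_mono[OF this, of "2 * pi * real m"] show ?thesis
    using assms unfolding phase_lag_def by (simp add: conv)
qed

lemma phase_lag_nonneg: "1 \<le> x \<Longrightarrow> 0 \<le> phase_lag m x"
  unfolding phase_lag_def by (intro mult_nonneg_nonneg) (auto intro: real_le_lsqrt)

lemma phase_coeff_minus: "phase_coeff m r = - (weight r * cos (phase_lag m (real r) - pi / 4))"
proof -
  have "phase_lag m (real r) + 3 * pi / 4 = (phase_lag m (real r) - pi / 4) + pi" by simp
  then show ?thesis unfolding phase_coeff_def by (simp only: cos_periodic_pi)
qed

text \<open>Once the phase lag is below \<open>3 / 2\<close>, the coefficients are negative and increase to \<open>0\<close>. For the logarithmic derivative in \<open>r\<close>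
the decay of the weight beats the change of the phase, since the derivative of the lag is \<open>- phase_lag / sqrt (r\<^sup>2 - 1)\<close>.\<close>

lemma phase_coeff_late:
  assumes "2 \<le> M" "phase_lag m (real M) \<le> 3 / 2" "M \<le> r"
  shows "phase_coeff m r \<le> 0" and "phase_coeff m r \<le> phase_coeff m (Suc r)"
proof -
  define e where "e x = (x\<^sup>2 - 1) powr (- 3 / 4) * cos (phase_lag m x - pi / 4)" for x
  have phase_lag: "0 \<le> phase_lag m x" "phase_lag m x \<le> 3 / 2" if "real r \<le> x" for x
    using phase_lag_nonneg[of x m] phase_lag_antimono[of "real M" x m] that assms by auto
  have ev: "- phase_coeff m k = e (real k)" for k
    unfolding phase_coeff_minus e_def weight_def by simp
  have "0 \<le> cos (phase_lag m (real r) - pi / 4)"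
    using phase_lag[of "real r"] pi_gt3 by (intro cos_ge_zero) auto
  then show "phase_coeff m r \<le> 0" unfolding phase_coeff_minus using weight_nonneg[of r] by simp
  have "e (real (Suc r)) \<le> e (real r)"
  proof (rule DERIV_nonpos_imp_nonincreasing[where f = e])
    fix x assume x: "real r \<le> x" "x \<le> real (Suc r)"
    then have x1: "1 < x" using assms by linarith
    define s where "s = sqrt (x\<^sup>2 - 1)"
    have "1 < x\<^sup>2" using x1 by (simp add: one_less_power)
    then have s: "0 < s" "s\<^sup>2 = x\<^sup>2 - 1" by (auto simp: s_def)
    have dlag: "((phase_lag m) has_real_derivative - phase_lag m x / s) (at x)"
      unfolding phase_lag_def s_def using \<open>1 < x\<^sup>2\<close>
      by (auto intro!: derivative_eq_intros simp: field_simps)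
    define \<phi> where "\<phi> = phase_lag m x - pi / 4"
    have "(e has_real_derivative
        (s\<^sup>2 powr (- 3 / 4)) * (- (3 / 2 * x / s\<^sup>2) * cos \<phi> + sin \<phi> * (phase_lag m x / s))) (at x)"
    proof -
      have "(x\<^sup>2 - 1) powr - (3 / 4) + (x\<^sup>2 - 1) powr - (7 / 4) = x\<^sup>2 * (x\<^sup>2 - 1) powr - (7 / 4)"
        using powr_mult_base[of "x\<^sup>2 - 1" "- (7 / 4)"] \<open>1 < x\<^sup>2\<close> by (simp add: algebra_simps)
      then have K: "x * (6 * (c * (x\<^sup>2 - 1) powr - (3 / 4))) + x * (6 * (c * (x\<^sup>2 - 1) powr - (7 / 4)))
          = x * (6 * (x\<^sup>2 * (c * (x\<^sup>2 - 1) powr - (7 / 4))))" for c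
        by algebra
      show ?thesis
        unfolding e_def \<phi>_def s(2) using \<open>1 < x\<^sup>2\<close>
        by (auto intro!: derivative_eq_intros dlag simp: field_simps powr_diff) (rule K)
    qed
    moreover have "(s\<^sup>2 powr (- 3 / 4)) * (- (3 / 2 * x / s\<^sup>2) * cos \<phi> + sin \<phi> * (phase_lag m x / s)) \<le> 0"
    proof -
      have ph: "- pi / 4 \<le> \<phi>" "\<phi> \<le> pi / 4" unfolding \<phi>_def using phase_lag[OF x(1)] pi_gt3 by auto
      have c: "0 \<le> cos \<phi>" using ph by (intro cos_ge_zero) auto
      \<comment> \<open>\<open>\<phi>\<close> stays within \<open>pi / 4\<close> of \<open>0\<close> because \<open>3 / 2 < pi / 2\<close>, hence \<open>sin \<phi> \<le> cos \<phi>\<close>\<close>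
      have "sin \<phi> \<le> sin (pi / 4)" using ph by (intro sin_monotone_2pi_le) auto
      moreover have "cos (pi / 4) \<le> cos \<phi>"
        using ph cos_monotone_0_pi_le[of "\<bar>\<phi>\<bar>" "pi / 4"] by (simp add: abs_le_iff)
      ultimately have "sin \<phi> \<le> cos \<phi>" by (simp add: sin_45 cos_45)
      then have "sin \<phi> * phase_lag m x \<le> cos \<phi> * phase_lag m x" using phase_lag[OF x(1)] by (intro mult_right_mono) auto
      also have "\<dots> \<le> cos \<phi> * (3 / 2 * (x / s))"
      proof (intro mult_left_mono c)
        have "s \<le> x" unfolding s_def using x1 by (intro real_le_lsqrt) auto
        then have "1 \<le> x / s" using s by simp
        then show "phase_lag m x \<le> 3 / 2 * (x / s)" using phase_lag[OF x(1)] by linarith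
      qed
      finally have "sin \<phi> * phase_lag m x / s \<le> cos \<phi> * (3 / 2 * (x / s)) / s" using s by (intro divide_right_mono) auto
      then have "- (3 / 2 * x / s\<^sup>2) * cos \<phi> + sin \<phi> * (phase_lag m x / s) \<le> 0"
        by (simp add: power2_eq_square mult_ac)
      then show "(s\<^sup>2 powr (- 3 / 4)) * (- (3 / 2 * x / s\<^sup>2) * cos \<phi> + sin \<phi> * (phase_lag m x / s)) \<le> 0"
        by (intro mult_nonneg_nonpos) auto
    qed
    ultimately show "\<exists>y. (e has_real_derivative y) (at x) \<and> y \<le> 0" by blast
  qed simp
  then show "phase_coeff m r \<le> phase_coeff m (Suc r)" using ev[of r] ev[of "Suc r"] by simp
qed

section \<open>Numerical enclosures of the first coefficients\<close>

text \<open>The Taylor polynomial of the cosine used for all numerical values; arguments are first reduced to \<open>\<bar>c\<bar> \<le> 1.6\<close>.\<close>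

definition cos_poly :: "real \<Rightarrow> real" where
  "cos_poly c = 1 - c ^ 2 / 2 + c ^ 4 / 24 - c ^ 6 / 720 + c ^ 8 / 40320"

lemma cos_Taylor: "\<bar>cos c - cos_poly c\<bar> \<le> c ^ 10 / 3628800"
proof -
  obtain t where "cos c = (\<Sum>k<10. cos_coeff k * c ^ k) + cos (t + 1 / 2 * real 10 * pi) / fact 10 * c ^ 10"
    using Maclaurin_cos_expansion[of c 10] by blast
  moreover have "(\<Sum>k<10. cos_coeff k * c ^ k) = cos_poly c"
  proof -
    have "{..<10} = {0, 1, 2, 3, 4, 5, 6, 7, 8, 9::nat}" by auto
    then show ?thesis by (simp add: cos_coeff_def cos_poly_def fact_numeral)
  qed
  ultimately have "\<bar>cos c - cos_poly c\<bar> = \<bar>cos (t + 1 / 2 * real 10 * pi)\<bar> * (c ^ 10 / fact 10)"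
    by (simp add: abs_mult zero_le_even_power)
  also have "\<dots> \<le> 1 * (c ^ 10 / fact 10)"
    by (intro mult_right_mono abs_cos_le_one) (simp add: zero_le_even_power)
  also have "(fact 10 :: real) = 3628800" by (simp add: fact_numeral)
  finally show ?thesis by simp
qed

text \<open>Interval arithmetic by hand: \<open>s\<close> is a rational approximation of the root, \<open>j\<close> the multiple of \<open>pi\<close> removed from the phase, and \<open>c\<close>
the reduced phase rounded to four digits. The three rounding errors together stay below \<open>0.0002\<close>.\<close>

lemma cos_phase_lag_enclosure:
  assumes "2 \<le> r" and "m \<le> 7"
    and s: "0.000001 \<le> s" "(s - 0.000001)\<^sup>2 \<le> (real r)\<^sup>2 - 1" "(real r)\<^sup>2 - 1 \<le> (s + 0.000001)\<^sup>2"
    and g: "\<bar>2 * real m * (real r - s) + 3 / 4 - real j\<bar> \<le> 1"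
    and c: "\<bar>3.14159265359 * (2 * real m * (real r - s) + 3 / 4 - real j) - c\<bar> \<le> 0.0001"
  shows "\<bar>cos (phase_lag m (real r) + 3 * pi / 4) - (- 1) ^ j * cos_poly c\<bar> \<le> c ^ 10 / 3628800 + 0.0002"
proof -
  define q where "q = sqrt ((real r)\<^sup>2 - 1)"
  define G where "G = 2 * real m * (real r - s) + 3 / 4 - real j"
  define z where "z = phase_lag m (real r) + 3 * pi / 4 - pi * real j"
  have "s - 0.000001 \<le> q" unfolding q_def by (rule real_le_rsqrt[OF s(2)])
  moreover have "q \<le> s + 0.000001" unfolding q_def using s by (intro real_le_lsqrt) auto
  ultimately have "\<bar>q - s\<bar> \<le> 0.000001" by linarith
  have "\<bar>2 * real m * (s - q)\<bar> \<le> 14 * 0.000001"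
    using assms(2) \<open>\<bar>q - s\<bar> \<le> 0.000001\<close> abs_minus_commute[of q s] unfolding abs_mult by (intro mult_mono) auto
  then have "\<bar>pi * (2 * real m * (s - q))\<bar> \<le> 4 * (14 * 0.000001)"
    unfolding abs_mult[of pi] using pi_less_4 by (intro mult_mono) auto
  moreover have "\<bar>(pi - 3.14159265359) * G\<bar> \<le> 0.00000001 * 1"
    unfolding abs_mult using pi_approx g by (intro mult_mono) (auto simp: G_def abs_le_iff)
  moreover have "z - c = pi * (2 * real m * (s - q)) + (pi - 3.14159265359) * G + (3.14159265359 * G - c)"
    unfolding z_def phase_lag_def q_def[symmetric] G_def by (simp add: algebra_simps)
  ultimately have "\<bar>z - c\<bar> \<le> 4 * (14 * 0.000001) + 0.00000001 * 1 + 0.0001"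
    using c unfolding G_def[symmetric]
    by (simp only:)
  then have "\<bar>z - c\<bar> \<le> 0.0002" by simp
  moreover have "\<bar>cos z - cos c\<bar> \<le> \<bar>z - c\<bar>"
    using abs_Re_le_cmod[of "cis z - cis c"] norm_cis_diff[of z c] by simp
  ultimately have "\<bar>cos z - cos_poly c\<bar> \<le> c ^ 10 / 3628800 + 0.0002"
    using cos_Taylor[of c] by linarith
  moreover have "cos (phase_lag m (real r) + 3 * pi / 4) = (- 1) ^ j * cos z"
    using cos_add[of "pi * real j" z] by (simp add: z_def cos_pi_eq_zero sin_npi2 cos_npi2)
  then have "cos (phase_lag m (real r) + 3 * pi / 4) - (- 1) ^ j * cos_poly c = (- 1) ^ j * (cos z - cos_poly c)"
    by (simp add: algebra_simps)
  ultimately show ?thesis by (simp add: abs_mult power_abs)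
qed

text \<open>The cosine is enclosed first and then multiplied by the enclosed weight. As the sign of the cosine is not known in advance, both
ends of the weight interval are required to satisfy the inequality.\<close>

lemma phase_coeff_enclosure:
  assumes w: "weight r \<in> {wl..wu}" and "2 \<le> r" "m \<le> 7"
    and "0.000001 \<le> s" "(s - 0.000001)\<^sup>2 \<le> (real r)\<^sup>2 - 1" "(real r)\<^sup>2 - 1 \<le> (s + 0.000001)\<^sup>2"
    and "\<bar>2 * real m * (real r - s) + 3 / 4 - real j\<bar> \<le> 1"
    and "\<bar>3.14159265359 * (2 * real m * (real r - s) + 3 / 4 - real j) - c\<bar> \<le> 0.0001"
    and lo: "lo \<le> wl * ((- 1) ^ j * cos_poly c - (c ^ 10 / 3628800 + 0.0002))"
      "lo \<le> wu * ((- 1) ^ j * cos_poly c - (c ^ 10 / 3628800 + 0.0002))"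
    and hi: "wl * ((- 1) ^ j * cos_poly c + (c ^ 10 / 3628800 + 0.0002)) \<le> hi"
      "wu * ((- 1) ^ j * cos_poly c + (c ^ 10 / 3628800 + 0.0002)) \<le> hi"
  shows "phase_coeff m r \<in> {lo..hi}"
proof -
  define a where "a = (- 1) ^ j * cos_poly c - (c ^ 10 / 3628800 + 0.0002)"
  define b where "b = (- 1) ^ j * cos_poly c + (c ^ 10 / 3628800 + 0.0002)"
  define C where "C = cos (phase_lag m (real r) + 3 * pi / 4)"
  have C: "a \<le> C" "C \<le> b"
    using cos_phase_lag_enclosure[OF assms(2-8)] unfolding a_def b_def C_def by linarith+
  have lin: "min (wl * t) (wu * t) \<le> weight r * t" "weight r * t \<le> max (wl * t) (wu * t)" for t
    using w by (cases "0 \<le> t"; auto simp: min_le_iff_disj le_max_iff_disj mult_right_mono mult_right_mono_neg)+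
  have "lo \<le> weight r * a" using lin(1)[of a] lo unfolding a_def[symmetric] by linarith
  also have "\<dots> \<le> weight r * C" using C weight_nonneg by (intro mult_left_mono)
  finally have "lo \<le> phase_coeff m r" by (simp add: phase_coeff_def C_def)
  moreover have "weight r * C \<le> weight r * b" using C weight_nonneg by (intro mult_left_mono)
  then have "phase_coeff m r \<le> hi" using lin(2)[of b] hi unfolding b_def[symmetric] by (simp add: phase_coeff_def C_def)
  ultimately show ?thesis by simp
qed

lemma weight_table:
  shows "weight 2 \<in> {0.43869..0.4387}"
    and "weight 3 \<in> {0.21022..0.21023}"
    and "weight 4 \<in> {0.13119..0.1312}"
    and "weight 5 \<in> {0.09222..0.09223}"
    and "weight 6 \<in> {0.06949..0.0695}"
    and "weight 7 \<in> {0.05483..0.05484}"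
    and "weight 8 \<in> {0.04471..0.04472}"
    and "weight 9 \<in> {0.03738..0.03739}"
    and "weight 10 \<in> {0.03186..0.03187}"
  by (simp_all only: atLeastAtMost_iff, (intro conjI weight_bounds; simp add: power_divide)+)

text \<open>The coefficients \<open>r = 2, ..., 10\<close> for \<open>m = 2, ..., 6\<close>; for \<open>m = 7\<close> a bound for \<open>r = 2\<close> is enough. The instantiations give the root
\<open>sqrt (r\<^sup>2 - 1)\<close>, the number of half turns and the reduced phase.\<close>

lemma phase_coeff_table_2:
  shows "phase_coeff 2 2 \<in> {0.3716..0.3719}"
    and "phase_coeff 2 3 \<in> {- 0.0419..- 0.0417}"
    and "phase_coeff 2 4 \<in> {- 0.0905..- 0.0903}"
    and "phase_coeff 2 5 \<in> {- 0.0817..- 0.0816}"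
    and "phase_coeff 2 6 \<in> {- 0.0671..- 0.0669}"
    and "phase_coeff 2 7 \<in> {- 0.0545..- 0.0544}"
    and "phase_coeff 2 8 \<in> {- 0.0448..- 0.0447}"
    and "phase_coeff 2 9 \<in> {- 0.0373..- 0.0372}"
    and "phase_coeff 2 10 \<in> {- 0.0315..- 0.0314}"
    apply (rule phase_coeff_enclosure[OF weight_table(1), of 2 "1.732051" 2 "- 0.5598"]; simp add: cos_poly_def power_divide)
    apply (rule phase_coeff_enclosure[OF weight_table(2), of 2 "2.828427" 1 "1.3707"]; simp add: cos_poly_def power_divide)
    apply (rule phase_coeff_enclosure[OF weight_table(3), of 2 "3.872983" 1 "0.8107"]; simp add: cos_poly_def power_divide)
    apply (rule phase_coeff_enclosure[OF weight_table(4), of 2 "4.898979" 1 "0.4841"]; simp add: cos_poly_def power_divide)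
    apply (rule phase_coeff_enclosure[OF weight_table(5), of 2 "5.91608" 1 "0.2692"]; simp add: cos_poly_def power_divide)
    apply (rule phase_coeff_enclosure[OF weight_table(6), of 2 "6.928203" 1 "0.1168"]; simp add: cos_poly_def power_divide)
    apply (rule phase_coeff_enclosure[OF weight_table(7), of 2 "7.937254" 1 "0.0031"]; simp add: cos_poly_def power_divide)
    apply (rule phase_coeff_enclosure[OF weight_table(8), of 2 "8.944272" 1 "- 0.0851"]; simp add: cos_poly_def power_divide)
    apply (rule phase_coeff_enclosure[OF weight_table(9), of 2 "9.949874" 1 "- 0.1555"]; simp add: cos_poly_def power_divide)
  done

lemma phase_coeff_table_3:
  shows "phase_coeff 3 2 \<in> {0.1895..0.1898}"
    and "phase_coeff 3 3 \<in> {0.1617..0.1618}"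
    and "phase_coeff 3 4 \<in> {0.0049..0.0051}"
    and "phase_coeff 3 5 \<in> {- 0.0404..- 0.0402}"
    and "phase_coeff 3 6 \<in> {- 0.0487..- 0.0485}"
    and "phase_coeff 3 7 \<in> {- 0.0463..- 0.0462}"
    and "phase_coeff 3 8 \<in> {- 0.0413..- 0.0412}"
    and "phase_coeff 3 9 \<in> {- 0.0361..- 0.036}"
    and "phase_coeff 3 10 \<in> {- 0.0315..- 0.0314}"
    apply (rule phase_coeff_enclosure[OF weight_table(1), of 3 "1.732051" 2 "1.1237"]; simp add: cos_poly_def power_divide)
    apply (rule phase_coeff_enclosure[OF weight_table(2), of 3 "2.828427" 2 "- 0.6929"]; simp add: cos_poly_def power_divide)
    apply (rule phase_coeff_enclosure[OF weight_table(3), of 3 "3.872983" 2 "- 1.5328"]; simp add: cos_poly_def power_divide)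
    apply (rule phase_coeff_enclosure[OF weight_table(4), of 3 "4.898979" 1 "1.1188"]; simp add: cos_poly_def power_divide)
    apply (rule phase_coeff_enclosure[OF weight_table(5), of 3 "5.91608" 1 "0.7965"]; simp add: cos_poly_def power_divide)
    apply (rule phase_coeff_enclosure[OF weight_table(6), of 3 "6.928203" 1 "0.5679"]; simp add: cos_poly_def power_divide)
    apply (rule phase_coeff_enclosure[OF weight_table(7), of 3 "7.937254" 1 "0.3973"]; simp add: cos_poly_def power_divide)
    apply (rule phase_coeff_enclosure[OF weight_table(8), of 3 "8.944272" 1 "0.265"]; simp add: cos_poly_def power_divide)
    apply (rule phase_coeff_enclosure[OF weight_table(9), of 3 "9.949874" 1 "0.1595"]; simp add: cos_poly_def power_divide)
  done

lemma phase_coeff_table_4: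
  shows "phase_coeff 4 2 \<in> {- 0.4146..- 0.4143}"
    and "phase_coeff 4 3 \<in> {0.1947..0.1949}"
    and "phase_coeff 4 4 \<in> {0.0973..0.0974}"
    and "phase_coeff 4 5 \<in> {0.0167..0.0168}"
    and "phase_coeff 4 6 \<in> {- 0.0171..- 0.0169}"
    and "phase_coeff 4 7 \<in> {- 0.0288..- 0.0287}"
    and "phase_coeff 4 8 \<in> {- 0.0315..- 0.0314}"
    and "phase_coeff 4 9 \<in> {- 0.0306..- 0.0305}"
    and "phase_coeff 4 10 \<in> {- 0.0284..- 0.0283}"
    apply (rule phase_coeff_enclosure[OF weight_table(1), of 4 "1.732051" 3 "- 0.3343"]; simp add: cos_poly_def power_divide)
    apply (rule phase_coeff_enclosure[OF weight_table(2), of 4 "2.828427" 2 "0.3851"]; simp add: cos_poly_def power_divide)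
    apply (rule phase_coeff_enclosure[OF weight_table(3), of 4 "3.872983" 2 "- 0.7347"]; simp add: cos_poly_def power_divide)
    apply (rule phase_coeff_enclosure[OF weight_table(4), of 4 "4.898979" 2 "- 1.3881"]; simp add: cos_poly_def power_divide)
    apply (rule phase_coeff_enclosure[OF weight_table(5), of 4 "5.91608" 1 "1.3237"]; simp add: cos_poly_def power_divide)
    apply (rule phase_coeff_enclosure[OF weight_table(6), of 4 "6.928203" 1 "1.0191"]; simp add: cos_poly_def power_divide)
    apply (rule phase_coeff_enclosure[OF weight_table(7), of 4 "7.937254" 1 "0.7916"]; simp add: cos_poly_def power_divide)
    apply (rule phase_coeff_enclosure[OF weight_table(8), of 4 "8.944272" 1 "0.6152"]; simp add: cos_poly_def power_divide)
    apply (rule phase_coeff_enclosure[OF weight_table(9), of 4 "9.949874" 1 "0.4744"]; simp add: cos_poly_def power_divide)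
  done

lemma phase_coeff_table_5:
  shows "phase_coeff 5 2 \<in> {- 0.0965..- 0.0962}"
    and "phase_coeff 5 3 \<in> {0.0225..0.0227}"
    and "phase_coeff 5 4 \<in> {0.1309..0.131}"
    and "phase_coeff 5 5 \<in> {0.0672..0.0673}"
    and "phase_coeff 5 6 \<in> {0.0192..0.0193}"
    and "phase_coeff 5 7 \<in> {- 0.0056..- 0.0054}"
    and "phase_coeff 5 8 \<in> {- 0.0169..- 0.0167}"
    and "phase_coeff 5 9 \<in> {- 0.0213..- 0.0212}"
    and "phase_coeff 5 10 \<in> {- 0.0225..- 0.0224}"
    apply (rule phase_coeff_enclosure[OF weight_table(1), of 5 "1.732051" 3 "1.3493"]; simp add: cos_poly_def power_divide)
    apply (rule phase_coeff_enclosure[OF weight_table(2), of 5 "2.828427" 2 "1.4631"]; simp add: cos_poly_def power_divide)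
    apply (rule phase_coeff_enclosure[OF weight_table(3), of 5 "3.872983" 2 "0.0634"]; simp add: cos_poly_def power_divide)
    apply (rule phase_coeff_enclosure[OF weight_table(4), of 5 "4.898979" 2 "- 0.7533"]; simp add: cos_poly_def power_divide)
    apply (rule phase_coeff_enclosure[OF weight_table(5), of 5 "5.91608" 2 "- 1.2906"]; simp add: cos_poly_def power_divide)
    apply (rule phase_coeff_enclosure[OF weight_table(6), of 5 "6.928203" 1 "1.4702"]; simp add: cos_poly_def power_divide)
    apply (rule phase_coeff_enclosure[OF weight_table(7), of 5 "7.937254" 1 "1.1858"]; simp add: cos_poly_def power_divide)
    apply (rule phase_coeff_enclosure[OF weight_table(8), of 5 "8.944272" 1 "0.9653"]; simp add: cos_poly_def power_divide)
    apply (rule phase_coeff_enclosure[OF weight_table(9), of 5 "9.949874" 1 "0.7894"]; simp add: cos_poly_def power_divide)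
  done

lemma phase_coeff_table_6:
  shows "phase_coeff 6 2 \<in> {0.436..0.4362}"
    and "phase_coeff 6 3 \<in> {- 0.1736..- 0.1734}"
    and "phase_coeff 6 4 \<in> {0.0854..0.0855}"
    and "phase_coeff 6 5 \<in> {0.0915..0.0917}"
    and "phase_coeff 6 6 \<in> {0.0501..0.0503}"
    and "phase_coeff 6 7 \<in> {0.0188..0.0189}"
    and "phase_coeff 6 8 \<in> {0.0004..0.0005}"
    and "phase_coeff 6 9 \<in> {- 0.0095..- 0.0094}"
    and "phase_coeff 6 10 \<in> {- 0.0144..- 0.0143}"
    apply (rule phase_coeff_enclosure[OF weight_table(1), of 6 "1.732051" 4 "- 0.1087"]; simp add: cos_poly_def power_divide)
    apply (rule phase_coeff_enclosure[OF weight_table(2), of 6 "2.828427" 3 "- 0.6004"]; simp add: cos_poly_def power_divide)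
    apply (rule phase_coeff_enclosure[OF weight_table(3), of 6 "3.872983" 2 "0.8614"]; simp add: cos_poly_def power_divide)
    apply (rule phase_coeff_enclosure[OF weight_table(4), of 6 "4.898979" 2 "- 0.1186"]; simp add: cos_poly_def power_divide)
    apply (rule phase_coeff_enclosure[OF weight_table(5), of 6 "5.91608" 2 "- 0.7633"]; simp add: cos_poly_def power_divide)
    apply (rule phase_coeff_enclosure[OF weight_table(6), of 6 "6.928203" 2 "- 1.2203"]; simp add: cos_poly_def power_divide)
    apply (rule phase_coeff_enclosure[OF weight_table(7), of 6 "7.937254" 2 "- 1.5615"]; simp add: cos_poly_def power_divide)
    apply (rule phase_coeff_enclosure[OF weight_table(8), of 6 "8.944272" 1 "1.3155"]; simp add: cos_poly_def power_divide)
    apply (rule phase_coeff_enclosure[OF weight_table(9), of 6 "9.949874" 1 "1.1043"]; simp add: cos_poly_def power_divide)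
  done

lemma phase_coeff_table_7:
  shows "phase_coeff 7 2 \<in> {- 0.0019..- 0.0016}"
    apply (rule phase_coeff_enclosure[OF weight_table(1), of 7 "1.732051" 5 "- 1.5668"]; simp add: cos_poly_def power_divide)
  done

section \<open>Bounds for the leading series\<close>

definition phase_series :: "nat \<Rightarrow> real \<Rightarrow> real" where
  "phase_series m \<theta> = (\<Sum>k. phase_coeff m (k + 2) * cos (real (k + 2) * \<theta>))"

abbreviation phase_tail :: "nat \<Rightarrow> nat \<Rightarrow> real \<Rightarrow> real" where
  "phase_tail m M \<theta> \<equiv> (\<Sum>k. phase_coeff m (k + M) * cos (real (k + M) * \<theta>))"

lemma phase_tail_split:
  assumes "M \<le> R"
  shows "phase_tail m M \<theta> = (\<Sum>r = M..<R. phase_coeff m r * cos (real r * \<theta>)) + phase_tail m R \<theta>"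
proof -
  let ?f = "\<lambda>r. phase_coeff m r * cos (real r * \<theta>)"
  have "(\<Sum>k. ?f (k + M)) = (\<Sum>k. ?f (k + (R - M) + M)) + (\<Sum>k<R - M. ?f (k + M))"
    by (rule suminf_split_initial_segment[OF phase_coeff_cos_summable])
  moreover have "(\<Sum>k<R - M. ?f (k + M)) = (\<Sum>r = M..<R. ?f r)"
    using assms sum.shift_bounds_nat_ivl[of ?f 0 M "R - M"] by (simp add: lessThan_atLeast0)
  ultimately show ?thesis using assms by (simp add: add.assoc)
qed

lemma phase_split:
  "2 \<le> R \<Longrightarrow> phase_series m \<theta> = (\<Sum>r = 2..<R. phase_coeff m r * cos (real r * \<theta>)) + phase_tail m R \<theta>"
  unfolding phase_series_def by (rule phase_tail_split)

lemma abs_sin_multiple: "\<bar>sin (real n * x)\<bar> \<le> real n * \<bar>sin x\<bar>"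
proof (induction n)
  case (Suc n)
  have "sin (real (Suc n) * x) = sin (real n * x) * cos x + cos (real n * x) * sin x"
    by (simp add: distrib_right sin_add add.commute)
  also have "\<bar>\<dots>\<bar> \<le> \<bar>sin (real n * x)\<bar> * \<bar>cos x\<bar> + \<bar>cos (real n * x)\<bar> * \<bar>sin x\<bar>"
    by (simp add: abs_mult[symmetric])
  also have "\<dots> \<le> \<bar>sin (real n * x)\<bar> * 1 + 1 * \<bar>sin x\<bar>"
    by (intro add_mono mult_mono) auto
  finally show ?case using Suc by (simp add: algebra_simps)
qed simp

text \<open>The deviation of every \<open>cos (n * \<theta>)\<close> from \<open>1\<close> is controlled by that of \<open>cos \<theta>\<close>. This lets the head of the series be replaced
by its value at \<open>\<theta> = 0\<close>.\<close>

lemma one_minus_cos_multiple: "1 - cos (real n * \<theta>) \<le> (real n)\<^sup>2 * (1 - cos \<theta>)"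
proof -
  have half: "1 - cos y = 2 * (sin (y / 2))\<^sup>2" for y :: real
    using cos_double_sin[of "y / 2"] by simp
  have "(sin (real n * (\<theta> / 2)))\<^sup>2 \<le> (real n * \<bar>sin (\<theta> / 2)\<bar>)\<^sup>2"
    using abs_sin_multiple[of n "\<theta> / 2"] by (simp add: abs_le_square_iff[symmetric] abs_mult)
  then show ?thesis unfolding half by (simp add: power_mult_distrib)
qed

lemma phase_coeff_cos_upper:
  assumes "phase_coeff m r \<le> u" "- phase_coeff m r \<le> l" "0 \<le> l"
  shows "phase_coeff m r * cos (real r * \<theta>) \<le> u + l * (real r)\<^sup>2 * (1 - cos \<theta>)"
proof -
  have c: "0 \<le> 1 - cos (real r * \<theta>)" by simp
  have "- phase_coeff m r * (1 - cos (real r * \<theta>)) \<le> l * (1 - cos (real r * \<theta>))"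
    using assms c by (intro mult_right_mono) auto
  also have "\<dots> \<le> l * ((real r)\<^sup>2 * (1 - cos \<theta>))"
    using assms one_minus_cos_multiple by (intro mult_left_mono) auto
  finally show ?thesis using assms(1) by (simp add: algebra_simps)
qed

lemma cos_multiple_reflect: "cos (real r * \<theta>) = (- 1) ^ r * cos (real r * (pi - \<theta>))"
proof -
  have "cos (real r * (pi - \<theta>)) = cos (pi * real r) * cos (real r * \<theta>)"
    by (simp add: right_diff_distrib cos_diff mult.commute[of pi] sin_npi)
  then have "cos (real r * (pi - \<theta>)) = (- 1) ^ r * cos (real r * \<theta>)" by (simp only: cos_npi2)
  then show ?thesis by (simp add: mult.assoc[symmetric] power_add[symmetric] flip: power_mult_distrib)
qed

lemma sum_sq_weight:
  assumes "R \<le> 11" shows "(\<Sum>r = 2..<R. (real r)\<^sup>2 * weight r) \<le> 23"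
proof -
  have "(\<Sum>r = 2..<R. (real r)\<^sup>2 * weight r) \<le> (\<Sum>r = 2..<11. (real r)\<^sup>2 * weight r)"
    using assms by (intro sum_mono2) (auto simp: weight_nonneg)
  also have "{2..<11} = {2, 3, 4, 5, 6, 7, 8, 9, 10::nat}" by auto
  also have "(\<Sum>r\<in>{2, 3, 4, 5, 6, 7, 8, 9, 10::nat}. (real r)\<^sup>2 * weight r) \<le> 23"
    using weight_table by simp
  finally show ?thesis .
qed

text \<open>The head of the series against its value at \<open>0\<close>, and, by the reflection \<open>\<theta> \<mapsto> pi - \<theta>\<close>, against its value at \<open>pi\<close>. The
constant \<open>23\<close> is an upper bound for the sum of \<open>r\<^sup>2 * weight r\<close> with \<open>r \<le> 10\<close>.\<close>

lemma phase_head_upper: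
  assumes "R \<le> 11"
  shows "(\<Sum>r = 2..<R. phase_coeff m r * cos (real r * \<theta>)) \<le> (\<Sum>r = 2..<R. phase_coeff m r) + 23 * (1 - cos \<theta>)"
    and "- (\<Sum>r = 2..<R. phase_coeff m r * cos (real r * \<theta>)) \<le> - (\<Sum>r = 2..<R. (- 1) ^ r * phase_coeff m r) + 23 * (1 + cos \<theta>)"
proof -
  have *: "(\<Sum>r = 2..<R. \<epsilon> r * phase_coeff m r * cos (real r * x)) \<le> (\<Sum>r = 2..<R. \<epsilon> r * phase_coeff m r) + 23 * (1 - cos x)"
    if "\<And>r. \<bar>\<epsilon> r\<bar> = 1" for \<epsilon> x
  proof -
    have "\<epsilon> r * phase_coeff m r * cos (real r * x) \<le> \<epsilon> r * phase_coeff m r + (real r)\<^sup>2 * weight r * (1 - cos x)" for r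
    proof -
      have "- (\<epsilon> r * phase_coeff m r) \<le> weight r"
        using phase_coeff_le_weight[of m r] that[of r] abs_ge_minus_self[of "\<epsilon> r * phase_coeff m r"] by (simp add: abs_mult)
      then have "- (\<epsilon> r * phase_coeff m r) * (1 - cos (real r * x)) \<le> weight r * (1 - cos (real r * x))"
        by (intro mult_right_mono) auto
      also have "\<dots> \<le> weight r * ((real r)\<^sup>2 * (1 - cos x))"
        by (intro mult_left_mono one_minus_cos_multiple weight_nonneg)
      finally show ?thesis by (simp add: algebra_simps)
    qed
    then have "(\<Sum>r = 2..<R. \<epsilon> r * phase_coeff m r * cos (real r * x))
        \<le> (\<Sum>r = 2..<R. \<epsilon> r * phase_coeff m r + (real r)\<^sup>2 * weight r * (1 - cos x))"
      by (rule sum_mono)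
    also have "\<dots> = (\<Sum>r = 2..<R. \<epsilon> r * phase_coeff m r) + (\<Sum>r = 2..<R. (real r)\<^sup>2 * weight r) * (1 - cos x)"
      by (simp add: sum.distrib sum_distrib_right)
    also have "\<dots> \<le> (\<Sum>r = 2..<R. \<epsilon> r * phase_coeff m r) + 23 * (1 - cos x)"
      using sum_sq_weight[OF assms] by (intro add_left_mono mult_right_mono) auto
    finally show ?thesis .
  qed
  show "(\<Sum>r = 2..<R. phase_coeff m r * cos (real r * \<theta>)) \<le> (\<Sum>r = 2..<R. phase_coeff m r) + 23 * (1 - cos \<theta>)"
    using *[of "\<lambda>_. 1" \<theta>] by simp
  have "- (\<Sum>r = 2..<R. phase_coeff m r * cos (real r * \<theta>)) = (\<Sum>r = 2..<R. - ((- 1) ^ r) * phase_coeff m r * cos (real r * (pi - \<theta>)))"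
    by (subst cos_multiple_reflect) (simp add: sum_negf mult_ac)
  also have "\<dots> \<le> - (\<Sum>r = 2..<R. (- 1) ^ r * phase_coeff m r) + 23 * (1 + cos \<theta>)"
    using *[of "\<lambda>r. - ((- 1) ^ r)" "pi - \<theta>"] by (simp add: sum_negf)
  finally show "- (\<Sum>r = 2..<R. phase_coeff m r * cos (real r * \<theta>)) \<le> - (\<Sum>r = 2..<R. (- 1) ^ r * phase_coeff m r) + 23 * (1 + cos \<theta>)" .
qed

lemma phase_series_trivial: "\<bar>phase_series m \<theta>\<bar> \<le> \<bar>phase_coeff m 2\<bar> + 13651 / 10000"
proof -
  have "phase_series m \<theta> = (\<Sum>r = 2..<4. phase_coeff m r * cos (real r * \<theta>)) + phase_tail m 4 \<theta>"
    by (rule phase_split) simp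
  also have "{2..<4} = {2, 3::nat}" by auto
  finally have "phase_series m \<theta> = phase_coeff m 2 * cos (2 * \<theta>) + phase_coeff m 3 * cos (3 * \<theta>) + phase_tail m 4 \<theta>" by simp
  moreover have "\<bar>phase_coeff m 2 * cos (2 * \<theta>)\<bar> \<le> \<bar>phase_coeff m 2\<bar> * 1" "\<bar>phase_coeff m 3 * cos (3 * \<theta>)\<bar> \<le> \<bar>phase_coeff m 3\<bar> * 1"
    unfolding abs_mult by (intro mult_left_mono; simp)+
  moreover have "\<bar>phase_tail m 4 \<theta>\<bar> \<le> 2 / sqrt 3" using phase_coeff_tail_triangle[of 4 m \<theta>] by simp
  moreover have "2 / sqrt 3 \<le> 11548 / 10000"
    using real_le_rsqrt[of "20000 / 11548" 3] by (simp add: field_simps power2_eq_square)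
  moreover have "\<bar>phase_coeff m 3\<bar> \<le> 21023 / 100000" using phase_coeff_le_weight[of m 3] weight_table(2) by simp
  ultimately show ?thesis unfolding abs_le_iff by linarith
qed

text \<open>\<open>1.804\<close> bounds the sum of all weights: \<open>weight 2 + weight 3\<close> plus the telescoped tail \<open>2 / sqrt 3\<close>.\<close>

lemma phase_series_small: "\<bar>phase_series m \<theta>\<bar> \<le> 1804 / 1000"
  using phase_series_trivial[of m \<theta>] phase_coeff_le_weight[of m 2] weight_table(1) by simp

text \<open>Signs in the head, absolute values in the tail from \<open>r = 11\<close> on, where \<open>2 / sqrt 10 \<le> 0.6325\<close>.\<close>

lemma phase_series_signed:
  "phase_series m \<theta> \<le> (\<Sum>r = 2..<11. phase_coeff m r) + 6325 / 10000 + 23 * (1 - cos \<theta>)"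
  "- phase_series m \<theta> \<le> - (\<Sum>r = 2..<11. (- 1) ^ r * phase_coeff m r) + 6325 / 10000 + 23 * (1 + cos \<theta>)"
proof -
  have "\<bar>phase_tail m 11 \<theta>\<bar> \<le> 2 / sqrt 10" using phase_coeff_tail_triangle[of 11 m \<theta>] by simp
  moreover have "2 / sqrt 10 \<le> 6325 / 10000"
    using real_le_rsqrt[of "20000 / 6325" 10] by (simp add: field_simps power2_eq_square)
  ultimately have "\<bar>phase_tail m 11 \<theta>\<bar> \<le> 6325 / 10000" by simp
  then show "phase_series m \<theta> \<le> (\<Sum>r = 2..<11. phase_coeff m r) + 6325 / 10000 + 23 * (1 - cos \<theta>)"
    "- phase_series m \<theta> \<le> - (\<Sum>r = 2..<11. (- 1) ^ r * phase_coeff m r) + 6325 / 10000 + 23 * (1 + cos \<theta>)"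
    using phase_head_upper[of 11 m \<theta>] phase_split[of 11 m \<theta>] by simp_all
qed

text \<open>Near \<open>pi\<close> the Dirichlet kernel is bounded, so Abel summation makes the tail as small as its first coefficient, instead of
\<open>2 / sqrt (M - 1)\<close>. The factor \<open>1 / sin (\<theta> / 2) \<le> 1 + (1 + cos \<theta>)\<close> is absorbed by raising \<open>23\<close> to \<open>24\<close>.\<close>

lemma phase_series_near_pi:
  assumes \<theta>: "0 \<le> \<theta>" "\<theta> \<le> pi" "cos \<theta> \<le> 0" and "2 \<le> M" "M \<le> 11"
    and late: "\<And>r. M \<le> r \<Longrightarrow> phase_coeff m r \<le> phase_coeff m (Suc r)" "\<And>r. M \<le> r \<Longrightarrow> phase_coeff m r \<le> 0"
  shows "- phase_series m \<theta> \<le> - (\<Sum>r = 2..<M. (- 1) ^ r * phase_coeff m r) - phase_coeff m M + 24 * (1 + cos \<theta>)"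
proof -
  define v where "v = 1 + cos \<theta>"
  have v: "0 \<le> v" "v \<le> 1" unfolding v_def using \<theta>(3) cos_ge_minus_one[of \<theta>] by linarith+
  have s: "0 \<le> sin (\<theta> / 2)" "sin (\<theta> / 2) \<le> 1" using \<theta> by (auto intro: sin_ge_zero)
  have sq: "(sin (\<theta> / 2))\<^sup>2 = 1 - v / 2" using cos_double_sin[of "\<theta> / 2"] by (simp add: v_def field_simps)
  have "1 - v / 2 \<le> sin (\<theta> / 2)"
    unfolding sq[symmetric] using s by (simp add: power2_eq_square mult_left_le)
  then have pos: "0 < sin (\<theta> / 2)" and inv: "1 / sin (\<theta> / 2) \<le> 1 / (1 - v / 2)"
    using v by (auto intro!: divide_left_mono mult_pos_pos)
  have "1 / (1 - v / 2) \<le> 1 + v"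
  proof -
    have "0 \<le> v * (1 - v) / 2" using v by simp
    then have "1 \<le> (1 + v) * (1 - v / 2)" by (simp add: algebra_simps)
    then show ?thesis using v by (simp add: divide_le_eq)
  qed
  with inv have "1 / sin (\<theta> / 2) \<le> 1 + v" by linarith
  moreover have cM: "0 \<le> - phase_coeff m M" "- phase_coeff m M \<le> 1"
  proof -
    have "1 < M\<^sup>2" using assms(4) by (intro one_less_power) auto
    then have "1 \<le> M\<^sup>2 - 1" by simp
    then have "1 \<le> real (M\<^sup>2 - 1) ^ 3" by (intro one_le_power) (metis of_nat_1 of_nat_le_iff)
    then have "weight M \<le> 1" by (intro weight_bounds assms(4)) (simp_all del: of_nat_diff)
    then show "- phase_coeff m M \<le> 1" using phase_coeff_le_weight[of m M] by linarith
    show "0 \<le> - phase_coeff m M" using late(2)[of M] by simp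
  qed
  ultimately have "- phase_coeff m M * (1 / sin (\<theta> / 2)) \<le> - phase_coeff m M * (1 + v)" by (intro mult_left_mono)
  also have "\<dots> \<le> - phase_coeff m M + v" using mult_right_mono[OF cM(2) v(1)] by (simp add: algebra_simps)
  finally have "\<bar>phase_tail m M \<theta>\<bar> \<le> - phase_coeff m M + v"
    using phase_coeff_tail_Abel[of M m \<theta>, OF late(1) late(2) pos] by simp
  then show ?thesis
    using phase_head_upper(2)[OF assms(5), of m \<theta>] phase_split[OF assms(4), of m \<theta>] by (simp add: v_def)
qed

lemma cos_le_Taylor: "cos x \<le> 1 - x\<^sup>2 / 2 + x ^ 4 / 24" for x :: real
proof -
  obtain t where "cos x = (\<Sum>k<4. cos_coeff k * x ^ k) + cos (t + 1 / 2 * real 4 * pi) / fact 4 * x ^ 4"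
    using Maclaurin_cos_expansion[of x 4] by blast
  moreover have "{..<4} = {0, 1, 2, 3::nat}" by auto
  ultimately have "cos x = 1 - x\<^sup>2 / 2 + cos (t + 1 / 2 * real 4 * pi) * (x ^ 4 / 24)"
    by (simp add: cos_coeff_def fact_numeral)
  moreover have "cos (t + 1 / 2 * real 4 * pi) * (x ^ 4 / 24) \<le> 1 * (x ^ 4 / 24)"
    by (intro mult_right_mono cos_le_one) (simp add: zero_le_even_power)
  ultimately show ?thesis by linarith
qed

text \<open>Near \<open>0\<close> Abel summation degenerates, but the negative coefficients of a late tail meet positive cosines up to \<open>r\<close> about \<open>pi / (2 * \<theta>)\<close>.
Only the part beyond needs Abel summation, and it is at most of order \<open>sqrt \<theta>\<close>. Since the available slack is proportional to
\<open>1 - cos \<theta>\<close>, about \<open>\<theta>\<^sup>2 / 2\<close>, the root is replaced by a constant plus a multiple of \<open>1 - cos \<theta>\<close>; the free parameter \<open>t\<close>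
balances the two, and \<open>K\<close> is a rational upper bound for the constant in front of the root.\<close>

lemma phase_tail_near_zero:
  assumes late: "2 \<le> M\<^sub>0" "phase_lag m (real M\<^sub>0) \<le> 3 / 2" "M\<^sub>0 \<le> Suc R"
    and \<theta>: "0 < \<theta>" "\<theta> \<le> b" "b \<le> 1" "real R * b \<le> 1.57"
    and K: "0 < K" "1024 \<le> K ^ 4 * 961 * (1 - 1 / (real (Suc R))\<^sup>2) ^ 3 * (1 - b\<^sup>2 / 12)\<^sup>2"
    and t: "0 < t"
  shows "phase_tail m (Suc R) \<theta> \<le> K * (3 / 4 * t + (1 - cos \<theta>) / (2 * t ^ 3 * (1 - b\<^sup>2 / 12)))"
proof -
  \<comment> \<open>for \<open>r < x\<close> the cosines are nonnegative and the coefficients nonpositive, so these terms only help\<close>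
  define x where "x = pi / (2 * \<theta>)"
  define M where "M = max (Suc R) (nat \<lceil>x\<rceil>)"
  have x: "0 < x" "x \<le> real M" and M: "Suc R \<le> M" "2 \<le> M"
    using \<theta> late by (auto simp: x_def M_def le_max_iff_disj) linarith
  define s where "s = sin (\<theta> / 2)"
  define l where "l = 1 - b\<^sup>2 / 12"
  define \<kappa> where "\<kappa> = 1 - 1 / (real (Suc R))\<^sup>2"
  have b2: "b\<^sup>2 \<le> 1" "\<theta>\<^sup>2 \<le> b\<^sup>2" using \<theta> by (auto intro: power_mono power_le_one)
  have l: "0 < l" unfolding l_def using b2 by simp
  have v: "\<theta>\<^sup>2 / 2 * l \<le> 1 - cos \<theta>"
  proof -
    have "\<theta>\<^sup>2 / 2 * l \<le> \<theta>\<^sup>2 / 2 * (1 - \<theta>\<^sup>2 / 12)" unfolding l_def using b2 by (intro mult_left_mono) auto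
    also have "\<dots> = \<theta>\<^sup>2 / 2 - \<theta> ^ 4 / 24" by (simp add: algebra_simps eval_nat_numeral)
    finally show ?thesis using cos_le_Taylor[of \<theta>] by linarith
  qed
  have "\<theta> / 2 < pi" using \<theta> pi_gt3 by linarith
  then have spos: "0 < s" unfolding s_def using \<theta> by (intro sin_gt_zero) auto
  have "s\<^sup>2 = (1 - cos \<theta>) / 2" using cos_double_sin[of "\<theta> / 2"] by (simp add: s_def)
  then have s: "\<theta>\<^sup>2 / 4 * l \<le> s\<^sup>2" using v by simp
  have head: "(\<Sum>r = Suc R..<M. phase_coeff m r * cos (real r * \<theta>)) \<le> 0"
  proof (rule sum_nonpos)
    fix r assume r: "r \<in> {Suc R..<M}"
    then have "r < nat \<lceil>x\<rceil>" by (auto simp: M_def)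
    then have "real r < x" by linarith
    then have "real r * \<theta> \<le> pi / 2" using \<theta> by (simp add: x_def field_simps)
    then have "0 \<le> cos (real r * \<theta>)" using \<theta> by (intro cos_ge_zero) (auto intro: order_trans[of _ 0])
    moreover have "phase_coeff m r \<le> 0" using r late by (intro phase_coeff_late) auto
    ultimately show "phase_coeff m r * cos (real r * \<theta>) \<le> 0" by (simp add: mult_nonpos_nonneg)
  qed
  have "\<bar>phase_tail m M \<theta>\<bar> \<le> - phase_coeff m M / s"
    unfolding s_def using M late spos
    by (intro phase_coeff_tail_Abel phase_coeff_late[OF late(1,2)]) (auto simp: s_def)
  then have "phase_tail m (Suc R) \<theta> \<le> - phase_coeff m M / s"
    using head phase_tail_split[OF M(1), of m \<theta>] by linarith
  also have "\<dots> \<le> weight M / s"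
    using phase_coeff_le_weight[of m M] spos by (intro divide_right_mono) auto
  also have "\<dots> \<le> K * sqrt \<theta>"
  proof -
    have kM: "0 < \<kappa>" "x\<^sup>2 * \<kappa> \<le> (real M)\<^sup>2 - 1"
    proof -
      have "1 < (real (Suc R))\<^sup>2" using late by (intro one_less_power) auto
      then show "0 < \<kappa>" by (simp add: \<kappa>_def)
      have "(real (Suc R))\<^sup>2 \<le> (real M)\<^sup>2" using M by (intro power_mono) auto
      then have "1 / (real M)\<^sup>2 \<le> 1 / (real (Suc R))\<^sup>2"
        using M by (intro divide_left_mono mult_pos_pos) auto
      then have "\<kappa> \<le> 1 - 1 / (real M)\<^sup>2" by (simp add: \<kappa>_def)
      moreover have "x\<^sup>2 \<le> (real M)\<^sup>2" using x by (intro power_mono) auto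
      ultimately have "x\<^sup>2 * \<kappa> \<le> (real M)\<^sup>2 * (1 - 1 / (real M)\<^sup>2)"
        using \<open>0 < \<kappa>\<close> by (intro mult_mono) auto
      also have "\<dots> = (real M)\<^sup>2 - 1" using M by (simp add: right_diff_distrib)
      finally show "x\<^sup>2 * \<kappa> \<le> (real M)\<^sup>2 - 1" .
    qed
    have "weight M ^ 4 = 1 / ((real M)\<^sup>2 - 1) ^ 3" by (rule weight_power4[OF M(2)])
    also have "\<dots> \<le> 1 / (x\<^sup>2 * \<kappa>) ^ 3"
      using kM x one_less_power[of "real M" 2] M by (intro divide_left_mono power_mono mult_pos_pos zero_less_power) auto
    also have "\<dots> = 64 * \<theta> ^ 6 / (pi ^ 6 * \<kappa> ^ 3)"
      using \<theta> kM by (simp add: x_def field_simps power_divide flip: power_mult)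
    also have "\<dots> \<le> K ^ 4 * \<theta>\<^sup>2 * (\<theta>\<^sup>2 / 4 * l)\<^sup>2"
    proof -
      \<comment> \<open>\<open>961\<close> stands for \<open>pi ^ 6\<close>, and \<open>1024 = 64 * 16\<close> collects the powers of two from \<open>x = pi / (2 * \<theta>)\<close> and from \<open>(\<theta>\<^sup>2 / 4)\<^sup>2\<close>\<close>
      have "(961::real) \<le> 3.1415 ^ 6" by (simp add: power_divide)
      also have "\<dots> \<le> pi ^ 6" using pi_approx by (intro power_mono) auto
      finally have "K ^ 4 * 961 * \<kappa> ^ 3 * l\<^sup>2 \<le> K ^ 4 * pi ^ 6 * \<kappa> ^ 3 * l\<^sup>2"
        using K kM by (intro mult_right_mono mult_left_mono) auto
      then have "1024 \<le> K ^ 4 * pi ^ 6 * \<kappa> ^ 3 * l\<^sup>2" using K unfolding l_def \<kappa>_def by linarith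
      then have "1024 * \<theta> ^ 6 \<le> (K ^ 4 * pi ^ 6 * \<kappa> ^ 3 * l\<^sup>2) * \<theta> ^ 6"
        using \<theta> by (intro mult_right_mono) auto
      then show ?thesis using kM
        by (simp add: divide_le_eq) (simp add: algebra_simps power2_eq_square eval_nat_numeral)
    qed
    also have "\<dots> \<le> K ^ 4 * \<theta>\<^sup>2 * (s\<^sup>2)\<^sup>2"
      using s \<theta> l K by (intro mult_left_mono power_mono) auto
    also have "\<dots> = (K * sqrt \<theta> * s) ^ 4"
      using \<theta> power_mult[of "sqrt \<theta>" 2 2] power_mult[of s 2 2] by (simp add: power_mult_distrib)
    finally have "weight M ^ 4 \<le> (K * sqrt \<theta> * s) ^ 4" .
    then have "weight M \<le> K * sqrt \<theta> * s"
      using weight_nonneg K \<theta> spos by (subst (asm) power_mono_iff) auto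
    then show ?thesis using spos by (simp add: divide_le_eq)
  qed
  also have "\<dots> \<le> K * (3 / 4 * t + (1 - cos \<theta>) / (2 * t ^ 3 * (1 - b\<^sup>2 / 12)))"
  proof (intro mult_left_mono)
    define z where "z = sqrt \<theta>"
    have z: "0 \<le> z" "z ^ 4 = \<theta>\<^sup>2" unfolding z_def using \<theta> power_mult[of "sqrt \<theta>" 2 2] by auto
    \<comment> \<open>Young's inequality for \<open>sqrt \<theta>\<close>, with equality at \<open>\<theta> = t\<^sup>2\<close>\<close>
    have "0 \<le> (z - t)\<^sup>2 * (z\<^sup>2 + 2 * z * t + 3 * t\<^sup>2)" using z t by (intro mult_nonneg_nonneg) auto
    then have "4 * t ^ 3 * z \<le> 3 * t ^ 4 + z ^ 4" by (simp add: algebra_simps eval_nat_numeral)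
    then have "z \<le> 3 / 4 * t + \<theta>\<^sup>2 / (4 * t ^ 3)"
      using t unfolding z(2) by (simp add: field_simps eval_nat_numeral)
    also have "\<theta>\<^sup>2 / (4 * t ^ 3) \<le> (1 - cos \<theta>) / (2 * t ^ 3 * (1 - b\<^sup>2 / 12))"
    proof -
      have "\<theta>\<^sup>2 / (4 * t ^ 3) = (\<theta>\<^sup>2 / 2 * l) / (2 * t ^ 3 * l)" using l by simp
      also have "\<dots> \<le> (1 - cos \<theta>) / (2 * t ^ 3 * l)" using v t l by (intro divide_right_mono) auto
      finally show ?thesis by (simp add: l_def)
    qed
    finally show "sqrt \<theta> \<le> 3 / 4 * t + (1 - cos \<theta>) / (2 * t ^ 3 * (1 - b\<^sup>2 / 12))" by (simp add: z_def)
  qed (use K in simp)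
  finally show ?thesis .
qed

text \<open>Here \<open>V\<close> bounds the series from above at \<open>0\<close> and from below at \<open>pi\<close>, where \<open>cos \<theta>\<close> is \<open>1\<close> and \<open>- 1\<close>, and \<open>p\<close> bounds the rate of growth away from them. If \<open>p\<close> is at most the
coefficient \<open>P\<close> of \<open>cos \<theta>\<close>, then \<open>\<bar>P * cos \<theta> + S\<bar> \<le> P + V\<close> for the whole range of \<open>\<theta>\<close>.\<close>

definition phase_bound :: "nat \<Rightarrow> real \<Rightarrow> real \<Rightarrow> bool" where
  "phase_bound m V p \<longleftrightarrow> (\<forall>\<theta>\<in>{0..pi}.
     phase_series m \<theta> \<le> V + p * (1 - cos \<theta>) \<and> - phase_series m \<theta> \<le> V + p * (1 + cos \<theta>))"

lemma one_minus_cos_ge: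
  assumes "0 \<le> a" "a \<le> \<theta>" "\<theta> \<le> pi" "c \<le> a\<^sup>2 / 2 - a ^ 4 / 24"
  shows "c \<le> 1 - cos \<theta>"
  using cos_monotone_0_pi_le[OF assms(1-3)] cos_le_Taylor[of a] assms(4) by linarith

lemma sum_2_11: "(\<Sum>r = 2..<11. f r) = f 2 + f 3 + f 4 + f 5 + f 6 + f 7 + f 8 + f 9 + f (10::nat)"
  for f :: "nat \<Rightarrow> real"
proof -
  have "{2..<11} = {2, 3, 4, 5, 6, 7, 8, 9, 10::nat}" by auto
  then show ?thesis by simp
qed

lemma one_pm_cos_nonneg: "0 \<le> 1 - cos \<theta>" "0 \<le> 1 + cos \<theta>" for \<theta> :: real
  using cos_ge_minus_one[of \<theta>] cos_le_one[of \<theta>] by linarith+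

lemma phase_bound_signed:
  assumes "(\<Sum>r = 2..<11. phase_coeff m r) + 6325 / 10000 \<le> V"
    "- (\<Sum>r = 2..<11. (- 1) ^ r * phase_coeff m r) + 6325 / 10000 \<le> V" "23 \<le> p"
  shows "phase_bound m V p"
  unfolding phase_bound_def
proof (intro ballI conjI)
  fix \<theta> :: real
  have "23 * (1 - cos \<theta>) \<le> p * (1 - cos \<theta>)"
    by (rule mult_right_mono[OF assms(3) one_pm_cos_nonneg(1)])
  then show "phase_series m \<theta> \<le> V + p * (1 - cos \<theta>)"
    using phase_series_signed(1)[of m \<theta>] assms(1) by linarith
  have "23 * (1 + cos \<theta>) \<le> p * (1 + cos \<theta>)"
    by (rule mult_right_mono[OF assms(3) one_pm_cos_nonneg(2)])
  then show "- phase_series m \<theta> \<le> V + p * (1 + cos \<theta>)"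
    using phase_series_signed(2)[of m \<theta>] assms(2) by linarith
qed

lemma phase_bound_5: "phase_bound 5 (842 / 1000) 110"
  by (rule phase_bound_signed; use phase_coeff_table_5 in \<open>simp add: sum_2_11\<close>)

lemma phase_bound_6: "phase_bound 6 (1178 / 1000) 145"
  by (rule phase_bound_signed; use phase_coeff_table_6 in \<open>simp add: sum_2_11\<close>)

text \<open>For \<open>m = 7\<close> the second coefficient almost vanishes, and the sum of the other weights is small enough.\<close>

lemma phase_bound_7: "phase_bound 7 (1562 / 1000) 182"
  unfolding phase_bound_def
proof (intro ballI conjI)
  fix \<theta> :: real
  have "0 \<le> 182 * (1 - cos \<theta>)" "0 \<le> 182 * (1 + cos \<theta>)"
    using one_pm_cos_nonneg[of \<theta>] by (auto intro: mult_nonneg_nonneg)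
  moreover have "\<bar>phase_coeff 7 2\<bar> \<le> 1 / 10" using phase_coeff_table_7 by simp
  ultimately show "phase_series 7 \<theta> \<le> 1562 / 1000 + 182 * (1 - cos \<theta>)"
    "- phase_series 7 \<theta> \<le> 1562 / 1000 + 182 * (1 + cos \<theta>)"
    using phase_series_trivial[of 7 \<theta>] by linarith+
qed

lemma phase_lag_le:
  assumes "0 \<le> a" "0 \<le> x" "a\<^sup>2 \<le> x\<^sup>2 - 1" "22 / 7 * (2 * real m * (x - a)) \<le> c"
  shows "phase_lag m x \<le> c"
proof -
  have "a\<^sup>2 \<le> x\<^sup>2" using assms(3) by linarith
  then have "a \<le> x" using assms(2) by (rule power2_le_imp_le)
  have "phase_lag m x \<le> pi * (2 * real m * (x - a))"
    using real_le_rsqrt[OF assms(3)] unfolding phase_lag_def by (simp add: mult_left_mono)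
  also have "\<dots> \<le> 22 / 7 * (2 * real m * (x - a))"
    using pi_approx \<open>a \<le> x\<close> by (intro mult_right_mono) auto
  finally show ?thesis using assms(4) by linarith
qed

lemma late_2: "phase_lag 2 (real 5) \<le> 3 / 2" by (rule phase_lag_le[of "48989 / 10000"]) (simp_all add: power_divide)
lemma late_3: "phase_lag 3 (real 7) \<le> 3 / 2" by (rule phase_lag_le[of "69282 / 10000"]) (simp_all add: power_divide)
lemma late_4: "phase_lag 4 (real 9) \<le> 3 / 2" by (rule phase_lag_le[of "89442 / 10000"]) (simp_all add: power_divide)

text \<open>The second half of the bound is needed only where \<open>cos \<theta> \<le> 0\<close>; elsewhere the slack \<open>p * (1 + cos \<theta>)\<close> exceeds the sum of the weights.\<close>

lemma phase_bound_small_m: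
  assumes nearpi: "\<And>\<theta>. 0 \<le> \<theta> \<Longrightarrow> \<theta> \<le> pi \<Longrightarrow> cos \<theta> \<le> 0 \<Longrightarrow> - phase_series m \<theta> \<le> V + p * (1 + cos \<theta>)"
    and near0: "\<And>\<theta>. 0 \<le> \<theta> \<Longrightarrow> \<theta> \<le> pi \<Longrightarrow> phase_series m \<theta> \<le> V + p * (1 - cos \<theta>)"
    and "2 \<le> p" "0 \<le> V"
  shows "phase_bound m V p"
  unfolding phase_bound_def
proof (intro ballI conjI)
  fix \<theta> :: real assume t: "\<theta> \<in> {0..pi}"
  show "phase_series m \<theta> \<le> V + p * (1 - cos \<theta>)" using near0 t by simp
  show "- phase_series m \<theta> \<le> V + p * (1 + cos \<theta>)"
  proof (cases "cos \<theta> \<le> 0")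
    case True
    then show ?thesis using nearpi t by simp
  next
    case False
    then have "2 * 1 \<le> p * (1 + cos \<theta>)" using assms(3) by (intro mult_mono) auto
    then show ?thesis using phase_series_small[of m \<theta>] assms(4) by linarith
  qed
qed

text \<open>At \<open>\<theta> = 0\<close> a late tail consists of negative terms and can be dropped.\<close>

lemma phase_at_zero:
  assumes "2 \<le> M" "phase_lag m (real M) \<le> 3 / 2" "M \<le> 11"
  shows "phase_series m 0 \<le> (\<Sum>r = 2..<11. phase_coeff m r)"
proof -
  have "phase_tail m 11 0 \<le> (\<Sum>k. 0 :: real)"
  proof (rule suminf_le)
    show "phase_coeff m (k + 11) * cos (real (k + 11) * 0) \<le> 0" for k
      using phase_coeff_late(1)[OF assms(1,2), of "k + 11"] assms(3) by simp
  qed (use phase_coeff_cos_summable[of m 11 0] in auto)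
  then show ?thesis using phase_split[of 11 m 0] by simp
qed

lemma one_minus_cos_le: "1 - cos x \<le> x\<^sup>2 / 2" for x :: real
proof -
  have "1 - cos x = 2 * (sin (x / 2))\<^sup>2" using cos_double_sin[of "x / 2"] by simp
  also have "(sin (x / 2))\<^sup>2 \<le> (x / 2)\<^sup>2"
    using abs_sin_x_le_abs_x[of "x / 2"] by (simp only: abs_le_square_iff)
  finally show ?thesis by (simp add: power_divide)
qed

lemma phase_bound_4: "phase_bound 4 (562 / 1000) 78"
proof (rule phase_bound_small_m)
  fix \<theta> :: real assume t: "0 \<le> \<theta>" "\<theta> \<le> pi"
  have v: "0 \<le> 1 - cos \<theta>" "0 \<le> 1 + cos \<theta>" using cos_ge_minus_one[of \<theta>] cos_le_one[of \<theta>] by linarith+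
  have "(\<Sum>r = 2..<11. phase_coeff 4 r) + 6325 / 10000 \<le> 562 / 1000" using phase_coeff_table_4 by (simp add: sum_2_11)
  moreover have "23 * (1 - cos \<theta>) \<le> 78 * (1 - cos \<theta>)" using v by (intro mult_right_mono) auto
  ultimately show "phase_series 4 \<theta> \<le> 562 / 1000 + 78 * (1 - cos \<theta>)"
    using phase_series_signed(1)[of 4 \<theta>] by linarith
  assume c: "cos \<theta> \<le> 0"
  have late: "phase_coeff 4 r \<le> phase_coeff 4 (Suc r)" "phase_coeff 4 r \<le> 0" if "8 \<le> r" for r
    using phase_coeff_late[of 9 4 r] late_4 that phase_coeff_table_4 by (cases "r = 8"; simp)+
  have "- phase_series 4 \<theta> \<le> - (\<Sum>r = 2..<8. (- 1) ^ r * phase_coeff 4 r) - phase_coeff 4 8 + 24 * (1 + cos \<theta>)"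
    by (rule phase_series_near_pi[OF t c _ _ late]) auto
  moreover have "{2..<8} = {2, 3, 4, 5, 6, 7::nat}" by auto
  then have "- (\<Sum>r = 2..<8. (- 1) ^ r * phase_coeff 4 r) - phase_coeff 4 8 \<le> 562 / 1000" using phase_coeff_table_4 by simp
  ultimately show "- phase_series 4 \<theta> \<le> 562 / 1000 + 78 * (1 + cos \<theta>)" using v by simp
qed auto

lemma cos_double_bound: "cos (2 * \<theta>) \<le> 1 - 38 / 10 * (1 - cos \<theta>)" if "1 - cos \<theta> \<le> 1 / 10" for \<theta> :: real
proof -
  have "cos (2 * \<theta>) = 1 - 4 * (1 - cos \<theta>) + 2 * (1 - cos \<theta>)\<^sup>2"
    unfolding cos_double_cos by (simp add: power2_eq_square algebra_simps)
  moreover have "2 * (1 - cos \<theta>)\<^sup>2 \<le> 2 * (1 / 10 * (1 - cos \<theta>))"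
    unfolding power2_eq_square using that by (intro mult_left_mono mult_right_mono) auto
  ultimately show ?thesis by (simp add: field_simps)
qed

text \<open>Away from \<open>0\<close> the slack \<open>51 * (1 - cos \<theta>)\<close> exceeds the sum of the weights. Nearer to \<open>0\<close> the tail starts at the largest \<open>R\<close> for which
\<open>R * \<theta> \<le> pi / 2\<close> holds on the interval; \<open>t\<close> is chosen in each interval so that the constant and the multiple of \<open>v\<close> fit.\<close>

lemma phase_bound_3: "phase_bound 3 (346 / 1000) 51"
proof (rule phase_bound_small_m)
  fix \<theta> :: real assume t: "0 \<le> \<theta>" "\<theta> \<le> pi"
  define v where "v = 1 - cos \<theta>"
  define w where "w = 1 + cos \<theta>"
  have v: "0 \<le> v" "0 \<le> w" using one_pm_cos_nonneg[of \<theta>] by (simp_all add: v_def w_def)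
  have up: "phase_coeff 3 r * cos (real r * \<theta>) \<le> u + l * (real r)\<^sup>2 * v"
    if "phase_coeff 3 r \<le> u" "- phase_coeff 3 r \<le> l" "0 \<le> l" for r u l
    unfolding v_def by (rule phase_coeff_cos_upper[OF that])
  have head: "phase_coeff 3 2 * cos (2 * \<theta>) \<le> 0.1898" "phase_coeff 3 3 * cos (3 * \<theta>) \<le> 0.1618"
      "phase_coeff 3 4 * cos (4 * \<theta>) \<le> 0.0051"
      "phase_coeff 3 5 * cos (5 * \<theta>) \<le> - 0.0402 + 1.01 * v" "phase_coeff 3 6 * cos (6 * \<theta>) \<le> - 0.0485 + 1.7532 * v"
      "phase_coeff 3 7 * cos (7 * \<theta>) \<le> - 0.0462 + 2.2687 * v" "phase_coeff 3 8 * cos (8 * \<theta>) \<le> - 0.0412 + 2.6432 * v"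
      "phase_coeff 3 9 * cos (9 * \<theta>) \<le> - 0.036 + 2.9241 * v" "phase_coeff 3 10 * cos (10 * \<theta>) \<le> - 0.0314 + 3.15 * v"
    using up[of 2 "0.1898" 0] up[of 3 "0.1618" 0] up[of 4 "0.0051" 0]
      up[of 5 "- 0.0402" "0.0404"] up[of 6 "- 0.0485" "0.0487"] up[of 7 "- 0.0462" "0.0463"]
      up[of 8 "- 0.0412" "0.0413"] up[of 9 "- 0.036" "0.0361"] up[of 10 "- 0.0314" "0.0315"]
      phase_coeff_table_3 by simp_all
  show "phase_series 3 \<theta> \<le> 346 / 1000 + 51 * (1 - cos \<theta>)"
  proof -
    consider "\<theta> = 0" | "0 < \<theta>" "\<theta> \<le> 157 / 1000" | "157 / 1000 \<le> \<theta>" "\<theta> \<le> 26 / 100" | "26 / 100 \<le> \<theta>"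
      using t by linarith
    then show ?thesis
    proof cases
      case 1
      then show ?thesis using phase_at_zero[of 7 3] late_3 phase_coeff_table_3 by (simp add: sum_2_11)
    next
      case 2
      have "phase_tail 3 (Suc 10) \<theta> \<le> 1.0236 * (3 / 4 * 0.249 + (1 - cos \<theta>) / (2 * 0.249 ^ 3 * (1 - 0.157\<^sup>2 / 12)))"
        by (rule phase_tail_near_zero[OF _ late_3]) (use 2 in \<open>simp_all add: power_divide\<close>)
      also have "\<dots> \<le> 0.1912 + 33.3 * v"
        unfolding v_def[symmetric] using v by (simp add: power_divide field_simps)
      finally show ?thesis
        using phase_split[of 11 3 \<theta>] head v unfolding v_def[symmetric] by (simp add: sum_2_11)
    next
      case 3
      have "phase_tail 3 (Suc 6) \<theta> \<le> 1.035 * (3 / 4 * 0.396 + (1 - cos \<theta>) / (2 * 0.396 ^ 3 * (1 - 0.26\<^sup>2 / 12)))"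
        by (rule phase_tail_near_zero[OF _ late_3]) (use 3 in \<open>simp_all add: power_divide\<close>)
      also have "\<dots> \<le> 0.3075 + 8.5 * v"
        unfolding v_def[symmetric] using v by (simp add: power_divide field_simps)
      finally have "phase_tail 3 7 \<theta> \<le> 0.3075 + 8.5 * v" by simp
      moreover have "{2..<7} = {2, 3, 4, 5, 6::nat}" by auto
      moreover have "12 / 1000 \<le> v"
        unfolding v_def using 3 t by (intro one_minus_cos_ge[of "157 / 1000"]) (auto simp: power_divide)
      ultimately show ?thesis
        using phase_split[of 7 3 \<theta>] head v unfolding v_def[symmetric] by simp
    next
      case 4
      have "33 / 1000 \<le> v"
        unfolding v_def using 4 t by (intro one_minus_cos_ge[of "26 / 100"]) (auto simp: power_divide)
      then show ?thesis using phase_series_small[of 3 \<theta>] unfolding v_def[symmetric] by linarith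
    qed
  qed
  assume c: "cos \<theta> \<le> 0"
  note late = phase_coeff_late(2)[OF _ late_3] phase_coeff_late(1)[OF _ late_3]
  have "- phase_series 3 \<theta> \<le> - (\<Sum>r = 2..<7. (- 1) ^ r * phase_coeff 3 r) - phase_coeff 3 7 + 24 * (1 + cos \<theta>)"
    by (rule phase_series_near_pi[OF t c _ _ late]) auto
  moreover have "{2..<7} = {2, 3, 4, 5, 6::nat}" by auto
  then have "- (\<Sum>r = 2..<7. (- 1) ^ r * phase_coeff 3 r) - phase_coeff 3 7 \<le> 346 / 1000" using phase_coeff_table_3 by simp
  ultimately show "- phase_series 3 \<theta> \<le> 346 / 1000 + 51 * (1 + cos \<theta>)" using v unfolding w_def[symmetric] by linarith
qed auto

text \<open>The tightest case, treated like \<open>m = 3\<close> with one more interval. The coefficient for \<open>r = 2\<close> is large and positive here, and the decrease of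
\<open>cos (2 * \<theta>)\<close> is needed to reduce its contribution.\<close>

lemma phase_bound_2: "phase_bound 2 (2065 / 10000) (279 / 10)"
proof (rule phase_bound_small_m)
  fix \<theta> :: real assume t: "0 \<le> \<theta>" "\<theta> \<le> pi"
  define v where "v = 1 - cos \<theta>"
  define w where "w = 1 + cos \<theta>"
  have v: "0 \<le> v" "0 \<le> w" using one_pm_cos_nonneg[of \<theta>] by (simp_all add: v_def w_def)
  have up: "phase_coeff 2 r * cos (real r * \<theta>) \<le> u + l * (real r)\<^sup>2 * v"
    if "phase_coeff 2 r \<le> u" "- phase_coeff 2 r \<le> l" "0 \<le> l" for r u l
    unfolding v_def by (rule phase_coeff_cos_upper[OF that])
  have small: "v \<le> 1 / 10" if "\<theta> \<le> 38 / 100"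
  proof -
    have "\<theta>\<^sup>2 \<le> (38 / 100)\<^sup>2" using that t by (intro power_mono)
    then show ?thesis using one_minus_cos_le[of \<theta>] unfolding v_def by (simp add: power_divide)
  qed
  have head: "phase_coeff 2 3 * cos (3 * \<theta>) \<le> - 0.0417 + 0.3771 * v" "phase_coeff 2 4 * cos (4 * \<theta>) \<le> - 0.0903 + 1.448 * v"
      "phase_coeff 2 5 * cos (5 * \<theta>) \<le> - 0.0816 + 2.0425 * v" "phase_coeff 2 6 * cos (6 * \<theta>) \<le> - 0.0669 + 2.4156 * v"
      "phase_coeff 2 7 * cos (7 * \<theta>) \<le> - 0.0544 + 2.6705 * v" "phase_coeff 2 8 * cos (8 * \<theta>) \<le> - 0.0447 + 2.8672 * v"
      "phase_coeff 2 9 * cos (9 * \<theta>) \<le> - 0.0372 + 3.0213 * v" "phase_coeff 2 10 * cos (10 * \<theta>) \<le> - 0.0314 + 3.15 * v"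
    using up[of 3 "- 0.0417" "0.0419"] up[of 4 "- 0.0903" "0.0905"]
      up[of 5 "- 0.0816" "0.0817"] up[of 6 "- 0.0669" "0.0671"] up[of 7 "- 0.0544" "0.0545"]
      up[of 8 "- 0.0447" "0.0448"] up[of 9 "- 0.0372" "0.0373"] up[of 10 "- 0.0314" "0.0315"]
      phase_coeff_table_2 by simp_all
  have second: "phase_coeff 2 2 * cos (2 * \<theta>) \<le> 0.3719 - 1.412 * v" if "v \<le> 1 / 10"
  proof -
    have "phase_coeff 2 2 * cos (2 * \<theta>) \<le> phase_coeff 2 2 * (1 - 38 / 10 * v)"
      using cos_double_bound[of \<theta>] that phase_coeff_table_2(1) unfolding v_def by (intro mult_left_mono) auto
    moreover have "0.3716 * v \<le> phase_coeff 2 2 * v" using phase_coeff_table_2(1) v by (intro mult_right_mono) auto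
    ultimately show ?thesis using phase_coeff_table_2(1) v by (simp add: algebra_simps)
  qed
  show "phase_series 2 \<theta> \<le> 2065 / 10000 + 279 / 10 * (1 - cos \<theta>)"
  proof -
    consider "\<theta> = 0" | "0 < \<theta>" "\<theta> \<le> 157 / 1000" | "157 / 1000 \<le> \<theta>" "\<theta> \<le> 22 / 100"
      | "22 / 100 \<le> \<theta>" "\<theta> \<le> 38 / 100" | "38 / 100 \<le> \<theta>"
      using t by linarith
    then show ?thesis
    proof cases
      case 1
      then show ?thesis using phase_at_zero[of 5 2] late_2 phase_coeff_table_2 by (simp add: sum_2_11)
    next
      case 2
      have "phase_tail 2 (Suc 10) \<theta> \<le> 1.0236 * (3 / 4 * 0.3564 + (1 - cos \<theta>) / (2 * 0.3564 ^ 3 * (1 - 0.157\<^sup>2 / 12)))"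
        by (rule phase_tail_near_zero[OF _ late_2]) (use 2 in \<open>simp_all add: power_divide\<close>)
      also have "\<dots> \<le> 0.2737 + 11.335 * v"
        unfolding v_def[symmetric] using v by (simp add: power_divide field_simps)
      finally have "phase_tail 2 11 \<theta> \<le> 0.2737 + 11.335 * v" by simp
      moreover have "v \<le> 1 / 10" using 2 by (intro small) simp
      ultimately show ?thesis
        using phase_split[of 11 2 \<theta>] head second v unfolding v_def[symmetric] by (simp add: sum_2_11)
    next
      case 3
      have "phase_tail 2 (Suc 7) \<theta> \<le> 1.0303 * (3 / 4 * 0.396 + (1 - cos \<theta>) / (2 * 0.396 ^ 3 * (1 - 0.22\<^sup>2 / 12)))"
        by (rule phase_tail_near_zero[OF _ late_2]) (use 3 in \<open>simp_all add: power_divide\<close>)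
      also have "\<dots> \<le> 0.3061 + 8.4 * v"
        unfolding v_def[symmetric] using v by (simp add: power_divide field_simps)
      finally have "phase_tail 2 8 \<theta> \<le> 0.3061 + 8.4 * v" by simp
      moreover have "{2..<8} = {2, 3, 4, 5, 6, 7::nat}" by auto
      moreover have "12 / 1000 \<le> v"
        unfolding v_def using 3 t by (intro one_minus_cos_ge[of "157 / 1000"]) (auto simp: power_divide)
      moreover have "v \<le> 1 / 10" using 3 by (intro small) simp
      ultimately show ?thesis
        using phase_split[of 8 2 \<theta>] head second v unfolding v_def[symmetric] by simp
    next
      case 4
      have "phase_tail 2 (Suc 4) \<theta> \<le> 1.0541 * (3 / 4 * 0.469 + (1 - cos \<theta>) / (2 * 0.469 ^ 3 * (1 - 0.38\<^sup>2 / 12)))"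
        by (rule phase_tail_near_zero[OF _ late_2]) (use 4 in \<open>simp_all add: power_divide\<close>)
      also have "\<dots> \<le> 0.3708 + 5.2 * v"
        unfolding v_def[symmetric] using v by (simp add: power_divide field_simps)
      finally have "phase_tail 2 5 \<theta> \<le> 0.3708 + 5.2 * v" by simp
      moreover have "{2..<5} = {2, 3, 4::nat}" by auto
      moreover have "24 / 1000 \<le> v"
        unfolding v_def using 4 t by (intro one_minus_cos_ge[of "22 / 100"]) (auto simp: power_divide)
      moreover have "v \<le> 1 / 10" using 4 by (intro small) simp
      ultimately show ?thesis
        using phase_split[of 5 2 \<theta>] head second v unfolding v_def[symmetric] by simp
    next
      case 5
      have "7 / 100 \<le> v"
        unfolding v_def using 5 t by (intro one_minus_cos_ge[of "38 / 100"]) (auto simp: power_divide)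
      then show ?thesis using phase_series_small[of 2 \<theta>] unfolding v_def[symmetric] by linarith
    qed
  qed
  assume c: "cos \<theta> \<le> 0"
  note late = phase_coeff_late(2)[OF _ late_2] phase_coeff_late(1)[OF _ late_2]
  have "- phase_series 2 \<theta> \<le> - (\<Sum>r = 2..<5. (- 1) ^ r * phase_coeff 2 r) - phase_coeff 2 5 + 24 * (1 + cos \<theta>)"
    by (rule phase_series_near_pi[OF t c _ _ late]) auto
  moreover have "{2..<5} = {2, 3, 4::nat}" by auto
  then have "- (\<Sum>r = 2..<5. (- 1) ^ r * phase_coeff 2 r) - phase_coeff 2 5 \<le> 2065 / 10000" using phase_coeff_table_2 by simp
  ultimately show "- phase_series 2 \<theta> \<le> 2065 / 10000 + 279 / 10 * (1 + cos \<theta>)" using v unfolding w_def[symmetric] by linarith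
qed auto

section \<open>The budget left by the modified Bessel function\<close>

text \<open>The factor by which the lower bound for \<open>I\<^sub>1(y)\<close> falls short of its leading asymptotics.\<close>

definition bessel_factor :: "real \<Rightarrow> real" where
  "bessel_factor y = 1 - 3 / (8 * y) - 15 / (128 * y\<^sup>2) - 315 / (512 * y ^ 3)"

abbreviation pow32 :: "nat \<Rightarrow> real" where "pow32 m \<equiv> real m * sqrt (real m)"

lemma pi_sq_le: "4 * pi\<^sup>2 \<le> 394784177 / 10000000"
proof -
  have "pi\<^sup>2 \<le> (31415926536 / 10000000000)\<^sup>2" using pi_approx by (intro power_mono) auto
  then show ?thesis by (simp add: power_divide)
qed

lemma pi_sq_ge: "98696 / 10000 \<le> pi\<^sup>2"
proof -
  have "(314159265 / 100000000)\<^sup>2 \<le> pi\<^sup>2" using pi_approx by (intro power_mono) auto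
  then show ?thesis by (simp add: power_divide)
qed

lemma bessel_factor_mono: "0 < x \<Longrightarrow> x \<le> y \<Longrightarrow> bessel_factor x \<le> bessel_factor y"
  unfolding bessel_factor_def by (intro diff_mono divide_left_mono mult_left_mono power_mono mult_pos_pos zero_less_power) auto

lemma bessel_factor_ge:
  assumes "0 < m" shows "bessel_factor (628318530 / 100000000 * real m) \<le> bessel_factor (2 * pi * real m)"
  using assms pi_approx by (intro bessel_factor_mono mult_right_mono) auto

text \<open>Everything is monotone in \<open>pi\<close> and in \<open>sqrt m\<close> except for the difference \<open>40 * q - 4 * pi\<^sup>2\<close>, whose sign is not known in general; hence
the budget is required at both ends of the enclosure of \<open>sqrt m\<close>.\<close>

lemma budget_numeric:
  assumes m: "0 < m" and q: "q \<le> bessel_factor (628318530 / 100000000 * real m)"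
    and root: "0 \<le> lo" "lo \<le> sqrt (real m)" "sqrt (real m) \<le> hi"
    and V: "4 * V + 1197 / 10000 / real m \<le> real m * lo * (40 * q - 394784177 / 10000000) + 3 * q"
      "4 * V + 1197 / 10000 / real m \<le> real m * hi * (40 * q - 394784177 / 10000000) + 3 * q"
    and p: "p \<le> real m * lo * (98696 / 10000)"
  shows "4 * pi\<^sup>2 * pow32 m + 4 * V + 1197 / 10000 / real m \<le> (40 * pow32 m + 3) * bessel_factor (2 * pi * real m)"
    and "p \<le> pi\<^sup>2 * pow32 m"
proof -
  have qI: "q \<le> bessel_factor (2 * pi * real m)" using q bessel_factor_ge[OF m] by linarith
  define c where "c = 40 * q - 394784177 / 10000000"
  have "4 * V + 1197 / 10000 / real m \<le> pow32 m * c + 3 * q"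
  proof (cases "0 \<le> c")
    case True
    then have "real m * lo * c \<le> pow32 m * c" using root by (intro mult_right_mono mult_left_mono) auto
    then show ?thesis using V(1) unfolding c_def[symmetric] by linarith
  next
    case False
    then have "real m * hi * c \<le> pow32 m * c" using root by (intro mult_right_mono_neg mult_left_mono) auto
    then show ?thesis using V(2) unfolding c_def[symmetric] by linarith
  qed
  moreover have "4 * pi\<^sup>2 * pow32 m \<le> 394784177 / 10000000 * pow32 m"
    using pi_sq_le by (intro mult_right_mono) auto
  moreover have "(40 * pow32 m + 3) * q \<le> (40 * pow32 m + 3) * bessel_factor (2 * pi * real m)"
    using qI by (intro mult_left_mono) auto
  ultimately show "4 * pi\<^sup>2 * pow32 m + 4 * V + 1197 / 10000 / real m \<le> (40 * pow32 m + 3) * bessel_factor (2 * pi * real m)"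
    by (simp add: c_def algebra_simps)
  have "98696 / 10000 * (real m * lo) \<le> pi\<^sup>2 * pow32 m"
    using pi_sq_ge root by (intro mult_mono mult_left_mono) auto
  then show "p \<le> pi\<^sup>2 * pow32 m" using p by (simp add: mult_ac)
qed

text \<open>The required bound in the limit \<open>\<sigma> \<rightarrow> \<infinity>\<close> for the leading parts of the terms. The amount \<open>0.1197 / m\<close> is set aside for replacing
the leading parts by the terms themselves.\<close>

definition phase_budget :: "nat \<Rightarrow> bool" where
  "phase_budget m \<longleftrightarrow> (\<forall>\<theta>\<in>{0..pi}. 4 * pi\<^sup>2 * pow32 m * \<bar>cos \<theta> + phase_series m \<theta> / (pi\<^sup>2 * pow32 m)\<bar>
     \<le> (40 * pow32 m + 3) * bessel_factor (2 * pi * real m) - 1197 / 10000 / real m)"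

lemma phase_budgetI:
  assumes "0 < m" "phase_bound m V p" "p \<le> pi\<^sup>2 * pow32 m"
    and "4 * pi\<^sup>2 * pow32 m + 4 * V + 1197 / 10000 / real m \<le> (40 * pow32 m + 3) * bessel_factor (2 * pi * real m)"
  shows "phase_budget m"
  unfolding phase_budget_def
proof
  fix \<theta> :: real assume t: "\<theta> \<in> {0..pi}"
  define P where "P = pi\<^sup>2 * pow32 m"
  define S where "S = phase_series m \<theta>"
  have P: "0 < P" using assms(1) by (simp add: P_def)
  have S: "S \<le> V + p * (1 - cos \<theta>)" "- S \<le> V + p * (1 + cos \<theta>)"
    using assms(2) t by (auto simp: phase_bound_def S_def)
  have p: "p * (1 - cos \<theta>) \<le> P * (1 - cos \<theta>)" "p * (1 + cos \<theta>) \<le> P * (1 + cos \<theta>)"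
    using assms(3) one_pm_cos_nonneg[of \<theta>] unfolding P_def by (auto intro: mult_right_mono)
  have "\<bar>P * cos \<theta> + S\<bar> \<le> P + V"
    using S p by (simp add: abs_le_iff algebra_simps)
  moreover have "4 * pi\<^sup>2 * pow32 m * \<bar>cos \<theta> + S / P\<bar> = 4 * \<bar>P * cos \<theta> + S\<bar>"
  proof -
    have "P * cos \<theta> + S = P * (cos \<theta> + S / P)" using P by (simp add: algebra_simps)
    then show ?thesis using P by (simp add: abs_mult) (simp add: P_def)
  qed
  ultimately show "4 * pi\<^sup>2 * pow32 m * \<bar>cos \<theta> + phase_series m \<theta> / (pi\<^sup>2 * pow32 m)\<bar>
     \<le> (40 * pow32 m + 3) * bessel_factor (2 * pi * real m) - 1197 / 10000 / real m"
    using assms(4) unfolding S_def[symmetric] P_def[symmetric] by (simp add: P_def)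
qed

lemma phase_budget_2: "phase_budget 2"
proof -
  \<comment> \<open>a lower bound for the factor at \<open>y = 2 * pi * m\<close> with \<open>pi\<close> rounded down\<close>
  have q: "9691063 / 10000000 \<le> bessel_factor (628318530 / 100000000 * real 2)"
    by (simp add: bessel_factor_def power_divide)
  have root: "0 \<le> (14142135 / 10000000 :: real)" "14142135 / 10000000 \<le> sqrt (real 2)" "sqrt (real 2) \<le> 14142136 / 10000000"
    by simp (rule real_le_rsqrt, simp add: power_divide, rule real_le_lsqrt, simp_all add: power_divide)
  show ?thesis
    using budget_numeric[OF _ q root, of "2065 / 10000" "279 / 10"]
    by (intro phase_budgetI[OF _ phase_bound_2]) simp_all
qed

lemma phase_budget_3: "phase_budget 3"
proof -
  have q: "9796839 / 10000000 \<le> bessel_factor (628318530 / 100000000 * real 3)"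
    by (simp add: bessel_factor_def power_divide)
  have root: "0 \<le> (17320508 / 10000000 :: real)" "17320508 / 10000000 \<le> sqrt (real 3)" "sqrt (real 3) \<le> 17320509 / 10000000"
    by simp (rule real_le_rsqrt, simp add: power_divide, rule real_le_lsqrt, simp_all add: power_divide)
  show ?thesis
    using budget_numeric[OF _ q root, of "346 / 1000" "51"]
    by (intro phase_budgetI[OF _ phase_bound_3]) simp_all
qed

lemma phase_budget_4: "phase_budget 4"
proof -
  have q: "9848549 / 10000000 \<le> bessel_factor (628318530 / 100000000 * real 4)"
    by (simp add: bessel_factor_def power_divide)
  have root: "0 \<le> (20000000 / 10000000 :: real)" "20000000 / 10000000 \<le> sqrt (real 4)" "sqrt (real 4) \<le> 20000001 / 10000000"
    by simp (rule real_le_rsqrt, simp add: power_divide, rule real_le_lsqrt, simp_all add: power_divide)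
  show ?thesis
    using budget_numeric[OF _ q root, of "562 / 1000" "78"]
    by (intro phase_budgetI[OF _ phase_bound_4]) simp_all
qed

lemma phase_budget_5: "phase_budget 5"
proof -
  have q: "9879248 / 10000000 \<le> bessel_factor (628318530 / 100000000 * real 5)"
    by (simp add: bessel_factor_def power_divide)
  have root: "0 \<le> (22360679 / 10000000 :: real)" "22360679 / 10000000 \<le> sqrt (real 5)" "sqrt (real 5) \<le> 22360680 / 10000000"
    by simp (rule real_le_rsqrt, simp add: power_divide, rule real_le_lsqrt, simp_all add: power_divide)
  show ?thesis
    using budget_numeric[OF _ q root, of "842 / 1000" "110"]
    by (intro phase_budgetI[OF _ phase_bound_5]) simp_all
qed

lemma phase_budget_6: "phase_budget 6"
proof -
  have q: "9899588 / 10000000 \<le> bessel_factor (628318530 / 100000000 * real 6)"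
    by (simp add: bessel_factor_def power_divide)
  have root: "0 \<le> (24494897 / 10000000 :: real)" "24494897 / 10000000 \<le> sqrt (real 6)" "sqrt (real 6) \<le> 24494898 / 10000000"
    by simp (rule real_le_rsqrt, simp add: power_divide, rule real_le_lsqrt, simp_all add: power_divide)
  show ?thesis
    using budget_numeric[OF _ q root, of "1178 / 1000" "145"]
    by (intro phase_budgetI[OF _ phase_bound_6]) simp_all
qed

lemma phase_budget_7: "phase_budget 7"
proof -
  have q: "9914060 / 10000000 \<le> bessel_factor (628318530 / 100000000 * real 7)"
    by (simp add: bessel_factor_def power_divide)
  have root: "0 \<le> (26457513 / 10000000 :: real)" "26457513 / 10000000 \<le> sqrt (real 7)" "sqrt (real 7) \<le> 26457514 / 10000000"
    by simp (rule real_le_rsqrt, simp add: power_divide, rule real_le_lsqrt, simp_all add: power_divide)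
  show ?thesis
    using budget_numeric[OF _ q root, of "1562 / 1000" "182"]
    by (intro phase_budgetI[OF _ phase_bound_7]) simp_all
qed

text \<open>For \<open>m \<ge> 8\<close> the surplus \<open>(40 - 4 * pi\<^sup>2) * m powr (3 / 2) + 3\<close> exceeds four times the sum of the weights, with the losses in
\<open>bessel_factor\<close>, about \<open>0.39 / (2 * pi * m)\<close>, included.\<close>

lemma phase_budget_large:
  assumes "8 \<le> m" shows "phase_budget m"
proof -
  define z where "z = sqrt (real m)"
  have m: "8 \<le> real m" using assms by simp
  have z: "2828 / 1000 \<le> z" unfolding z_def using m by (intro real_le_rsqrt) (simp add: power_divide)
  define y where "y = 628318530 / 100000000 * real m"
  define u where "u = 1 / y"
  have u: "0 < u" "u \<le> 1 / 50" using m by (auto simp: y_def u_def field_simps)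
  have "u\<^sup>2 \<le> 1 / 50 * u" unfolding power2_eq_square using u by (intro mult_right_mono) auto
  moreover have "u ^ 3 \<le> 1 / 50 * u"
  proof -
    have "u * u\<^sup>2 \<le> 1 * (1 / 50 * u)" using u \<open>u\<^sup>2 \<le> 1 / 50 * u\<close> by (intro mult_mono) auto
    then show ?thesis by (simp add: power3_eq_cube power2_eq_square)
  qed
  moreover have "bessel_factor y = 1 - 3 / 8 * u - 15 / 128 * u\<^sup>2 - 315 / 512 * u ^ 3"
    by (simp add: bessel_factor_def u_def power_divide)
  ultimately have "1 - 39 / 100 * u \<le> bessel_factor y" using u(1) by linarith
  then have I: "1 - 39 / 100 * u \<le> bessel_factor (2 * pi * real m)"
    using bessel_factor_ge[of m] assms unfolding y_def by linarith
  have "(40 * pow32 m + 3) * (1 - 39 / 100 * u) \<le> (40 * pow32 m + 3) * bessel_factor (2 * pi * real m)"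
    using I by (intro mult_left_mono) auto
  moreover have mu: "real m * u \<le> 1592 / 10000" using m by (simp add: y_def u_def)
  have "z * (real m * u) \<le> z * (1592 / 10000)" using mu z by (intro mult_left_mono) auto
  moreover have "z * (168 / 100) \<le> z * (52158 / 100000 * real m - 24836 / 10000)" using m z by (intro mult_left_mono) auto
  then have "z * (168 / 100) \<le> 52158 / 100000 * pow32 m - 24836 / 10000 * z" by (simp add: z_def algebra_simps)
  moreover have "(40 * pow32 m + 3) * (1 - 39 / 100 * u)
      = 40 * pow32 m + 3 - 156 / 10 * (z * (real m * u)) - 117 / 100 * u" by (simp add: z_def algebra_simps)
  moreover have "4 * pi\<^sup>2 * pow32 m \<le> 394784177 / 10000000 * pow32 m"
    using pi_sq_le by (intro mult_right_mono) auto
  moreover have "1197 / 10000 / real m \<le> 1197 / 80000" using m by (simp add: field_simps)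
  moreover have "0 \<le> pow32 m" by simp
  ultimately have "4 * pi\<^sup>2 * pow32 m + 4 * (1804 / 1000) + 1197 / 10000 / real m \<le> (40 * pow32 m + 3) * bessel_factor (2 * pi * real m)"
    using u z by linarith
  then show ?thesis
  proof (rule phase_budgetI[rotated 3])
    show "0 < m" using assms by simp
    show "phase_bound m (1804 / 1000) 0"
      unfolding phase_bound_def
      using abs_le_D1[OF phase_series_small[of m]] abs_le_D2[OF phase_series_small[of m]] by simp
  qed simp
qed

lemma phase_budget_holds: "2 \<le> m \<Longrightarrow> phase_budget m"
  using phase_budget_2 phase_budget_3 phase_budget_4 phase_budget_5 phase_budget_6 phase_budget_7 phase_budget_large
  by (cases "8 \<le> m") (auto simp: not_le less_Suc_eq numeral_eq_Suc)

section \<open>The alias series in the limit of infinite oversampling\<close>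

lemma semicircle_cos_has_integral: "((\<lambda>s. semicircle s * cos (x * s)) has_integral pi * bessel (- (x\<^sup>2))) {-1..1}"
  unfolding integral_semicircle_cos[symmetric]
  by (intro integrable_integral integrable_continuous_interval continuous_intros)

text \<open>The Poisson integral with the Taylor bounds of the cosine inserted.\<close>

lemma bessel_bounds:
  shows "bessel (- (x\<^sup>2)) \<le> 1 / 2" "1 / 2 - x\<^sup>2 / 16 \<le> bessel (- (x\<^sup>2))"
    "bessel (- (x\<^sup>2)) \<le> 1 / 2 - x\<^sup>2 / 16 + x ^ 4 / 384" "- (1 / 2) \<le> bessel (- (x\<^sup>2))"
proof -
  have m0: "(semicircle has_integral pi / 2) {-1..1}"
    using moment_has_integral[of 0 0] by (simp add: moment_eq)
  have m1: "((\<lambda>s. s\<^sup>2 * semicircle s) has_integral pi / 8) {-1..1}"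
    using moment_has_integral[of 1 0] by (simp add: moment_eq fact_numeral)
  have m2: "((\<lambda>s. s ^ 4 * semicircle s) has_integral pi / 16) {-1..1}"
    using moment_has_integral[of 2 0] by (simp add: moment_eq fact_numeral)
  have nn: "0 \<le> semicircle s" if "s \<in> {-1..1}" for s using semicircle_nonneg[OF that] by simp
  have "pi * bessel (- (x\<^sup>2)) \<le> pi / 2"
    by (rule has_integral_le[OF semicircle_cos_has_integral m0]) (rule mult_left_le[OF cos_le_one nn])
  then show "bessel (- (x\<^sup>2)) \<le> 1 / 2" by simp
  have "- (pi / 2) \<le> pi * bessel (- (x\<^sup>2))"
  proof (rule has_integral_le[OF has_integral_neg[OF m0] semicircle_cos_has_integral])
    fix s :: real assume "s \<in> {-1..1}"
    then have "semicircle s * (- 1) \<le> semicircle s * cos (x * s)" by (intro mult_left_mono nn) auto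
    then show "- semicircle s \<le> semicircle s * cos (x * s)" by simp
  qed
  then have "pi * (- (1 / 2)) \<le> pi * bessel (- (x\<^sup>2))" by simp
  then show "- (1 / 2) \<le> bessel (- (x\<^sup>2))" by (rule mult_left_le_imp_le) simp
  have "pi / 2 - x\<^sup>2 / 2 * (pi / 8) \<le> pi * bessel (- (x\<^sup>2))"
  proof (rule has_integral_le[OF has_integral_diff[OF m0 has_integral_mult_right[OF m1]] semicircle_cos_has_integral])
    fix s :: real assume s: "s \<in> {-1..1}"
    have "semicircle s * (1 - (x * s)\<^sup>2 / 2) \<le> semicircle s * cos (x * s)"
      using one_minus_cos_le[of "x * s"] by (intro mult_left_mono nn s) linarith
    then show "semicircle s - x\<^sup>2 / 2 * (s\<^sup>2 * semicircle s) \<le> semicircle s * cos (x * s)"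
      by (simp add: algebra_simps power_mult_distrib)
  qed
  then have "pi * (1 / 2 - x\<^sup>2 / 16) \<le> pi * bessel (- (x\<^sup>2))" by (simp add: algebra_simps)
  then show "1 / 2 - x\<^sup>2 / 16 \<le> bessel (- (x\<^sup>2))" by (rule mult_left_le_imp_le) simp
  have "pi * bessel (- (x\<^sup>2)) \<le> pi / 2 - x\<^sup>2 / 2 * (pi / 8) + x ^ 4 / 24 * (pi / 16)"
  proof (rule has_integral_le[OF semicircle_cos_has_integral has_integral_add[OF has_integral_diff[OF m0 has_integral_mult_right[OF m1]] has_integral_mult_right[OF m2]]])
    fix s :: real assume s: "s \<in> {-1..1}"
    have "semicircle s * cos (x * s) \<le> semicircle s * (1 - (x * s)\<^sup>2 / 2 + (x * s) ^ 4 / 24)"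
      by (intro mult_left_mono nn s cos_le_Taylor)
    then show "semicircle s * cos (x * s) \<le> semicircle s - x\<^sup>2 / 2 * (s\<^sup>2 * semicircle s) + x ^ 4 / 24 * (s ^ 4 * semicircle s)"
      by (simp add: algebra_simps power_mult_distrib)
  qed
  then have "pi * bessel (- (x\<^sup>2)) \<le> pi * (1 / 2 - x\<^sup>2 / 16 + x ^ 4 / 384)" by (simp add: algebra_simps)
  then show "bessel (- (x\<^sup>2)) \<le> 1 / 2 - x\<^sup>2 / 16 + x ^ 4 / 384" by (rule mult_left_le_imp_le) simp
qed

lemma bessel_envelope:
  assumes "0 < x" shows "\<bar>bessel (- (x\<^sup>2))\<bar> \<le> amplitude x * (1 + 3 / (8 * x))"
proof -
  have "\<bar>amplitude x * cos (x - 3 * pi / 4)\<bar> \<le> amplitude x * 1"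
    unfolding abs_mult using amplitude_pos[OF assms] by (intro mult_mono) auto
  then show ?thesis using bessel_asymptotic[OF assms] by (simp add: distrib_left)
qed

lemma amplitude_antimono: "0 < x \<Longrightarrow> x \<le> y \<Longrightarrow> amplitude y \<le> amplitude x"
  unfolding amplitude_def by (intro divide_left_mono mult_mono mult_pos_pos) auto

text \<open>Up to \<open>x\<^sup>2 = 12\<close> the quartic Taylor bound is decreasing in \<open>x\<^sup>2\<close>, and \<open>1 / 16 - 3 / 384 \<ge> 0.0546\<close>; beyond, the envelope
of the asymptotics is below \<open>1 / 2 - 3 * 0.0546\<close>.\<close>

lemma bessel_decay:
  assumes "Z \<le> x\<^sup>2" "0 \<le> Z" "Z \<le> 3"
  shows "\<bar>bessel (- (x\<^sup>2))\<bar> \<le> 1 / 2 - 546 / 10000 * Z"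
proof (cases "x\<^sup>2 \<le> 12")
  case True
  have "x ^ 4 = x\<^sup>2 * x\<^sup>2" by (simp flip: power_add)
  moreover have "0 \<le> (x\<^sup>2 - Z) * (24 - x\<^sup>2 - Z)" using assms True by (intro mult_nonneg_nonneg) auto
  ultimately have "- x\<^sup>2 / 16 + x ^ 4 / 384 \<le> - Z / 16 + Z * Z / 384" by (simp add: field_simps)
  moreover have "Z * Z \<le> 3 * Z" using assms by (intro mult_right_mono)
  ultimately show ?thesis using bessel_bounds(2,3)[of x] True assms by (simp add: abs_le_iff)
next
  case False
  have "(3464 / 1000)\<^sup>2 \<le> \<bar>x\<bar>\<^sup>2" using False by (simp add: power_divide)
  then have x: "3464 / 1000 \<le> \<bar>x\<bar>" by (rule power2_le_imp_le) simp
  have "amplitude \<bar>x\<bar> \<le> amplitude (3464 / 1000)" by (rule amplitude_antimono[OF _ x]) simp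
  also have "amplitude (3464 / 1000) \<le> 1 / (3464 / 1000 * 1)"
    unfolding amplitude_def by (intro frac_le mult_mono) (auto intro: real_le_rsqrt simp: field_simps pi_ge_two)
  finally have a: "amplitude \<bar>x\<bar> \<le> 289 / 1000" by simp
  have "3 / (8 * \<bar>x\<bar>) \<le> 11 / 100" using x by (simp add: divide_le_eq)
  then have "amplitude \<bar>x\<bar> * (1 + 3 / (8 * \<bar>x\<bar>)) \<le> 289 / 1000 * (111 / 100)"
    using a x amplitude_pos[of "\<bar>x\<bar>"] by (intro mult_mono) auto
  moreover have "\<bar>bessel (- (x\<^sup>2))\<bar> \<le> amplitude \<bar>x\<bar> * (1 + 3 / (8 * \<bar>x\<bar>))"
    using bessel_envelope[of "\<bar>x\<bar>"] x by simp
  ultimately show ?thesis using assms by linarith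
qed

text \<open>This is where the factor \<open>m powr (3 / 2)\<close> of the theorem arises.\<close>

lemma amplitude_scaled:
  assumes "0 < m" "0 < \<xi>"
  shows "2 * pi\<^sup>2 * pow32 m * amplitude (2 * pi * real m * sqrt \<xi>) = \<xi> powr (- 3 / 4)"
proof -
  define q where "q = sqrt \<xi>"
  have q: "0 < q" "q\<^sup>2 = \<xi>" using assms by (auto simp: q_def)
  have "\<xi> powr (3 / 4) = q * sqrt q"
  proof -
    have "\<xi> powr (3 / 4) = q powr (3 / 2)"
      unfolding q(2)[symmetric] using q(1) powr_powr[of q 2 "3 / 4"] by simp
    also have "\<dots> = q powr (1 + 1 / 2)" by simp
    also have "\<dots> = q * sqrt q" using q(1) by (simp only: powr_add powr_one powr_half_sqrt less_imp_le)
    finally show ?thesis .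
  qed
  then have xi: "\<xi> powr (- 3 / 4) = 1 / (q * sqrt q)" by (simp add: powr_minus_divide)
  have "sqrt (2 / pi) * (2 * pi\<^sup>2) = 2 * pi * sqrt (2 * pi)"
  proof -
    have "sqrt (2 / pi) * pi = sqrt (2 * pi)"
      by (intro real_sqrt_unique[symmetric]) (simp_all add: power_mult_distrib power2_eq_square[of pi])
    then have "2 * pi * (sqrt (2 / pi) * pi) = 2 * pi * sqrt (2 * pi)" by (simp only:)
    then show ?thesis by (simp add: power2_eq_square mult_ac)
  qed
  moreover have "sqrt (2 * pi * real m * q) = sqrt (2 * pi) * sqrt (real m) * sqrt q"
    by (simp add: real_sqrt_mult)
  ultimately have "2 * pi\<^sup>2 * pow32 m * sqrt (2 / pi) = 2 * pi * sqrt (2 * pi) * pow32 m"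
    "(2 * pi * real m * q) * sqrt (2 * pi * real m * q) = 2 * pi * sqrt (2 * pi) * pow32 m * (q * sqrt q)"
    by (simp_all add: mult_ac)
  then show ?thesis
    unfolding xi amplitude_def q_def[symmetric] using assms q by (simp add: field_simps)
qed

text \<open>The alias term \<open>\<plusminus>r\<close> in the limit \<open>\<sigma> \<rightarrow> \<infinity>\<close>, that is, for \<open>a = u = 0\<close>.\<close>

definition base_term :: "nat \<Rightarrow> nat \<Rightarrow> real" where
  "base_term m r = bessel (- ((2 * pi * real m * sqrt ((real r)\<^sup>2 - 1))\<^sup>2))"

text \<open>The argument of the Bessel function is \<open>2 * pi * m * r\<close> minus the phase lag, so the periodicity of the cosine turns the
asymptotics of \<open>J\<^sub>1\<close> into the coefficient.\<close>

lemma base_phase_coeff: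
  assumes "0 < m" "2 \<le> r"
  shows "\<bar>2 * pi\<^sup>2 * pow32 m * base_term m r - phase_coeff m r\<bar> \<le> 3 / (16 * pi * real m) * (weight r / sqrt ((real r)\<^sup>2 - 1))"
proof -
  define q where "q = sqrt ((real r)\<^sup>2 - 1)"
  define x where "x = 2 * pi * real m * q"
  have rr: "0 < (real r)\<^sup>2 - 1" using assms by simp
  then have q: "0 < q" by (simp add: q_def)
  then have x: "0 < x" using assms by (simp add: x_def)
  have A: "2 * pi\<^sup>2 * pow32 m * amplitude x = weight r"
    unfolding x_def q_def weight_def by (rule amplitude_scaled[OF assms(1) rr])
  have "cos (x - 3 * pi / 4) = cos (phase_lag m (real r) + 3 * pi / 4)"
  proof -
    have "x - 3 * pi / 4 = pi * real (2 * m * r) - (phase_lag m (real r) + 3 * pi / 4)"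
      by (simp add: x_def phase_lag_def q_def algebra_simps)
    then show ?thesis by (simp only: cos_diff cos_npi2 sin_npi2) simp
  qed
  then have c: "phase_coeff m r = 2 * pi\<^sup>2 * pow32 m * (amplitude x * cos (x - 3 * pi / 4))"
    unfolding phase_coeff_def A[symmetric] by simp
  have "\<bar>2 * pi\<^sup>2 * pow32 m * base_term m r - phase_coeff m r\<bar>
      = 2 * pi\<^sup>2 * pow32 m * \<bar>base_term m r - amplitude x * cos (x - 3 * pi / 4)\<bar>"
    unfolding c right_diff_distrib[symmetric] abs_mult by simp
  also have "\<dots> \<le> 2 * pi\<^sup>2 * pow32 m * (amplitude x * (3 / (8 * x)))"
    using bessel_asymptotic[OF x] unfolding base_term_def q_def[symmetric] x_def[symmetric]
    by (intro mult_left_mono) auto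
  also have "\<dots> = weight r * (3 / (8 * x))" unfolding A[symmetric] by simp
  also have "\<dots> = 3 / (16 * pi * real m) * (weight r / q)" by (simp add: x_def)
  finally show ?thesis by (simp add: q_def)
qed

lemma suminf_abs_le:
  fixes f :: "nat \<Rightarrow> real"
  assumes "\<And>k. \<bar>f k\<bar> \<le> g k" "summable g"
  shows "summable f" "\<bar>suminf f\<bar> \<le> suminf g"
  using assms norm_suminf_le[of f g] summable_comparison_test'[of g 0 f] by auto

text \<open>The sum of the error terms of \<open>base_phase_coeff\<close>; \<open>3 / (16 * pi) * 0.5012\<close> is just below \<open>1197 / 40000\<close>.\<close>

lemma base_sum_weights:
  "summable (\<lambda>k. weight (k + 2) / sqrt ((real (k + 2))\<^sup>2 - 1))"
  "(\<Sum>k. weight (k + 2) / sqrt ((real (k + 2))\<^sup>2 - 1)) \<le> 5012 / 10000"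
proof -
  define f where "f r = weight r / sqrt ((real r)\<^sup>2 - 1)" for r
  \<comment> \<open>\<open>0.2974\<close> is half of \<open>0.5948 > 8 powr (- 1 / 4)\<close>; the bound \<open>X powr (- 5 / 4) \<le> 8 powr (- 1 / 4) / X\<close> telescopes by partial fractions of \<open>X = x\<^sup>2 - 1\<close>\<close>
  let ?g = "\<lambda>k. 2974 / 10000 * (1 / (real k + 2) - 1 / (real (Suc k) + 2) + (1 / (real k + 3) - 1 / (real (Suc k) + 3)))"
  have le: "\<bar>f (k + 3)\<bar> \<le> ?g k" for k
  proof -
    define x where "x = real (k + 3)"
    have x: "3 \<le> x" by (simp add: x_def)
    have X: "8 \<le> x\<^sup>2 - 1" using power_mono[OF x, of 2] by simp
    define X where "X = x\<^sup>2 - 1"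
    have "X powr (- 3 / 4) / sqrt X = X powr (- 1 / 4) / X"
    proof -
      have "0 < X" using X by (simp add: X_def)
      have "X powr (- 3 / 4 - 1 / 2) = X powr (- 1 / 4 - 1)" by simp
      then show ?thesis using \<open>0 < X\<close> by (simp only: powr_diff powr_half_sqrt powr_one less_imp_le)
    qed
    also have "\<dots> \<le> (8 powr (- 1 / 4)) / X"
      using X unfolding X_def by (intro divide_right_mono powr_mono2') auto
    also have "(8::real) powr (- 1 / 4) \<le> 5948 / 10000"
    proof -
      have "((8::real) powr (- 1 / 4)) ^ 4 = 1 / 8" by (subst powr_power) (simp_all add: powr_minus_divide)
      also have "\<dots> \<le> (5948 / 10000) ^ 4" by (simp add: power_divide)
      finally show ?thesis by (subst (asm) power_mono_iff) auto
    qed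
    then have "8 powr (- 1 / 4) / X \<le> 5948 / 10000 / X" using X unfolding X_def by (intro divide_right_mono) auto
    finally have "f (k + 3) \<le> 5948 / 10000 / X" unfolding f_def weight_def X_def x_def .
    also have "5948 / 10000 / X = 2974 / 10000 * (1 / (x - 1) - 1 / (x + 1))"
      using x X unfolding X_def by (simp add: field_simps power2_eq_square)
    also have "1 / (x - 1) - 1 / (x + 1) = 1 / (real k + 2) - 1 / (real (Suc k) + 2) + (1 / (real k + 3) - 1 / (real (Suc k) + 3))"
      by (simp add: x_def algebra_simps)
    finally show ?thesis using weight_nonneg[of "k + 3"] by (simp add: f_def)
  qed
  have lim: "(\<lambda>n. 1 / (real n + c)) \<longlonglongrightarrow> 0" for c :: real by real_asymp
  have g: "?g sums (2974 / 10000 * (5 / 6))"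
    using sums_mult[OF sums_add[OF telescope_sums'[OF lim[of 2]] telescope_sums'[OF lim[of 3]]], of "2974 / 10000"]
    by simp
  note s = suminf_abs_le[OF le sums_summable[OF g]]
  have "summable (\<lambda>k. f (Suc k + 2))" using s(1) by (simp add: numeral_3_eq_3)
  then show sm: "summable (\<lambda>k. weight (k + 2) / sqrt ((real (k + 2))\<^sup>2 - 1))"
    unfolding f_def[symmetric] by (subst (asm) summable_Suc_iff)
  have "(\<Sum>k. f (k + 2)) = f 2 + (\<Sum>k. f (Suc k + 2))"
    using suminf_split_head[of "\<lambda>k. f (k + 2)"] sm unfolding f_def[symmetric] by (simp add: numeral_2_eq_2)
  also have "(\<Sum>k. f (Suc k + 2)) = (\<Sum>k. f (k + 3))" by (simp add: numeral_3_eq_3)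
  also have "\<dots> \<le> 2974 / 10000 * (5 / 6)" using s(2) sums_unique[OF g] by simp
  also have "f 2 \<le> 4387 / 10000 * (57736 / 100000)"
  proof -
    have "1 / sqrt 3 \<le> (57736 / 100000 :: real)"
      using real_le_rsqrt[of "100000 / 57736" 3] by (simp add: field_simps power2_eq_square)
    then have "weight 2 * (1 / sqrt 3) \<le> 4387 / 10000 * (57736 / 100000)"
      using weight_table(1) by (intro mult_mono) auto
    then show ?thesis by (simp add: f_def)
  qed
  finally show "(\<Sum>k. weight (k + 2) / sqrt ((real (k + 2))\<^sup>2 - 1)) \<le> 5012 / 10000"
    unfolding f_def[symmetric] by simp
qed

definition base_series :: "nat \<Rightarrow> real \<Rightarrow> real" where
  "base_series m \<theta> = (\<Sum>k. 2 * base_term m (k + 2) * cos (real (k + 2) * \<theta>))"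

lemma base_series_phase:
  assumes "0 < m"
  shows "summable (\<lambda>k. 2 * base_term m (k + 2) * cos (real (k + 2) * \<theta>))"
    and "\<bar>pi\<^sup>2 * pow32 m * base_series m \<theta> - phase_series m \<theta>\<bar> \<le> 1197 / 40000 / real m"
proof -
  define P where "P = pi\<^sup>2 * pow32 m"
  have P: "0 < P" using assms by (simp add: P_def)
  let ?b = "\<lambda>k. 2 * base_term m (k + 2) * cos (real (k + 2) * \<theta>)"
  let ?c = "\<lambda>k. phase_coeff m (k + 2) * cos (real (k + 2) * \<theta>)"
  let ?w = "\<lambda>k. weight (k + 2) / sqrt ((real (k + 2))\<^sup>2 - 1)"
  have "\<bar>P * ?b k - ?c k\<bar> \<le> 3 / (16 * pi * real m) * ?w k" for k
  proof -
    have "\<bar>P * ?b k - ?c k\<bar> = \<bar>2 * pi\<^sup>2 * pow32 m * base_term m (k + 2) - phase_coeff m (k + 2)\<bar> * \<bar>cos (real (k + 2) * \<theta>)\<bar>"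
      unfolding abs_mult[symmetric] by (simp add: P_def algebra_simps)
    also have "\<dots> \<le> (3 / (16 * pi * real m) * ?w k) * 1"
      using base_phase_coeff[OF assms, of "k + 2"] weight_nonneg[of "k + 2"] assms by (intro mult_mono) auto
    finally show ?thesis by simp
  qed
  note d = suminf_abs_le[OF this summable_mult[OF base_sum_weights(1)]]
  have "summable (\<lambda>k. (P * ?b k - ?c k) + ?c k)"
    by (intro summable_add d(1) phase_coeff_cos_summable)
  then have "summable (\<lambda>k. P * ?b k)" by simp
  then show sb: "summable ?b" by (rule summable_mult_D) (use P in simp)
  have "P * base_series m \<theta> - phase_series m \<theta> = (\<Sum>k. P * ?b k - ?c k)"
    unfolding base_series_def phase_series_def
    using suminf_diff[OF summable_mult[OF sb, of P] phase_coeff_cos_summable[of m 2 \<theta>]] suminf_mult[OF sb, of P] by simp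
  then have "\<bar>P * base_series m \<theta> - phase_series m \<theta>\<bar> \<le> 3 / (16 * pi * real m) * (\<Sum>k. ?w k)"
    using d(2) by (simp only: suminf_mult[OF base_sum_weights(1)])
  also have "\<dots> \<le> 3 / (16 * pi * real m) * (5012 / 10000)"
    using base_sum_weights(2) assms by (intro mult_left_mono) auto
  also have "\<dots> \<le> 1197 / 40000 / real m"
    using pi_approx assms by (simp add: field_simps)
  finally show "\<bar>pi\<^sup>2 * pow32 m * base_series m \<theta> - phase_series m \<theta>\<bar> \<le> 1197 / 40000 / real m"
    by (simp only: P_def)
qed

lemma cos_multiple_cong:
  fixes \<theta> \<phi> :: real
  assumes "cos \<theta> = cos \<phi>" shows "cos (real n * \<theta>) = cos (real n * \<phi>)"
proof (induction n rule: induct_nat_012)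
  case (ge2 n)
  have step: "cos (real (Suc (Suc n)) * x) = 2 * cos x * cos (real (Suc n) * x) - cos (real n * x)" for x :: real
    using cos_add[of "real (Suc n) * x" x] cos_diff[of "real (Suc n) * x" x] by (simp add: algebra_simps)
  show ?case unfolding step using ge2 assms by simp
qed (use assms in auto)

text \<open>The limit case: \<open>cos \<theta>\<close> stands for the two terms with \<open>r = \<plusminus>1\<close>, which equal \<open>1 / 2\<close> each.\<close>

lemma base_series_bounds:
  assumes "2 \<le> m"
  shows "4 * pi\<^sup>2 * pow32 m * \<bar>cos \<theta> + base_series m \<theta>\<bar> \<le> (40 * pow32 m + 3) * bessel_factor (2 * pi * real m)"
    and "4 * pi\<^sup>2 * pow32 m * \<bar>base_series m \<theta>\<bar> \<le> 73 / 10"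
proof -
  define P where "P = pi\<^sup>2 * pow32 m"
  have P: "0 < P" using assms by (simp add: P_def)
  have e: "4 * pi\<^sup>2 * pow32 m * t = 4 * (P * t)" for t by (simp add: P_def)
  \<comment> \<open>the series depends on \<open>\<theta>\<close> only through \<open>cos \<theta>\<close>, so \<open>\<theta>\<close> may be taken from \<open>{0..pi}\<close>\<close>
  define \<phi> where "\<phi> = arccos (cos \<theta>)"
  have \<phi>: "\<phi> \<in> {0..pi}" "cos \<theta> = cos \<phi>" by (auto simp: \<phi>_def arccos_lbound arccos_ubound)
  have eq: "base_series m \<theta> = base_series m \<phi>"
    unfolding base_series_def cos_multiple_cong[OF \<phi>(2)] ..
  define B where "B = base_series m \<phi>"
  define S where "S = phase_series m \<phi>"
  define d where "d = 1197 / 40000 / real m"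
  have err: "\<bar>P * B - S\<bar> \<le> d"
    using base_series_phase(2)[of m \<phi>] assms by (simp add: B_def S_def d_def P_def)
  have "P * \<bar>cos \<phi> + S / P\<bar> = \<bar>P * cos \<phi> + S\<bar>"
    using P abs_mult[of P "cos \<phi> + S / P"] by (simp add: distrib_left)
  then have "4 * \<bar>P * cos \<phi> + S\<bar> \<le> (40 * pow32 m + 3) * bessel_factor (2 * pi * real m) - 4 * d"
    using bspec[OF phase_budget_holds[OF assms, unfolded phase_budget_def] \<phi>(1)]
    unfolding P_def[symmetric] S_def[symmetric] e d_def by simp
  moreover have "P * \<bar>cos \<phi> + B\<bar> = \<bar>P * cos \<phi> + P * B\<bar>" using P by (simp add: abs_mult flip: distrib_left)
  moreover have "\<bar>P * cos \<phi> + P * B\<bar> \<le> \<bar>P * cos \<phi> + S\<bar> + \<bar>P * B - S\<bar>" by linarith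
  ultimately have "4 * (P * \<bar>cos \<phi> + B\<bar>) \<le> (40 * pow32 m + 3) * bessel_factor (2 * pi * real m) - 4 * d + 4 * d"
    using err by (smt (verit, ccfv_threshold))
  then show "4 * pi\<^sup>2 * pow32 m * \<bar>cos \<theta> + base_series m \<theta>\<bar> \<le> (40 * pow32 m + 3) * bessel_factor (2 * pi * real m)"
    unfolding eq \<phi>(2) B_def[symmetric] e by simp
  have "P * \<bar>B\<bar> = \<bar>P * B\<bar>" using P by (simp add: abs_mult)
  moreover have "d \<le> 15 / 1000" using assms by (simp add: d_def field_simps)
  ultimately show "4 * pi\<^sup>2 * pow32 m * \<bar>base_series m \<theta>\<bar> \<le> 73 / 10"
    using err phase_series_small[of m \<phi>] unfolding eq B_def[symmetric] S_def[symmetric] e by linarith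
qed

section \<open>Perturbation by finite oversampling and frequency shift\<close>

lemma weight_sum: "summable (\<lambda>k. weight (k + 2))" "(\<Sum>k. weight (k + 2)) \<le> 1804 / 1000"
proof -
  show s: "summable (\<lambda>k. weight (k + 2))" by (rule weight_tail(1)) simp
  have "(\<Sum>k. weight (k + 2)) = (\<Sum>k. weight (k + 2 + 2)) + (\<Sum>k<2. weight (k + 2))"
    by (rule suminf_split_initial_segment[OF s])
  also have "(\<Sum>k<2. weight (k + 2)) = weight 2 + weight 3" by (simp add: numeral_2_eq_2 numeral_3_eq_3)
  also have "(\<lambda>k. weight (k + 2 + 2)) = (\<lambda>k. weight (k + 4))" by (simp add: numeral_eq_Suc)
  finally have "(\<Sum>k. weight (k + 2)) \<le> 2 / sqrt 3 + (weight 2 + weight 3)" using weight_tail(2)[of 4] by simp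
  moreover have "2 / sqrt 3 \<le> 11548 / 10000"
    using real_le_rsqrt[of "20000 / 11548" 3] by (simp add: field_simps power2_eq_square)
  ultimately show "(\<Sum>k. weight (k + 2)) \<le> 1804 / 1000" using weight_table(1,2) by simp
qed

lemma weighted_series:
  fixes f :: "nat \<Rightarrow> complex"
  assumes "0 < M" "0 \<le> c" "\<And>k. M * norm (f k) \<le> c * weight (k + 2)"
  shows "summable f" "M * norm (suminf f) \<le> c * (1804 / 1000)"
proof -
  have le: "norm (f k) \<le> c / M * weight (k + 2)" for k
    using assms(3)[of k] assms(1) by (simp add: field_simps)
  note sm = summable_mult[OF weight_sum(1), of "c / M"]
  show "summable f" by (rule summable_comparison_test'[OF sm]) (rule le)
  have "norm (suminf f) \<le> (\<Sum>k. c / M * weight (k + 2))" by (rule norm_suminf_le[OF le sm])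
  also have "\<dots> = c / M * (\<Sum>k. weight (k + 2))" by (rule suminf_mult[OF weight_sum(1)])
  also have "\<dots> \<le> c / M * (1804 / 1000)" using assms weight_sum(2) by (intro mult_left_mono) auto
  finally show "M * norm (suminf f) \<le> c * (1804 / 1000)" using assms(1) by (simp add: field_simps)
qed

text \<open>The alias term \<open>r\<close> before division by the term of the frequency \<open>n\<close> itself, with \<open>a = 1 / (2 * \<sigma>)\<close> and \<open>u = n / N\<^sub>1\<close>.\<close>

definition shifted_term :: "nat \<Rightarrow> real \<Rightarrow> real \<Rightarrow> int \<Rightarrow> real" where
  "shifted_term m a u r = bessel (- ((2 * pi * real m)\<^sup>2 * ((of_int r + u)\<^sup>2 - (1 - a)\<^sup>2)))"

locale window_shift =
  fixes m :: nat and a u :: real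
  assumes m: "2 \<le> m" and a: "0 < a" "a \<le> 2 / 5" and u: "\<bar>u\<bar> \<le> a"
begin

abbreviation "M \<equiv> 2 * pi\<^sup>2 * pow32 m"

lemma far_gap:
  fixes n :: nat
  assumes n: "2 \<le> n" and r: "\<bar>r\<bar> = int n"
  shows "11 / 15 * ((real n)\<^sup>2 - 1) \<le> (of_int r + u)\<^sup>2 - (1 - a)\<^sup>2"
    and "\<bar>((of_int r + u)\<^sup>2 - (1 - a)\<^sup>2) - ((real n)\<^sup>2 - 1)\<bar> \<le> 2 * a * (real n + 1)"
proof -
  have rn: "\<bar>real_of_int r\<bar> = real n" using r by (metis of_int_abs of_int_of_nat_eq)
  then have rsq: "(real_of_int r)\<^sup>2 = (real n)\<^sup>2" by (metis power2_abs)
  have n2: "2 \<le> real n" using n by simp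
  have "real n - a \<le> \<bar>of_int r + u\<bar>" using rn u by linarith
  then have "(real n - a)\<^sup>2 \<le> \<bar>of_int r + u\<bar>\<^sup>2"
    using n2 a by (intro power_mono) auto
  then have "(real n - a)\<^sup>2 \<le> (of_int r + u)\<^sup>2" by (simp only: power2_abs)
  then have "(real n - 1) * (real n + 1 - 2 * a) \<le> (of_int r + u)\<^sup>2 - (1 - a)\<^sup>2"
    by (simp add: power2_eq_square algebra_simps)
  \<comment> \<open>\<open>11 / 15\<close> is \<open>1 - 2 * a / (n + 1)\<close> for \<open>a = 2 / 5\<close> and \<open>n = 2\<close>\<close>
  moreover have "(real n - 1) * (11 / 15 * (real n + 1)) \<le> (real n - 1) * (real n + 1 - 2 * a)"
    using n2 a by (intro mult_left_mono) auto
  ultimately show "11 / 15 * ((real n)\<^sup>2 - 1) \<le> (of_int r + u)\<^sup>2 - (1 - a)\<^sup>2"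
    by (simp add: power2_eq_square algebra_simps)
  have "((of_int r + u)\<^sup>2 - (1 - a)\<^sup>2) - ((real n)\<^sup>2 - 1) = 2 * (of_int r * u) + (2 * a + (u\<^sup>2 - a\<^sup>2))"
    using rsq by (simp add: power2_eq_square algebra_simps)
  moreover have "\<bar>2 * (of_int r * u)\<bar> \<le> 2 * (real n * a)"
    unfolding abs_mult rn using u by (simp add: mult_left_mono)
  moreover have "u\<^sup>2 \<le> a\<^sup>2" using u a by (metis abs_le_square_iff abs_of_pos)
  moreover have "a\<^sup>2 \<le> a" using a by (simp add: power2_eq_square mult_left_le)
  ultimately show "\<bar>((of_int r + u)\<^sup>2 - (1 - a)\<^sup>2) - ((real n)\<^sup>2 - 1)\<bar> \<le> 2 * a * (real n + 1)"
  proof -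
    assume *: "((of_int r + u)\<^sup>2 - (1 - a)\<^sup>2) - ((real n)\<^sup>2 - 1) = 2 * (of_int r * u) + (2 * a + (u\<^sup>2 - a\<^sup>2))"
      "\<bar>2 * (of_int r * u)\<bar> \<le> 2 * (real n * a)" "u\<^sup>2 \<le> a\<^sup>2" "a\<^sup>2 \<le> a"
    have "2 * a * (real n + 1) = 2 * (real n * a) + 2 * a" by (simp add: algebra_simps)
    then show ?thesis unfolding *(1) using *(2-4) zero_le_power2[of u] a(1) by linarith
  qed
qed

text \<open>The arguments of far terms stay comparable with those of the limit case, so that both the size and, through the Lipschitz bound, the
difference are controlled by the same weights. The dependence on \<open>m\<close> of the second bound comes from the arguments, which are proportional to \<open>m\<close>.\<close>

lemma far_term:
  fixes n :: nat
  assumes n: "2 \<le> n" and r: "\<bar>r\<bar> = int n"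
  shows "M * \<bar>shifted_term m a u r\<bar> \<le> 129 / 100 * weight n"
    and "M * \<bar>shifted_term m a u r - base_term m n\<bar> \<le> 31 * real m * a * weight n"
proof -
  define c where "c = 2 * pi * real m"
  define \<xi> where "\<xi> = (of_int r + u)\<^sup>2 - (1 - a)\<^sup>2"
  define N where "N = (real n)\<^sup>2 - 1"
  define x where "x = c * sqrt \<xi>"
  define x' where "x' = c * sqrt N"
  define y where "y = c * sqrt (11 / 15 * N)"
  have n2: "2 \<le> real n" using n by simp
  have N: "3 \<le> N" unfolding N_def using power_mono[OF n2, of 2] by simp
  have gap: "11 / 15 * N \<le> \<xi>" "\<bar>\<xi> - N\<bar> \<le> 2 * a * (real n + 1)"
    unfolding \<xi>_def N_def by (rule far_gap[OF n r])+
  have xi: "0 < \<xi>" using gap N by linarith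
  have c: "1256 / 100 \<le> c"
  proof -
    have "2 * (314 / 100) * 2 \<le> 2 * pi * real m" using pi_approx m by (intro mult_mono) auto
    then show ?thesis by (simp add: c_def)
  qed
  have "148 / 100 \<le> sqrt (11 / 15 * N)" using N by (intro real_le_rsqrt) (simp add: power_divide)
  then have "1256 / 100 * (148 / 100) \<le> y" unfolding y_def using c by (intro mult_mono) auto
  then have y: "185 / 10 \<le> y" by simp
  have yx: "y \<le> x" "y \<le> x'" unfolding x_def x'_def y_def
    using gap(1) N c by (auto intro!: mult_left_mono real_sqrt_le_mono)
  have sh: "shifted_term m a u r = bessel (- (x\<^sup>2))" "base_term m n = bessel (- (x'\<^sup>2))"
    using xi N unfolding shifted_term_def base_term_def x_def x'_def c_def \<xi>_def N_def by (simp_all add: power_mult_distrib)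
  have amplitude: "M * amplitude y \<le> 1263 / 1000 * weight n"
  proof -
    have "M * amplitude y = (11 / 15 * N) powr (- 3 / 4)"
      unfolding y_def c_def using m N by (intro amplitude_scaled) auto
    also have "\<dots> = (11 / 15) powr (- 3 / 4) * weight n"
      using N unfolding weight_def N_def[symmetric] by (subst powr_mult) auto
    \<comment> \<open>all far arguments are at least \<open>11 / 15\<close> of the unperturbed ones, which costs this factor in the amplitude\<close>
    also have "((11::real) / 15) powr (- 3 / 4) \<le> 1263 / 1000"
    proof -
      have "(((11::real) / 15) powr (- 3 / 4)) ^ 4 = (11 / 15) powr (- 3)" by (subst powr_power) simp_all
      also have "\<dots> = 1 / (11 / 15) ^ 3" using powr_realpow[of "11 / 15" 3] by (simp add: powr_minus_divide)
      also have "\<dots> \<le> (1263 / 1000) ^ 4" by (simp add: power_divide)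
      finally show ?thesis by (subst (asm) power_mono_iff) auto
    qed
    finally show ?thesis using weight_nonneg[of n] by (simp add: mult_right_mono)
  qed
  have M0: "0 \<le> M" by simp
  have "M * \<bar>shifted_term m a u r\<bar> \<le> M * (amplitude x * (1 + 3 / (8 * x)))"
    unfolding sh using bessel_envelope[of x] y yx by (intro mult_left_mono M0) auto
  also have "\<dots> \<le> M * (amplitude y * (1 + 3 / (8 * (185 / 10))))"
    using y yx amplitude_antimono[of y x] amplitude_pos[of x] amplitude_pos[of y]
    by (intro mult_left_mono M0 mult_mono add_left_mono divide_left_mono) auto
  also have "\<dots> \<le> 1263 / 1000 * weight n * (1 + 3 / (8 * (185 / 10)))"
    unfolding mult.assoc[symmetric, of M] by (intro mult_right_mono[OF amplitude]) simp
  also have "\<dots> \<le> 129 / 100 * weight n" using weight_nonneg[of n] by simp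
  finally show "M * \<bar>shifted_term m a u r\<bar> \<le> 129 / 100 * weight n" .
  have dist: "\<bar>x - x'\<bar> \<le> 2178 / 100 * real m * a"
  proof -
    have x': "0 < x'" using y yx by linarith
    have "\<bar>x - x'\<bar> * x' \<le> \<bar>x - x'\<bar> * (x + x')" using y yx by (intro mult_left_mono) auto
    also have "\<dots> = \<bar>x\<^sup>2 - x'\<^sup>2\<bar>"
    proof -
      have "x\<^sup>2 - x'\<^sup>2 = (x - x') * (x + x')" by (simp add: power2_eq_square algebra_simps)
      then show ?thesis using y yx by (simp only: abs_mult)
    qed
    also have "x\<^sup>2 - x'\<^sup>2 = c\<^sup>2 * (\<xi> - N)"
      using xi N by (simp add: x_def x'_def power_mult_distrib right_diff_distrib)
    also have "\<bar>\<dots>\<bar> \<le> c\<^sup>2 * (2 * a * (real n + 1))" unfolding abs_mult using gap(2) by (intro mult_mono) auto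
    also have "\<dots> \<le> c\<^sup>2 * (2 * a * (17321 / 10000 * sqrt N))"
    proof -
      have "(real n + 1)\<^sup>2 \<le> 3 * N"
        using n2 mult_left_mono[of 2 "real n" "real n + 1"] unfolding N_def by (simp add: power2_eq_square algebra_simps)
      then have "real n + 1 \<le> sqrt (3 * N)" by (intro real_le_rsqrt)
      also have "\<dots> = sqrt 3 * sqrt N" by (simp add: real_sqrt_mult)
      also have "sqrt 3 \<le> 17321 / 10000" by (intro real_le_lsqrt) (auto simp: power_divide)
      finally have "real n + 1 \<le> 17321 / 10000 * sqrt N" using N by (simp add: mult_right_mono)
      then show ?thesis using a by (intro mult_left_mono) auto
    qed
    also have "\<dots> = c * (34642 / 10000 * a) * x'" by (simp add: x'_def power2_eq_square)
    finally have "\<bar>x - x'\<bar> \<le> c * (34642 / 10000 * a)" using x' by simp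
    also have "\<dots> \<le> (62832 / 10000 * real m) * (34642 / 10000 * a)"
      unfolding c_def using pi_approx a by (intro mult_right_mono) auto
    also have "\<dots> \<le> 2178 / 100 * real m * a" using a m by simp
    finally show ?thesis .
  qed
  have "M * \<bar>shifted_term m a u r - base_term m n\<bar> \<le> M * (amplitude y * (1 + 15 / (8 * y) + 15 / (16 * y\<^sup>2)) * \<bar>x - x'\<bar>)"
    unfolding sh using bessel_lipschitz[of y x x'] y yx by (intro mult_left_mono M0) auto
  also have "\<dots> \<le> M * (amplitude y * (1105 / 1000) * (2178 / 100 * real m * a))"
  proof -
    have "15 / (8 * y) \<le> 15 / (8 * (185 / 10))" using y by (intro divide_left_mono) auto
    moreover have "(185 / 10)\<^sup>2 \<le> y\<^sup>2" using y by (intro power_mono) auto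
    then have "15 / (16 * y\<^sup>2) \<le> 15 / (16 * (185 / 10)\<^sup>2)" using y by (intro divide_left_mono mult_left_mono) auto
    ultimately have "1 + 15 / (8 * y) + 15 / (16 * y\<^sup>2) \<le> 1105 / 1000" by (simp add: power_divide)
    then show ?thesis using dist y amplitude_pos[of y] a
      by (intro mult_left_mono M0 mult_mono) (auto intro!: add_nonneg_nonneg)
  qed
  also have "\<dots> = M * amplitude y * (1105 / 1000 * (2178 / 100) * real m * a)" by simp
  also have "\<dots> \<le> 1263 / 1000 * weight n * (1105 / 1000 * (2178 / 100) * real m * a)"
    using a by (intro mult_right_mono[OF amplitude]) auto
  also have "\<dots> \<le> 31 * real m * a * weight n"
    using a weight_nonneg[of n] m by (simp add: mult_ac mult_right_mono)
  finally show "M * \<bar>shifted_term m a u r - base_term m n\<bar> \<le> 31 * real m * a * weight n" .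
qed

lemma pow32_ge: "28 / 10 \<le> pow32 m"
proof -
  have "14 / 10 \<le> sqrt (real m)" using m by (intro real_le_rsqrt) (auto simp: power_divide)
  then have "2 * (14 / 10) \<le> pow32 m" using m by (intro mult_mono) auto
  then show ?thesis by simp
qed

definition far_series :: "real \<Rightarrow> complex" where
  "far_series \<theta> = (\<Sum>k. of_real (shifted_term m a u (int (k + 2))) * cis (real (k + 2) * \<theta>)
      + of_real (shifted_term m a u (- int (k + 2))) * cis (- (real (k + 2) * \<theta>)))"

lemma M_pos: "0 < M"
  using m by simp

lemma far_series_bounds:
  shows "summable (\<lambda>k. of_real (shifted_term m a u (int (k + 2))) * cis (real (k + 2) * \<theta>)
      + of_real (shifted_term m a u (- int (k + 2))) * cis (- (real (k + 2) * \<theta>)))"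
    and "2 * M * norm (far_series \<theta>) \<le> 931 / 100"
    and "2 * M * norm (far_series \<theta> - of_real (base_series m \<theta>)) \<le> 224 * real m * a"
proof -
  let ?p = "\<lambda>k. shifted_term m a u (int (k + 2))" and ?n = "\<lambda>k. shifted_term m a u (- int (k + 2))"
  let ?c = "\<lambda>k. cis (real (k + 2) * \<theta>)" and ?d = "\<lambda>k. cis (- (real (k + 2) * \<theta>))"
  let ?f = "\<lambda>k. of_real (?p k) * ?c k + of_real (?n k) * ?d k"
  let ?b = "\<lambda>k. 2 * base_term m (k + 2) * cos (real (k + 2) * \<theta>)"
  have f: "M * norm (?f k) \<le> 258 / 100 * weight (k + 2)" for k
  proof -
    have "norm (?f k) \<le> \<bar>?p k\<bar> + \<bar>?n k\<bar>"
      by (rule order_trans[OF norm_triangle_ineq]) (simp add: norm_mult)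
    then have "M * norm (?f k) \<le> M * \<bar>?p k\<bar> + M * \<bar>?n k\<bar>"
      using mult_left_mono[of "norm (?f k)" "\<bar>?p k\<bar> + \<bar>?n k\<bar>" M] M_pos by (simp add: distrib_left)
    then show ?thesis
      using far_term(1)[of "k + 2" "int (k + 2)"] far_term(1)[of "k + 2" "- int (k + 2)"] by simp
  qed
  have g: "M * norm (?f k - of_real (?b k)) \<le> 62 * real m * a * weight (k + 2)" for k
  proof -
    have "complex_of_real (2 * cos (real (k + 2) * \<theta>)) = ?c k + ?d k"
      by (simp add: complex_eq_iff)
    moreover have "?b k = base_term m (k + 2) * (2 * cos (real (k + 2) * \<theta>))" by simp
    ultimately have "complex_of_real (?b k) = of_real (base_term m (k + 2)) * (?c k + ?d k)"
      by (metis of_real_mult)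
    then have "complex_of_real (?b k) = of_real (base_term m (k + 2)) * ?c k + of_real (base_term m (k + 2)) * ?d k"
      by (simp only: distrib_left)
    then have "?f k - of_real (?b k) = of_real (?p k - base_term m (k + 2)) * ?c k + of_real (?n k - base_term m (k + 2)) * ?d k"
      by (simp add: algebra_simps)
    then have "norm (?f k - of_real (?b k)) \<le> \<bar>?p k - base_term m (k + 2)\<bar> + \<bar>?n k - base_term m (k + 2)\<bar>"
      by (simp only:) (rule order_trans[OF norm_triangle_ineq], simp add: norm_mult del: of_real_diff)
    then have "M * norm (?f k - of_real (?b k)) \<le> M * \<bar>?p k - base_term m (k + 2)\<bar> + M * \<bar>?n k - base_term m (k + 2)\<bar>"
      using mult_left_mono[of "norm (?f k - of_real (?b k))" "\<bar>?p k - base_term m (k + 2)\<bar> + \<bar>?n k - base_term m (k + 2)\<bar>" M] M_pos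
      by (simp add: distrib_left)
    moreover have "M * \<bar>?p k - base_term m (k + 2)\<bar> \<le> 31 * real m * a * weight (k + 2)"
      "M * \<bar>?n k - base_term m (k + 2)\<bar> \<le> 31 * real m * a * weight (k + 2)"
      by (rule far_term(2); simp)+
    ultimately have "M * norm (?f k - of_real (?b k)) \<le> 31 * real m * a * weight (k + 2) + 31 * real m * a * weight (k + 2)"
      by (meson add_mono order_trans)
    then show ?thesis by (simp only: mult.assoc)
  qed
  note F = weighted_series[OF M_pos _ f]
  show sf: "summable ?f" by (rule F(1)) simp
  show "2 * M * norm (far_series \<theta>) \<le> 931 / 100"
    using F(2) unfolding far_series_def by simp
  have "(\<Sum>k. ?f k - of_real (?b k)) = far_series \<theta> - of_real (base_series m \<theta>)"
  proof -
    have sb: "summable ?b" using base_series_phase(1)[of m \<theta>] m by simp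
    have so: "complex_of_real (\<Sum>k. ?b k) = (\<Sum>k. of_real (?b k))" by (rule suminf_of_real[OF sb])
    show ?thesis unfolding far_series_def base_series_def so
      by (rule suminf_diff[OF sf summable_of_real[OF sb], symmetric])
  qed
  moreover have "M * norm (\<Sum>k. ?f k - of_real (?b k)) \<le> 62 * real m * a * (1804 / 1000)"
    using a by (intro weighted_series(2)[OF M_pos _ g]) auto
  moreover have "2 * M * x = 2 * (M * x)" for x by simp
  ultimately have "2 * M * norm (far_series \<theta> - of_real (base_series m \<theta>)) \<le> 2 * (62 * real m * a * (1804 / 1000))"
    by (simp only:)
  also have "\<dots> \<le> 224 * real m * a" using a m by simp
  finally show "2 * M * norm (far_series \<theta> - of_real (base_series m \<theta>)) \<le> 224 * real m * a" .
qed

text \<open>The least argument \<open>x\<^sup>2\<close> that at least one of the two terms \<open>r = \<plusminus>1\<close> has, namely the one for which \<open>r\<close> and \<open>u\<close> have the same sign.\<close>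

definition near_gap :: real where "near_gap = (2 * pi * real m)\<^sup>2 * (2 * a - a\<^sup>2)"

text \<open>A shift \<open>u\<close> moves one of \<open>\<plusminus>1\<close> towards \<open>0\<close> and the other away from it; the latter is damped.\<close>

lemma near_terms:
  assumes "Z \<le> near_gap" "0 \<le> Z" "Z \<le> 3"
  shows "\<bar>shifted_term m a u 1\<bar> \<le> 1 / 2" "\<bar>shifted_term m a u (- 1)\<bar> \<le> 1 / 2"
    and "\<bar>shifted_term m a u 1\<bar> \<le> 1 / 2 - 546 / 10000 * Z \<or> \<bar>shifted_term m a u (- 1)\<bar> \<le> 1 / 2 - 546 / 10000 * Z"
proof -
  define c where "c = (2 * pi * real m)\<^sup>2"
  have c: "0 \<le> c" by (simp add: c_def)
  define X where "X s = c * ((s + u)\<^sup>2 - (1 - a)\<^sup>2)" for s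
  have X0: "0 \<le> X s" if "s = 1 \<or> s = - 1" for s
  proof -
    have "1 - a \<le> \<bar>s + u\<bar>" using that u a by auto
    then have "(1 - a)\<^sup>2 \<le> \<bar>s + u\<bar>\<^sup>2" using a by (intro power_mono) auto
    then show ?thesis using c by (simp add: X_def)
  qed
  have sh: "shifted_term m a u 1 = bessel (- ((sqrt (X 1))\<^sup>2))" "shifted_term m a u (- 1) = bessel (- ((sqrt (X (- 1)))\<^sup>2))"
  proof -
    have "(sqrt (X s))\<^sup>2 = X s" if "s = 1 \<or> s = - 1" for s
      by (rule real_sqrt_pow2[OF X0[OF that]])
    then show "shifted_term m a u 1 = bessel (- ((sqrt (X 1))\<^sup>2))" "shifted_term m a u (- 1) = bessel (- ((sqrt (X (- 1)))\<^sup>2))"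
      by (simp_all only: simp_thms) (simp_all add: shifted_term_def X_def c_def)
  qed
  show "\<bar>shifted_term m a u 1\<bar> \<le> 1 / 2" "\<bar>shifted_term m a u (- 1)\<bar> \<le> 1 / 2"
    unfolding sh using bessel_bounds(1,4)[of "sqrt (X 1)"] bessel_bounds(1,4)[of "sqrt (X (- 1))"] by (auto simp: abs_le_iff)
  have big: "Z \<le> (sqrt (X s))\<^sup>2" if s: "s = 1 \<or> s = - 1" and "1 \<le> \<bar>s + u\<bar>" for s
  proof -
    have "1\<^sup>2 \<le> \<bar>s + u\<bar>\<^sup>2" using that by (intro power_mono) auto
    then have "2 * a - a\<^sup>2 \<le> (s + u)\<^sup>2 - (1 - a)\<^sup>2" by (simp add: power2_eq_square algebra_simps)
    then have "near_gap \<le> X s" unfolding near_gap_def X_def c_def by (intro mult_left_mono) auto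
    then show ?thesis using assms X0[OF s] by simp
  qed
  show "\<bar>shifted_term m a u 1\<bar> \<le> 1 / 2 - 546 / 10000 * Z \<or> \<bar>shifted_term m a u (- 1)\<bar> \<le> 1 / 2 - 546 / 10000 * Z"
  proof (cases "0 \<le> u")
    case True
    then show ?thesis unfolding sh using assms by (intro disjI1 bessel_decay big) auto
  next
    case False
    then show ?thesis unfolding sh using assms by (intro disjI2 bessel_decay big) auto
  qed
qed

definition alias_total :: "real \<Rightarrow> complex" where
  "alias_total \<theta> = of_real (shifted_term m a u 1) * cis \<theta> + of_real (shifted_term m a u (- 1)) * cis (- \<theta>) + far_series \<theta>"

lemma M_le: "M \<le> 19739209 / 1000000 * pow32 m"
  using mult_right_mono[OF pi_sq_le, of "pow32 m"] pow32_ge by simp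

lemma bessel_factor_shrunk: "92 / 100 \<le> bessel_factor (2 * pi * real m * sqrt (1 - 2 * a))"
proof -
  have "447 / 1000 \<le> sqrt (1 - 2 * a)" using a by (intro real_le_rsqrt) (simp add: power_divide)
  then have "2 * (314 / 100) * 2 * (447 / 1000) \<le> 2 * pi * real m * sqrt (1 - 2 * a)"
    using pi_approx m by (intro mult_mono) auto
  then have "bessel_factor (561432 / 100000) \<le> bessel_factor (2 * pi * real m * sqrt (1 - 2 * a))" by (intro bessel_factor_mono) auto
  moreover have "92 / 100 \<le> bessel_factor (561432 / 100000)" by (simp add: bessel_factor_def power_divide)
  ultimately show ?thesis by linarith
qed

text \<open>If one near term is damped by at least \<open>3 * 0.0546\<close>, signs in the far terms are not needed.\<close>

lemma alias_total_large:
  assumes "3 \<le> near_gap"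
  shows "2 * M * norm (alias_total \<theta>) \<le> (40 * pow32 m + 3) * bessel_factor (2 * pi * real m * sqrt (1 - 2 * a))"
proof -
  have "\<bar>shifted_term m a u 1\<bar> + \<bar>shifted_term m a u (- 1)\<bar> \<le> 8362 / 10000"
    using near_terms[of 3] assms by auto
  moreover have "norm (alias_total \<theta>) \<le> \<bar>shifted_term m a u 1\<bar> + \<bar>shifted_term m a u (- 1)\<bar> + norm (far_series \<theta>)"
    unfolding alias_total_def
    by (intro order_trans[OF norm_triangle_ineq] add_mono order_refl) (simp_all add: norm_mult)
  ultimately have "norm (alias_total \<theta>) \<le> 8362 / 10000 + norm (far_series \<theta>)" by linarith
  then have "2 * M * norm (alias_total \<theta>) \<le> 2 * M * (8362 / 10000 + norm (far_series \<theta>))"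
    by (rule mult_left_mono) simp
  then have "2 * M * norm (alias_total \<theta>) \<le> 2 * (8362 / 10000) * M + 931 / 100"
    using far_series_bounds(2)[of \<theta>] by (simp add: distrib_left)
  also have "\<dots> \<le> 2 * (8362 / 10000) * (19739209 / 1000000 * pow32 m) + 931 / 100"
    using M_le by (intro add_right_mono mult_left_mono) auto
  also have "\<dots> \<le> (40 * pow32 m + 3) * (92 / 100)" using pow32_ge by (simp add: algebra_simps)
  also have "\<dots> \<le> (40 * pow32 m + 3) * bessel_factor (2 * pi * real m * sqrt (1 - 2 * a))"
    using bessel_factor_shrunk by (intro mult_left_mono) auto
  finally show ?thesis .
qed

text \<open>The denominator is evaluated at \<open>y * sqrt (1 - 2 * a)\<close> instead of \<open>y\<close>; this costs \<open>O(m * a)\<close> in the budget, with a small constant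
because \<open>1 / y\<close> is at most \<open>1 / 12\<close>.\<close>

lemma bessel_factor_loss:
  assumes "a \<le> 1 / 100"
  shows "(40 * pow32 m + 3) * (bessel_factor (2 * pi * real m) - bessel_factor (2 * pi * real m * sqrt (1 - 2 * a))) \<le> 9 * real m * a"
proof -
  define y where "y = 2 * pi * real m"
  define t where "t = 1 / sqrt (1 - 2 * a)"
  define w where "w = 1 / y"
  have y: "6 * real m \<le> y" unfolding y_def using pi_gt3 by (intro mult_right_mono) auto
  have y12: "12 \<le> y" using y m by linarith
  have w: "0 < w" "w \<le> 1 / 12" "w \<le> 1 / (6 * real m)"
    using y12 y m unfolding w_def by (auto intro!: divide_left_mono mult_pos_pos)
  have s: "0 < sqrt (1 - 2 * a)" "sqrt (1 - 2 * a) \<le> 1" "(sqrt (1 - 2 * a))\<^sup>2 = 1 - 2 * a"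
    using assms a by auto
  have t1: "1 \<le> t" unfolding t_def using s by simp
  have "(sqrt (1 - 2 * a))\<^sup>2 \<le> sqrt (1 - 2 * a)"
    unfolding power2_eq_square using s by (intro mult_left_le) auto
  then have "1 - 2 * a \<le> sqrt (1 - 2 * a)" unfolding s(3) .
  then have "t \<le> 1 / (1 - 2 * a)" unfolding t_def using assms a s by (intro divide_left_mono) auto
  also have "\<dots> \<le> 1 + 21 / 10 * a"
  proof -
    have "0 \<le> a * (1 / 10 - 42 / 10 * a)" using assms a by (intro mult_nonneg_nonneg) auto
    then have "1 \<le> (1 + 21 / 10 * a) * (1 - 2 * a)" by (simp add: algebra_simps)
    then show ?thesis using assms by (simp add: divide_le_eq)
  qed
  finally have t2: "t \<le> 1 + 21 / 10 * a" .
  then have t3: "t \<le> 103 / 100" using assms by linarith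
  have ws: "1 / (y * sqrt (1 - 2 * a)) = w * t" by (simp add: w_def t_def)
  have I: "bessel_factor z = 1 - 3 / 8 * (1 / z) - 15 / 128 * (1 / z)\<^sup>2 - 315 / 512 * (1 / z) ^ 3" for z
    by (simp add: bessel_factor_def power_divide)
  have "t\<^sup>2 - 1 = (t - 1) * (t + 1)" "t ^ 3 - 1 = (t - 1) * (t\<^sup>2 + t + 1)"
    by (simp_all add: algebra_simps eval_nat_numeral)
  moreover have "t\<^sup>2 \<le> (103 / 100)\<^sup>2" using t1 t3 by (intro power_mono) auto
  then have "t\<^sup>2 + t + 1 \<le> 32 / 10" using t3 by (simp add: power_divide)
  then have "(t - 1) * (t\<^sup>2 + t + 1) \<le> (t - 1) * (32 / 10)" using t1 by (intro mult_left_mono) auto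
  moreover have "(t - 1) * (t + 1) \<le> (t - 1) * (204 / 100)" using t1 t3 by (intro mult_left_mono) auto
  ultimately have T: "t\<^sup>2 - 1 \<le> (t - 1) * (204 / 100)" "t ^ 3 - 1 \<le> (t - 1) * (32 / 10)"
    by (simp_all only:)
  have W: "w\<^sup>2 \<le> w * (1 / 12)" "w ^ 3 \<le> w * (1 / 144)"
  proof -
    show "w\<^sup>2 \<le> w * (1 / 12)" unfolding power2_eq_square using w by (intro mult_left_mono) auto
    have "w\<^sup>2 \<le> (1 / 12)\<^sup>2" using w by (intro power_mono) auto
    then have "w * w\<^sup>2 \<le> w * (1 / 144)" using w by (intro mult_left_mono) (auto simp: power_divide)
    then show "w ^ 3 \<le> w * (1 / 144)" by (simp add: power3_eq_cube power2_eq_square)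
  qed
  define Q where "Q = w * (t - 1)"
  define A2 where "A2 = w\<^sup>2 * (t\<^sup>2 - 1)"
  define A3 where "A3 = w ^ 3 * (t ^ 3 - 1)"
  have "A2 \<le> w * (1 / 12) * ((t - 1) * (204 / 100))"
    unfolding A2_def using W T t1 w by (intro mult_mono) auto
  then have "A2 \<le> 17 / 100 * Q" by (simp add: Q_def algebra_simps)
  moreover have "A3 \<le> w * (1 / 144) * ((t - 1) * (32 / 10))"
    unfolding A3_def using W T t1 w by (intro mult_mono) auto
  then have "A3 \<le> 1 / 45 * Q" by (simp add: Q_def algebra_simps)
  moreover have "0 \<le> Q" unfolding Q_def using w t1 by (intro mult_nonneg_nonneg) auto
  moreover have "bessel_factor y - bessel_factor (y * sqrt (1 - 2 * a)) = 3 / 8 * Q + 15 / 128 * A2 + 315 / 512 * A3"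
    unfolding I ws w_def[symmetric] Q_def A2_def A3_def by (simp add: power_mult_distrib field_simps)
  ultimately have "bessel_factor y - bessel_factor (y * sqrt (1 - 2 * a)) \<le> 1 / 2 * (w * (t - 1))"
    unfolding Q_def[symmetric] by linarith
  also have "\<dots> \<le> 1 / 2 * (1 / (6 * real m) * (21 / 10 * a))"
    using w t1 t2 a by (intro mult_left_mono mult_mono) auto
  finally have d: "bessel_factor y - bessel_factor (y * sqrt (1 - 2 * a)) \<le> 21 / 120 * (a / real m)" by simp
  have "40 * pow32 m + 3 \<le> 42 * pow32 m" using pow32_ge by linarith
  moreover have "0 \<le> a / real m" using a by simp
  ultimately have "(40 * pow32 m + 3) * (bessel_factor y - bessel_factor (y * sqrt (1 - 2 * a))) \<le> (42 * pow32 m) * (21 / 120 * (a / real m))"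
    using d bessel_factor_mono[of "y * sqrt (1 - 2 * a)" y] s y12
    by (intro mult_mono) (auto simp: mult_left_le)
  also have "\<dots> = 735 / 100 * (sqrt (real m) * a)" using m by simp
  also have "sqrt (real m) \<le> real m"
    using m mult_left_mono[of 1 "real m" "real m"] by (intro real_le_lsqrt) (auto simp: power2_eq_square)
  then have "735 / 100 * (sqrt (real m) * a) \<le> 735 / 100 * (real m * a)"
    using a by (intro mult_left_mono mult_right_mono) auto
  also have "\<dots> \<le> 9 * real m * a" using a by simp
  finally show ?thesis by (simp only: y_def)
qed

text \<open>The near terms \<open>v / 2\<close> and \<open>w / 2\<close> are split into the common part \<open>p = v * w\<close>, for which the sharp bound with \<open>cos \<theta> + B\<close> is available, and remainders,
which are estimated trivially. The trivial part has total weight at most \<open>1 - p\<close> because \<open>v + w \<le> 1 + v * w\<close>.\<close>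

lemma convex_corner_bound:
  fixes v w B \<theta> :: real
  assumes "0 \<le> v" "v \<le> 1" "0 \<le> w" "w \<le> 1"
  shows "norm (of_real (v / 2) * cis \<theta> + of_real (w / 2) * cis (- \<theta>) + of_real B)
    \<le> v * w * \<bar>cos \<theta> + B\<bar> + (1 - v * w) * (1 / 2 + \<bar>B\<bar>)"
proof -
  define p where "p = v * w"
  have p: "0 \<le> p" "p \<le> v" "p \<le> w" "p \<le> 1"
    using assms by (auto simp: p_def mult_left_le mult_left_le_one_le mult_le_one)
  have "complex_of_real (cos \<theta>) = cis \<theta> / 2 + cis (- \<theta>) / 2" by (simp add: complex_eq_iff)
  then have "of_real (v / 2) * cis \<theta> + of_real (w / 2) * cis (- \<theta>) + of_real B
      = of_real (p * (cos \<theta> + B)) + (of_real ((v - p) / 2) * cis \<theta> + of_real ((w - p) / 2) * cis (- \<theta>) + of_real ((1 - p) * B))"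
    by (simp add: algebra_simps diff_divide_distrib)
  then have "norm (of_real (v / 2) * cis \<theta> + of_real (w / 2) * cis (- \<theta>) + of_real B)
      \<le> \<bar>p * (cos \<theta> + B)\<bar> + (\<bar>(v - p) / 2\<bar> + \<bar>(w - p) / 2\<bar> + \<bar>(1 - p) * B\<bar>)"
    by (simp only:) (intro order_trans[OF norm_triangle_ineq] add_mono order_trans[OF norm_triangle_ineq];
      simp add: norm_mult del: of_real_mult of_real_diff of_real_divide)
  also have "\<dots> = p * \<bar>cos \<theta> + B\<bar> + ((v + w - 2 * p) / 2 + (1 - p) * \<bar>B\<bar>)"
  proof -
    have "\<bar>p * (cos \<theta> + B)\<bar> = p * \<bar>cos \<theta> + B\<bar>" "\<bar>(1 - p) * B\<bar> = (1 - p) * \<bar>B\<bar>"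
      "\<bar>(v - p) / 2\<bar> = (v - p) / 2" "\<bar>(w - p) / 2\<bar> = (w - p) / 2"
      using p by (simp_all add: abs_mult)
    then show ?thesis by (simp only:) (simp add: field_simps)
  qed
  also have "\<dots> \<le> p * \<bar>cos \<theta> + B\<bar> + ((1 - p) / 2 + (1 - p) * \<bar>B\<bar>)"
  proof -
    have "0 \<le> (1 - v) * (1 - w)" using assms by (intro mult_nonneg_nonneg) auto
    then show ?thesis by (simp add: p_def field_simps)
  qed
  also have "\<dots> = p * \<bar>cos \<theta> + B\<bar> + (1 - p) * (1 / 2 + \<bar>B\<bar>)" by (simp add: algebra_simps)
  finally show ?thesis by (simp only: p_def)
qed

text \<open>The sharp bound of the limit case is used with weight \<open>p\<close>. The remaining weight \<open>1 - p\<close> uses the trivial bound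
\<open>1 / 2 + \<bar>B\<bar>\<close>, which on the scale of the claim is smaller than the sharp one by at least \<open>10 * m powr (3 / 2)\<close>; this surplus pays for the perturbation of the far terms and of the
denominator.\<close>

lemma alias_total_small:
  assumes "near_gap < 3"
  shows "2 * M * norm (alias_total \<theta>) \<le> (40 * pow32 m + 3) * bessel_factor (2 * pi * real m * sqrt (1 - 2 * a))"
proof -
  define Z where "Z = near_gap"
  define B where "B = base_series m \<theta>"
  define W where "W = (40 * pow32 m + 3) * bessel_factor (2 * pi * real m)"
  have msq: "4 \<le> (real m)\<^sup>2" using m power_mono[of 2 "real m" 2] by simp
  have c: "39478 / 1000 * (real m)\<^sup>2 \<le> (2 * pi * real m)\<^sup>2"
    using mult_right_mono[OF pi_sq_ge, of "4 * (real m)\<^sup>2"] msq by (simp add: power_mult_distrib)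
  have "157 * (16 / 10 * a) \<le> (2 * pi * real m)\<^sup>2 * (2 * a - a\<^sup>2)"
  proof (rule mult_mono)
    show "157 \<le> (2 * pi * real m)\<^sup>2" using c msq by linarith
    show "16 / 10 * a \<le> 2 * a - a\<^sup>2" using mult_right_mono[OF a(2), of a] a(1) by (simp add: power2_eq_square)
  qed (use a in auto)
  \<comment> \<open>the crude bound on \<open>a\<close> makes \<open>a\<^sup>2\<close> negligible against \<open>2 * a\<close>; a second pass with that knowledge gives \<open>a \<le> 1 / 100\<close>\<close>
  then have a2: "a \<le> 1195 / 100000" using assms unfolding near_gap_def by linarith
  have "157 * (198 / 100 * a) \<le> (2 * pi * real m)\<^sup>2 * (2 * a - a\<^sup>2)"
  proof (rule mult_mono)
    show "157 \<le> (2 * pi * real m)\<^sup>2" using c msq by linarith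
    show "198 / 100 * a \<le> 2 * a - a\<^sup>2" using mult_right_mono[OF a2, of a] a(1) by (simp add: power2_eq_square)
  qed (use a in auto)
  then have a3: "a \<le> 1 / 100" using assms unfolding near_gap_def by linarith
  have Zge: "78 * (real m)\<^sup>2 * a \<le> Z"
  proof -
    have "39478 / 1000 * (real m)\<^sup>2 * (198 / 100 * a) \<le> Z"
      unfolding Z_def near_gap_def
    proof (rule mult_mono[OF c])
      show "198 / 100 * a \<le> 2 * a - a\<^sup>2" using mult_right_mono[OF a2, of a] a(1) by (simp add: power2_eq_square)
    qed (use a in auto)
    moreover have "78 * (real m)\<^sup>2 * a \<le> 39478 / 1000 * (real m)\<^sup>2 * (198 / 100 * a)" using a by simp
    ultimately show ?thesis by linarith
  qed
  have Z: "0 \<le> Z" "Z \<le> 3" using Zge assms a order_trans[of 0 "78 * (real m)\<^sup>2 * a" Z] unfolding Z_def by auto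
  note near = near_terms[OF order_refl, folded Z_def, OF Z]
  have pos: "0 \<le> shifted_term m a u r" if "r = 1 \<or> r = - 1" for r
  proof -
    define X where "X = (2 * pi * real m)\<^sup>2 * ((of_int r + u)\<^sup>2 - (1 - a)\<^sup>2)"
    have "1 - a \<le> \<bar>of_int r + u\<bar>" "\<bar>of_int r + u\<bar> \<le> 1 + a" using that u a by auto
    then have "(1 - a)\<^sup>2 \<le> \<bar>of_int r + u\<bar>\<^sup>2" "\<bar>of_int r + u\<bar>\<^sup>2 \<le> (1 + a)\<^sup>2" using a power_mono[of "1 - a" "\<bar>of_int r + u\<bar>" 2] power_mono[of "\<bar>of_int r + u\<bar>" "1 + a" 2] by auto
    then have "0 \<le> (of_int r + u)\<^sup>2 - (1 - a)\<^sup>2" "(of_int r + u)\<^sup>2 - (1 - a)\<^sup>2 \<le> 4 * a"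
      by (auto simp: power2_eq_square algebra_simps)
    moreover have "4 * a \<le> 5 / 2 * (2 * a - a\<^sup>2)" using mult_right_mono[OF a2, of a] a(1) by (simp add: power2_eq_square)
    ultimately have D: "0 \<le> (of_int r + u)\<^sup>2 - (1 - a)\<^sup>2" "(of_int r + u)\<^sup>2 - (1 - a)\<^sup>2 \<le> 5 / 2 * (2 * a - a\<^sup>2)"
      by linarith+
    have "0 \<le> X" unfolding X_def by (rule mult_nonneg_nonneg[OF zero_le_power2 D(1)])
    moreover have "X \<le> (2 * pi * real m)\<^sup>2 * (5 / 2 * (2 * a - a\<^sup>2))"
      unfolding X_def by (rule mult_left_mono[OF D(2) zero_le_power2])
    moreover have "(2 * pi * real m)\<^sup>2 * (5 / 2 * (2 * a - a\<^sup>2)) = 5 / 2 * Z" by (simp add: Z_def near_gap_def)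
    ultimately have X: "0 \<le> X" "X \<le> 8" using Z by linarith+
    have "shifted_term m a u r = bessel (- ((sqrt X)\<^sup>2))" using X(1) by (simp add: shifted_term_def X_def)
    then show ?thesis using bessel_bounds(2)[of "sqrt X"] X by simp
  qed
  define v where "v = 2 * shifted_term m a u 1"
  define w where "w = 2 * shifted_term m a u (- 1)"
  define p where "p = v * w"
  have v: "0 \<le> v" "v \<le> 1" "0 \<le> w" "w \<le> 1"
    using near(1,2) pos[of 1] pos[of "- 1"] by (auto simp: v_def w_def)
  have "p \<le> v" "p \<le> w" "0 \<le> p" using v by (auto simp: p_def mult_left_le mult_left_le_one_le)
  moreover have "v \<le> 1 - 1092 / 10000 * Z \<or> w \<le> 1 - 1092 / 10000 * Z"
    using near(3) by (auto simp: v_def w_def)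
  ultimately have p: "0 \<le> p" "1092 / 10000 * Z \<le> 1 - p" "0 \<le> 1 - p" using v by auto
  have head: "norm (of_real (v / 2) * cis \<theta> + of_real (w / 2) * cis (- \<theta>) + of_real B)
      \<le> p * \<bar>cos \<theta> + B\<bar> + (1 - p) * (1 / 2 + \<bar>B\<bar>)"
    unfolding p_def by (rule convex_corner_bound[OF v])
  have "alias_total \<theta> = (of_real (v / 2) * cis \<theta> + of_real (w / 2) * cis (- \<theta>) + of_real B) + (far_series \<theta> - of_real B)"
    by (simp add: alias_total_def v_def w_def)
  then have "norm (alias_total \<theta>) \<le> p * \<bar>cos \<theta> + B\<bar> + (1 - p) * (1 / 2 + \<bar>B\<bar>) + norm (far_series \<theta> - of_real B)"
    using head norm_triangle_ineq order_trans add_right_mono by metis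
  then have "2 * M * norm (alias_total \<theta>)
      \<le> 2 * M * (p * \<bar>cos \<theta> + B\<bar> + (1 - p) * (1 / 2 + \<bar>B\<bar>) + norm (far_series \<theta> - of_real B))"
    by (rule mult_left_mono) simp
  also have "\<dots> = p * (2 * M * \<bar>cos \<theta> + B\<bar>) + (1 - p) * (M + 2 * M * \<bar>B\<bar>) + 2 * M * norm (far_series \<theta> - of_real B)"
    by (simp add: field_simps)
  also have "\<dots> \<le> p * W + (1 - p) * (M + 73 / 10) + 224 * real m * a"
  proof (intro add_mono mult_left_mono)
    show "2 * M * \<bar>cos \<theta> + B\<bar> \<le> W" using base_series_bounds(1)[OF m, of \<theta>] by (simp add: W_def B_def)
    show "2 * M * \<bar>B\<bar> \<le> 73 / 10" using base_series_bounds(2)[OF m, of \<theta>] by (simp add: B_def)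
    show "2 * M * norm (far_series \<theta> - of_real B) \<le> 224 * real m * a"
      unfolding B_def by (rule far_series_bounds(3))
  qed (use p in auto)
  \<comment> \<open>the damping \<open>1 - p\<close> is of order \<open>m\<^sup>2 * a\<close> and is multiplied by a quantity of order \<open>m * sqrt m\<close>; it therefore pays for \<open>224 * m * a\<close> here and for the loss in the denominator in the last step\<close>
  also have "\<dots> = W - (1 - p) * (W - M - 73 / 10) + 224 * real m * a" by (simp add: algebra_simps)
  also have "\<dots> \<le> W - 233 * real m * a + 224 * real m * a"
  proof -
    have "2 * (314 / 100) * 2 \<le> 2 * pi * real m" using pi_approx m by (intro mult_mono) auto
    then have "bessel_factor (1256 / 100) \<le> bessel_factor (2 * pi * real m)" by (intro bessel_factor_mono) auto
    moreover have "968 / 1000 \<le> bessel_factor (1256 / 100)" by (simp add: bessel_factor_def power_divide)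
    ultimately have "(40 * pow32 m + 3) * (968 / 1000) \<le> W"
      unfolding W_def by (intro mult_left_mono) auto
    then have "10 * pow32 m \<le> W - M - 73 / 10"
      using M_le pow32_ge by (simp add: algebra_simps)
    then have "28 \<le> W - M - 73 / 10" using pow32_ge by linarith
    moreover have "1092 / 10000 * (78 * (real m)\<^sup>2 * a) \<le> 1 - p"
      by (rule order_trans[OF mult_left_mono[OF Zge] p(2)]) simp
    ultimately have "(1092 / 10000 * (78 * (real m)\<^sup>2 * a)) * 28 \<le> (1 - p) * (W - M - 73 / 10)"
      using p(3) by (intro mult_mono) auto
    also have "1092 / 10000 * (78 * (real m)\<^sup>2 * a) * 28 = 2384928 / 10000 * (real m * (real m * a))"
      by (simp add: power2_eq_square)
    finally have gain: "2384928 / 10000 * (real m * (real m * a)) \<le> (1 - p) * (W - M - 73 / 10)" .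
    have "1 * (real m * a) \<le> real m * (real m * a)" using m a by (intro mult_right_mono) auto
    moreover have "0 \<le> real m * a" using a by simp
    ultimately have "233 * (real m * a) \<le> 2384928 / 10000 * (real m * (real m * a))" by linarith
    with gain have "233 * (real m * a) \<le> (1 - p) * (W - M - 73 / 10)" by (rule order_trans[rotated])
    then show ?thesis by (simp only: mult.assoc)
  qed
  also have "\<dots> = W - 9 * real m * a" by simp
  also have "\<dots> \<le> (40 * pow32 m + 3) * bessel_factor (2 * pi * real m * sqrt (1 - 2 * a))"
    using bessel_factor_loss[OF a3] unfolding W_def by (simp add: algebra_simps)
  finally show ?thesis .
qed

lemma alias_total_bound:
  "2 * M * norm (alias_total \<theta>) \<le> (40 * pow32 m + 3) * bessel_factor (2 * pi * real m * sqrt (1 - 2 * a))"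
  using alias_total_large alias_total_small by (cases "near_gap < 3") auto

end

section \<open>The window function and its Fourier transform\<close>

text \<open>In this form neither continuity nor the substitution in the Fourier integral needs a case distinction.\<close>

lemma window_eq:
  assumes "0 < m" "0 < N\<^sub>1"
  shows "sinh_window m \<beta> N\<^sub>1 x = sinh (\<beta> * sqrt (max 0 (1 - (real N\<^sub>1 * x / real m)\<^sup>2))) / sinh \<beta>"
proof -
  define s where "s = real N\<^sub>1 * x / real m"
  have iff: "x \<in> {- (real m / real N\<^sub>1)<..<real m / real N\<^sub>1} \<longleftrightarrow> \<bar>s\<bar> < 1"
    using assms by (auto simp: s_def abs_less_iff field_simps)
  show ?thesis
  proof (cases "\<bar>s\<bar> < 1")
    case True
    then have "s\<^sup>2 < 1" by (simp add: abs_square_less_1)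
    then show ?thesis using True unfolding sinh_window_def iff s_def[symmetric] by (simp add: max_def)
  next
    case False
    then have "1 \<le> s\<^sup>2" using abs_square_less_1[of s] by simp
    then show ?thesis using False unfolding sinh_window_def iff s_def[symmetric] by (simp add: max_def)
  qed
qed

lemma window_support:
  assumes "0 < m" "0 < N\<^sub>1" "0 < \<beta>"
  shows "sinh_window m \<beta> N\<^sub>1 x \<noteq> 0 \<longleftrightarrow> x \<in> {- (real m / real N\<^sub>1)<..<real m / real N\<^sub>1}"
proof
  assume "x \<in> {- (real m / real N\<^sub>1)<..<real m / real N\<^sub>1}"
  moreover from this have "\<bar>real N\<^sub>1 * x / real m\<bar> < 1"
    using assms by (auto simp: abs_less_iff field_simps)
  then have "(real N\<^sub>1 * x / real m)\<^sup>2 < 1" by (simp add: abs_square_less_1)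
  ultimately show "sinh_window m \<beta> N\<^sub>1 x \<noteq> 0" using assms by (simp add: sinh_window_def)
qed (auto simp: sinh_window_def split: if_splits)

text \<open>The sine part vanishes by symmetry.\<close>

lemma sinh_semicircle_fourier:
  "((\<lambda>s. of_real (sinh (\<beta> * semicircle s)) * exp (- \<i> * of_real (w * s))) has_integral
     complex_of_real (pi * \<beta> * bessel (\<beta>\<^sup>2 - w\<^sup>2))) {-1..1}"
proof -
  have c: "((\<lambda>s. sinh (\<beta> * semicircle s) * cos (w * s)) has_integral pi * \<beta> * bessel (\<beta>\<^sup>2 - w\<^sup>2)) {-1..1}"
    unfolding integral_sinh_semicircle_cos[symmetric]
    by (intro integrable_integral integrable_continuous_interval continuous_intros)
  define I where "I = integral {-1..1} (\<lambda>s. sinh (\<beta> * semicircle s) * sin (w * s))"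
  have s: "((\<lambda>s. sinh (\<beta> * semicircle s) * sin (w * s)) has_integral I) {-1..1}"
    unfolding I_def by (intro integrable_integral integrable_continuous_interval continuous_intros)
  then have "((\<lambda>s. sinh (\<beta> * semicircle (- s)) * sin (w * - s)) has_integral I) {-1..1}"
    using has_integral_reflect_real[of "\<lambda>s. sinh (\<beta> * semicircle s) * sin (w * s)" I 1 "-1"] by simp
  then have "((\<lambda>s. - (sinh (\<beta> * semicircle s) * sin (w * s))) has_integral I) {-1..1}" by simp
  with has_integral_neg[OF s] have "I = - I" by (metis has_integral_unique)
  then have "I = 0" by simp
  with s have s0: "((\<lambda>s. sinh (\<beta> * semicircle s) * sin (w * s)) has_integral 0) {-1..1}" by simp
  have "((\<lambda>s. complex_of_real (sinh (\<beta> * semicircle s) * cos (w * s)) - \<i> * complex_of_real (sinh (\<beta> * semicircle s) * sin (w * s)))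
      has_integral complex_of_real (pi * \<beta> * bessel (\<beta>\<^sup>2 - w\<^sup>2)) - \<i> * complex_of_real 0) {-1..1}"
    by (intro has_integral_diff has_integral_mult_right has_integral_of_real c s0)
  moreover have "complex_of_real (sinh (\<beta> * semicircle s) * cos (w * s)) - \<i> * complex_of_real (sinh (\<beta> * semicircle s) * sin (w * s))
      = of_real (sinh (\<beta> * semicircle s)) * exp (- \<i> * of_real (w * s))" for s
    by (simp add: complex_eq_iff Re_exp Im_exp)
  ultimately show ?thesis by simp
qed

lemma fourier_sinh_window:
  assumes "0 < m" "0 < N\<^sub>1"
  shows "fourier (sinh_window m \<beta> N\<^sub>1) v
    = of_real (real m / real N\<^sub>1 / sinh \<beta> * (pi * \<beta> * bessel (\<beta>\<^sup>2 - (2 * pi * real m * (v / real N\<^sub>1))\<^sup>2)))"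
proof -
  define L where "L = real m / real N\<^sub>1"
  have L: "0 < L" using assms by (simp add: L_def)
  define w where "w = 2 * pi * real m * (v / real N\<^sub>1)"
  define h where "h s = complex_of_real (sinh (\<beta> * sqrt (max 0 (1 - s\<^sup>2)))) * exp (- \<i> * of_real (w * s))" for s
  have "(h has_integral complex_of_real (pi * \<beta> * bessel (\<beta>\<^sup>2 - w\<^sup>2))) {-1..1}"
    by (rule has_integral_eq[OF _ sinh_semicircle_fourier]) (use semicircle_nonneg in \<open>auto simp: h_def max_def\<close>)
  note stretch = has_integral_stretch_real[OF this, of "1 / L"]
  have "((\<lambda>x. h (1 / L * x)) has_integral of_real (L * (pi * \<beta> * bessel (\<beta>\<^sup>2 - w\<^sup>2)))) {- L..L}"
  proof -
    have "(\<lambda>x. x / (1 / L)) = (*) L" by (auto simp: fun_eq_iff)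
    then have img: "(\<lambda>x. x / (1 / L)) ` {- 1..1} = {- L..L}"
      by (simp only: image_mult_atLeastAtMost[OF L]) simp
    show ?thesis
      using stretch[unfolded img] L by (simp add: scaleR_conv_of_real)
  qed
  from has_integral_mult_right[OF this, of "of_real (1 / sinh \<beta>)"]
  have hI: "((\<lambda>x. of_real (1 / sinh \<beta>) * h (1 / L * x)) has_integral
      of_real (L / sinh \<beta> * (pi * \<beta> * bessel (\<beta>\<^sup>2 - w\<^sup>2)))) {- L..L}"
    by (simp add: field_simps)
  have eq: "of_real (sinh_window m \<beta> N\<^sub>1 x) * exp (- 2 * of_real pi * \<i> * of_real v * of_real x)
      = indicator {- L..L} x *\<^sub>R (of_real (1 / sinh \<beta>) * h (1 / L * x))" for x
  proof -
    have "1 / L * x = real N\<^sub>1 * x / real m" by (simp add: L_def)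
    moreover have "w * (1 / L * x) = 2 * pi * v * x" using assms by (simp add: w_def L_def)
    then have "- 2 * of_real pi * \<i> * of_real v * of_real x = - \<i> * complex_of_real (w * (1 / L * x))"
      by (simp only:) simp
    moreover have "x \<notin> {- L..L} \<Longrightarrow> sinh_window m \<beta> N\<^sub>1 x = 0" by (auto simp: sinh_window_def L_def)
    ultimately show ?thesis
      by (cases "x \<in> {- L..L}") (simp_all add: h_def window_eq[OF assms])
  qed
  have "set_integrable lborel {- L..L} (\<lambda>x. of_real (1 / sinh \<beta>) * h (1 / L * x))"
    unfolding h_def by (intro borel_integrable_atLeastAtMost' continuous_intros)
  from set_borel_integral_eq_integral(2)[OF this]
  show ?thesis
    unfolding fourier_def eq set_lebesgue_integral_def integral_unique[OF hI] by (simp add: L_def w_def)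
qed

text \<open>Positivity of the transform needs the argument \<open>\<beta>\<^sup>2 - w\<^sup>2\<close> of \<open>bessel\<close> to be nonnegative, which is the hypothesis on \<open>\<beta>\<close>; there the power series has
nonnegative terms.\<close>

lemma sinh_window_in_class:
  assumes "0 < m" "0 < N\<^sub>1" "0 < \<beta>"
    and "\<And>v. \<bar>v\<bar> \<le> real N / 2 \<Longrightarrow> (2 * pi * real m * (v / real N\<^sub>1))\<^sup>2 \<le> \<beta>\<^sup>2"
  shows "sinh_window m \<beta> N\<^sub>1 \<in> window_class m N N\<^sub>1"
proof -
  let ?\<phi> = "sinh_window m \<beta> N\<^sub>1"
  define L where "L = real m / real N\<^sub>1"
  have L: "0 < L" using assms(1-3) by (simp add: L_def)
  note eq = window_eq[OF assms(1,2), of \<beta>]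
  have fn: "?\<phi> = (\<lambda>x. sinh (\<beta> * sqrt (max 0 (1 - (real N\<^sub>1 * x / real m)\<^sup>2))) / sinh \<beta>)"
    by (rule ext) (rule eq)
  have cont: "continuous_on UNIV ?\<phi>"
    unfolding fn by (intro continuous_intros) (use assms(1-3) in simp_all)
  have range: "?\<phi> x \<in> {0..1}" for x
  proof -
    have "sqrt (max 0 (1 - (real N\<^sub>1 * x / real m)\<^sup>2)) \<le> 1" by simp
    then have "\<beta> * sqrt (max 0 (1 - (real N\<^sub>1 * x / real m)\<^sup>2)) \<le> \<beta>" using assms(1-3) by (intro mult_left_le) auto
    then show ?thesis unfolding eq using assms(1-3) by (simp add: divide_le_eq)
  qed
  have even: "?\<phi> (- x) = ?\<phi> x" for x unfolding fn by simp
  have "{x. ?\<phi> x \<noteq> 0} = {- L<..<L}" unfolding window_support[OF assms(1-3)] L_def by (rule Collect_mem_eq)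
  then have closure: "closure {x. ?\<phi> x \<noteq> 0} = {- L..L}" using L by (simp add: closure_greaterThanLessThan)
  have anti: "antimono_on {0..L} ?\<phi>"
  proof (rule monotone_onI)
    fix x y assume "x \<in> {0..L}" "y \<in> {0..L}" "x \<le> y"
    then have "(real N\<^sub>1 * x / real m)\<^sup>2 \<le> (real N\<^sub>1 * y / real m)\<^sup>2"
      using assms(1-3) by (intro power_mono divide_right_mono mult_left_mono) auto
    then have "max 0 (1 - (real N\<^sub>1 * y / real m)\<^sup>2) \<le> max 0 (1 - (real N\<^sub>1 * x / real m)\<^sup>2)"
      by (intro max.mono) auto
    then have "\<beta> * sqrt (max 0 (1 - (real N\<^sub>1 * y / real m)\<^sup>2)) \<le> \<beta> * sqrt (max 0 (1 - (real N\<^sub>1 * x / real m)\<^sup>2))"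
      using assms(3) by (intro mult_left_mono real_sqrt_le_mono) auto
    then show "?\<phi> y \<le> ?\<phi> x"
      unfolding fn using assms(3) by (intro divide_right_mono) (simp_all only: sinh_real_le_iff, simp)
  qed
  have one: "?\<phi> 0 = 1" unfolding eq using assms(1-3) by simp
  have pos: "fourier ?\<phi> v \<in> \<real> \<and> 0 < Re (fourier ?\<phi> v)" if "v \<in> {- (real N / 2)..real N / 2}" for v
  proof -
    have "\<bar>v\<bar> \<le> real N / 2" using that by (auto simp: abs_le_iff)
    from assms(4)[OF this] have "0 \<le> \<beta>\<^sup>2 - (2 * pi * real m * (v / real N\<^sub>1))\<^sup>2" by (simp only: diff_ge_0_iff_ge)
    then have "0 < bessel (\<beta>\<^sup>2 - (2 * pi * real m * (v / real N\<^sub>1))\<^sup>2)" using bessel_ge_half by fastforce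
    then have "0 < real m / real N\<^sub>1 / sinh \<beta> * (pi * \<beta> * bessel (\<beta>\<^sup>2 - (2 * pi * real m * (v / real N\<^sub>1))\<^sup>2))"
      using assms(1-3) by (intro mult_pos_pos divide_pos_pos) auto
    then show ?thesis unfolding fourier_sinh_window[OF assms(1,2)] Re_complex_of_real by (intro conjI Reals_of_real)
  qed
  show ?thesis
    unfolding window_class_def mem_Collect_eq L_def[symmetric]
    by (intro conjI allI ballI cont even closure anti one pos image_subsetI range)
qed

lemma apply_trig_monom:
  "apply_bcontfun (trig_monom c k) x = c * exp (2 * of_real pi * \<i> * of_int k * of_real x)"
  by (simp add: trig_monom.rep_eq)

lemma norm_trig_monom: "norm (trig_monom c k) \<le> norm c"
  by (rule norm_bound) (simp add: apply_trig_monom norm_mult)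

text \<open>Absolutely convergent sums over the nonzero integers as series over pairs \<open>\<plusminus>(k + 1)\<close>.\<close>

lemma has_sum_nonzero_int:
  fixes f :: "int \<Rightarrow> 'a::banach"
  assumes "summable (\<lambda>k. norm (f (int (Suc k))))" "summable (\<lambda>k. norm (f (- int (Suc k))))"
  shows "(f has_sum (\<Sum>k. f (int (Suc k)) + f (- int (Suc k)))) (UNIV - {0})"
proof -
  let ?p = "\<lambda>k. int (Suc k)" and ?n = "\<lambda>k. - int (Suc k)"
  have s: "summable (\<lambda>k. f (?p k))" "summable (\<lambda>k. f (?n k))" using assms by (auto intro: summable_norm_cancel)
  have "((f \<circ> ?p) has_sum (\<Sum>k. f (?p k))) UNIV" "((f \<circ> ?n) has_sum (\<Sum>k. f (?n k))) UNIV"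
    using assms s by (auto intro!: norm_summable_imp_has_sum simp: o_def summable_sums)
  then have "(f has_sum (\<Sum>k. f (?p k))) (range ?p)" "(f has_sum (\<Sum>k. f (?n k))) (range ?n)"
    by (subst has_sum_reindex; auto simp: inj_on_def)+
  moreover have "range ?p \<inter> range ?n = {}" by auto
  ultimately have "(f has_sum ((\<Sum>k. f (?p k)) + (\<Sum>k. f (?n k)))) (range ?p \<union> range ?n)"
    by (rule has_sum_Un_disjoint)
  moreover have "range ?p \<union> range ?n = UNIV - {0}"
  proof (intro equalityI subsetI)
    fix r :: int assume "r \<in> UNIV - {0}"
    then have "r = ?p (nat (r - 1)) \<or> r = ?n (nat (- r - 1))" by auto
    then show "r \<in> range ?p \<union> range ?n" by blast
  qed auto
  ultimately show ?thesis by (simp only: suminf_add[OF s])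
qed

lemma bounded_linear_apply_bcontfun: "bounded_linear (\<lambda>f. apply_bcontfun f x)"
  by (rule bounded_linear_intro[of _ 1]) (auto simp: norm_bounded)

text \<open>Completeness of the function space makes absolutely convergent families summable.\<close>

instance bcontfun :: (metric_space, banach) banach ..

context window_shift
begin

lemma shifted_summable:
  "summable (\<lambda>k. \<bar>shifted_term m a u (int (Suc k))\<bar>)" "summable (\<lambda>k. \<bar>shifted_term m a u (- int (Suc k))\<bar>)"
proof -
  have *: "summable (\<lambda>k. \<bar>shifted_term m a u (e * int (Suc k))\<bar>)" if "\<bar>e\<bar> = 1" for e
  proof -
    have le: "\<bar>shifted_term m a u (e * int (Suc (Suc k)))\<bar> \<le> 129 / 100 / M * weight (k + 2)" for k
    proof -
      have "\<bar>e * int (Suc (Suc k))\<bar> = int (k + 2)" using that by (simp add: abs_mult)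
      then have "M * \<bar>shifted_term m a u (e * int (Suc (Suc k)))\<bar> \<le> 129 / 100 * weight (k + 2)" by (intro far_term(1)) auto
      then have "\<bar>shifted_term m a u (e * int (Suc (Suc k)))\<bar> \<le> (129 / 100 * weight (k + 2)) / M"
        by (simp only: pos_le_divide_eq[OF M_pos] mult.commute[of _ M])
      then show ?thesis by (simp only: times_divide_eq_left)
    qed
    have "summable (\<lambda>k. \<bar>shifted_term m a u (e * int (Suc (Suc k)))\<bar>)"
      by (rule summable_comparison_test'[OF summable_mult[OF weight_sum(1), of "129 / 100 / M"], of 0])
        (simp only: real_norm_def abs_abs, rule le)
    then show ?thesis by (subst summable_Suc_iff[symmetric])
  qed
  show "summable (\<lambda>k. \<bar>shifted_term m a u (int (Suc k))\<bar>)" "summable (\<lambda>k. \<bar>shifted_term m a u (- int (Suc k))\<bar>)"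
    using *[of 1] *[of "- 1"] by (simp_all only: mult_1 mult_minus1 abs_one abs_minus_cancel simp_thms)
qed

text \<open>The series converges absolutely in the sup-norm. Point evaluation is continuous and linear, so the norm of the sum is the supremum of
the values \<open>alias_total\<close> at \<open>\<theta> = 2 * pi * N * x\<close>, divided by \<open>D\<close>.\<close>

lemma shifted_trig_series:
  fixes F :: "int \<Rightarrow> (real \<Rightarrow>\<^sub>C complex)"
  assumes F: "\<And>r. F r = trig_monom (of_real (shifted_term m a u r) / of_real D) (r * int N)"
    and D: "0 < D"
  shows "F summable_on (UNIV - {0})"
    and "norm (infsum F (UNIV - {0})) \<le> (40 * pow32 m + 3) * bessel_factor (2 * pi * real m * sqrt (1 - 2 * a)) / (2 * M) / D"
proof -
  have nF: "norm (F r) \<le> \<bar>shifted_term m a u r\<bar> / D" for r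
    unfolding F using norm_trig_monom[of "of_real (shifted_term m a u r) / of_real D" "r * int N"] D
    by (simp add: norm_divide)
  have sF: "summable (\<lambda>k. norm (F (int (Suc k))))" "summable (\<lambda>k. norm (F (- int (Suc k))))"
    by (rule summable_comparison_test'[OF summable_divide[OF shifted_summable(1), of D], of 0], simp only: real_norm_def abs_norm_cancel, rule nF)
      (rule summable_comparison_test'[OF summable_divide[OF shifted_summable(2), of D], of 0], simp only: real_norm_def abs_norm_cancel, rule nF)
  note S = has_sum_nonzero_int[OF sF]
  show "F summable_on (UNIV - {0})" using S by (rule has_sum_imp_summable)
  have "norm (apply_bcontfun (infsum F (UNIV - {0})) x) \<le> (40 * pow32 m + 3) * bessel_factor (2 * pi * real m * sqrt (1 - 2 * a)) / (2 * M) / D" for x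
  proof -
    define \<theta> where "\<theta> = 2 * pi * real N * x"
    define f where "f r = complex_of_real (shifted_term m a u r) * cis (of_int r * \<theta>)" for r
    have Fx: "apply_bcontfun (F r) x = f r / of_real D" for r
    proof -
      have "exp (2 * of_real pi * \<i> * of_int (r * int N) * of_real x) = cis (of_int r * \<theta>)"
        by (simp add: cis_conv_exp \<theta>_def mult_ac)
      then show ?thesis unfolding F apply_trig_monom f_def by simp
    qed
    have sf: "summable (\<lambda>k. norm (f (int (Suc k))))" "summable (\<lambda>k. norm (f (- int (Suc k))))"
      using shifted_summable by (simp_all only: f_def norm_mult norm_of_real norm_cis mult_1_right)
    note s = has_sum_nonzero_int[OF sf]
    have "((\<lambda>r. apply_bcontfun (F r) x) has_sum apply_bcontfun (infsum F (UNIV - {0})) x) (UNIV - {0})"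
      using has_sum_bounded_linear[OF bounded_linear_apply_bcontfun S] infsumI[OF S] by (simp only:)
    moreover have "((\<lambda>r. apply_bcontfun (F r) x) has_sum (\<Sum>k. f (int (Suc k)) + f (- int (Suc k))) * inverse (of_real D)) (UNIV - {0})"
      using has_sum_bounded_linear[OF bounded_linear_mult_left[of "inverse (of_real D)"] s] unfolding Fx divide_inverse .
    ultimately have val: "apply_bcontfun (infsum F (UNIV - {0})) x = (\<Sum>k. f (int (Suc k)) + f (- int (Suc k))) / of_real D"
      unfolding divide_inverse by (rule has_sum_unique)
    have sm: "summable (\<lambda>k. f (int (Suc k)) + f (- int (Suc k)))"
      by (rule summable_add[OF sf(1)[THEN summable_norm_cancel] sf(2)[THEN summable_norm_cancel]])
    have "(\<Sum>k. f (int (Suc k)) + f (- int (Suc k))) = (f 1 + f (- 1)) + (\<Sum>k. f (int (Suc (Suc k))) + f (- int (Suc (Suc k))))"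
    proof -
      have "int (Suc 0) = 1" by simp
      note split = suminf_split_head[OF sm, unfolded this]
      have "S = H + X" if "X = S - H" for S H X :: complex using that by simp
      then show ?thesis using split by this
    qed
    also have "\<dots> = alias_total \<theta>"
    proof -
      have k2: "int (Suc (Suc k)) = int (k + 2)" for k by simp
      have pos: "f (int n) = of_real (shifted_term m a u (int n)) * cis (real n * \<theta>)"
        and neg: "f (- int n) = of_real (shifted_term m a u (- int n)) * cis (- (real n * \<theta>))" for n
        by (simp_all only: f_def of_int_minus of_int_of_nat_eq mult_minus_left)
      show ?thesis
        unfolding k2 alias_total_def far_series_def pos neg by (simp only: f_def of_int_1 of_int_minus mult_minus1 mult_1)
    qed
    finally have "norm (apply_bcontfun (infsum F (UNIV - {0})) x) = norm (alias_total \<theta>) / D"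
      unfolding val using D by (simp add: norm_divide)
    moreover have "norm (alias_total \<theta>) \<le> (40 * pow32 m + 3) * bessel_factor (2 * pi * real m * sqrt (1 - 2 * a)) / (2 * M)"
    proof -
      have "0 < 2 * M" using M_pos by linarith
      then show ?thesis using alias_total_bound[of \<theta>] by (simp only: pos_le_divide_eq mult.commute[of "norm _"])
    qed
    ultimately show ?thesis using D by (simp only: divide_right_mono less_imp_le)
  qed
  then show "norm (infsum F (UNIV - {0})) \<le> (40 * pow32 m + 3) * bessel_factor (2 * pi * real m * sqrt (1 - 2 * a)) / (2 * M) / D"
    by (rule norm_bound)
qed

lemma center_bound:
  shows "exp (2 * pi * real m * sqrt (1 - 2 * a)) / (2 * M * (sqrt (1 - 2 * a) * sqrt (sqrt (1 - 2 * a)))) * bessel_factor (2 * pi * real m * sqrt (1 - 2 * a))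
    \<le> bessel ((2 * pi * real m)\<^sup>2 * ((1 - a)\<^sup>2 - u\<^sup>2))"
proof -
  define q where "q = sqrt (1 - 2 * a)"
  define y where "y = 2 * pi * real m * q"
  have q: "0 < q" "q\<^sup>2 = 1 - 2 * a" using a by (auto simp: q_def)
  have y: "0 < y" using q m by (simp add: y_def)
  have "sqrt (2 * pi) * (y * sqrt y) = 2 * M * (q * sqrt q)"
  proof -
    have "sqrt y = sqrt (2 * pi) * sqrt (real m) * sqrt q" by (simp add: y_def real_sqrt_mult)
    then have "sqrt (2 * pi) * (y * sqrt y) = (sqrt (2 * pi) * sqrt (2 * pi)) * (2 * pi * real m * q) * (sqrt (real m) * sqrt q)"
      by (simp add: y_def)
    also have "sqrt (2 * pi) * sqrt (2 * pi) = 2 * pi" by simp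
    finally show ?thesis by (simp add: power2_eq_square mult_ac)
  qed
  then have "exp y / (2 * M * (q * sqrt q)) * bessel_factor y \<le> bessel (y\<^sup>2)"
    using bessel_lower_bound[OF y] unfolding bessel_factor_def by simp
  also have "\<dots> \<le> bessel ((2 * pi * real m)\<^sup>2 * ((1 - a)\<^sup>2 - u\<^sup>2))"
  proof (rule bessel_mono)
    \<comment> \<open>the denominator is smallest at the ends \<open>\<bar>u\<bar> = a\<close> of the frequency range\<close>
    have "u\<^sup>2 \<le> a\<^sup>2" using u a by (metis abs_le_square_iff abs_of_pos)
    then have "q\<^sup>2 \<le> (1 - a)\<^sup>2 - u\<^sup>2" unfolding q(2) by (simp add: power2_eq_square algebra_simps)
    then show "y\<^sup>2 \<le> (2 * pi * real m)\<^sup>2 * ((1 - a)\<^sup>2 - u\<^sup>2)"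
      unfolding y_def power_mult_distrib[of _ q] by (intro mult_left_mono) auto
  qed simp
  finally show ?thesis by (simp only: q_def y_def)
qed

end

section \<open>The error constant\<close>

context window_shift
begin

definition alias_bound :: real where
  "alias_bound = (40 * pow32 m + 3) * (sqrt (1 - 2 * a) * sqrt (sqrt (1 - 2 * a))) * exp (- (2 * pi * real m * sqrt (1 - 2 * a)))"

lemma normalised_series_bound:
  fixes F :: "int \<Rightarrow> (real \<Rightarrow>\<^sub>C complex)"
  assumes F: "\<And>r. F r = trig_monom (of_real (shifted_term m a u r) / of_real (bessel ((2 * pi * real m)\<^sup>2 * ((1 - a)\<^sup>2 - u\<^sup>2)))) (r * int N)"
  shows "F summable_on (UNIV - {0})" and "norm (infsum F (UNIV - {0})) \<le> alias_bound"
proof -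
  define D where "D = bessel ((2 * pi * real m)\<^sup>2 * ((1 - a)\<^sup>2 - u\<^sup>2))"
  define q where "q = sqrt (1 - 2 * a)"
  define y where "y = 2 * pi * real m * q"
  define P where "P = 40 * pow32 m + 3"
  define T where "T = 2 * M * (q * sqrt q)"
  have q: "0 < q" using a by (simp add: q_def)
  have T: "0 < T" using M_pos q by (simp add: T_def)
  have I: "0 < bessel_factor y" using bessel_factor_shrunk by (simp add: y_def q_def)
  have D: "exp y / T * bessel_factor y \<le> D" using center_bound by (simp only: D_def y_def q_def T_def)
  have "0 < exp y / T * bessel_factor y" using T I by simp
  then have Dp: "0 < D" using D by linarith
  note S = shifted_trig_series[OF F[folded D_def] Dp]
  show "F summable_on (UNIV - {0})" by (rule S(1))
  have P: "0 \<le> P" using pow32_ge by (simp add: P_def)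
  have "norm (infsum F (UNIV - {0})) \<le> P * bessel_factor y / (2 * M) / D" using S(2) by (simp only: P_def y_def q_def)
  also have "\<dots> \<le> P * bessel_factor y / (2 * M) / (exp y / T * bessel_factor y)"
    using P I M_pos by (intro divide_left_mono[OF D] mult_pos_pos divide_pos_pos Dp T) simp_all
  also have "\<dots> = P * (q * sqrt q) * exp (- y)"
    using I m q by (simp add: T_def exp_minus field_simps)
  finally show "norm (infsum F (UNIV - {0})) \<le> alias_bound" by (simp only: alias_bound_def P_def y_def q_def)
qed

end

text \<open>The constants of the Fourier transform cancel in the quotient. The bound is the same for every \<open>n\<close> and every grid.\<close>

lemma alias_norm_sinh_window:
  assumes grid: "(N, N\<^sub>1) \<in> grid_sizes \<sigma>" and m: "2 \<le> m" and \<sigma>: "5 / 4 \<le> \<sigma>" and n: "n \<in> index_set N"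
  shows "alias_norm (sinh_window m (2 * pi * real m * (1 - 1 / (2 * \<sigma>))) N\<^sub>1) N\<^sub>1 n
    \<le> ereal (window_shift.alias_bound m (1 / (2 * \<sigma>)))"
proof -
  define a where "a = 1 / (2 * \<sigma>)"
  define u where "u = of_int n / real N\<^sub>1"
  define \<beta> where "\<beta> = 2 * pi * real m * (1 - a)"
  have N: "0 < N" "0 < N\<^sub>1" "even N" "real N\<^sub>1 = \<sigma> * real N" using grid by (auto simp: grid_sizes_def)
  have a: "0 < a" "a \<le> 2 / 5" using \<sigma> by (auto simp: a_def field_simps)
  have aN: "a * real N\<^sub>1 = real N / 2" using \<sigma> by (simp add: N(4) a_def)
  have "\<bar>n\<bar> * 2 \<le> int N" using n N(3) by (auto simp: index_set_def abs_le_iff)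
  then have "\<bar>real_of_int n\<bar> \<le> real N / 2" by linarith
  then have u: "\<bar>u\<bar> \<le> a" using N(2) aN by (simp add: u_def divide_le_eq)
  interpret window_shift m a u by unfold_locales (use m a u in auto)
  define C where "C = real m / real N\<^sub>1 / sinh \<beta> * (pi * \<beta>)"
  have \<beta>: "0 < \<beta>" using m a by (simp add: \<beta>_def)
  have C: "C \<noteq> 0" using m N(2) \<beta> by (simp add: C_def)
  have ft: "fourier (sinh_window m \<beta> N\<^sub>1) (of_int k) = of_real C * of_real (bessel (\<beta>\<^sup>2 - (2 * pi * real m * (of_int k / real N\<^sub>1))\<^sup>2))" for k
    using fourier_sinh_window[of m N\<^sub>1 \<beta> "of_int k"] m N(2) by (simp add: C_def)
  have "alias_term (sinh_window m \<beta> N\<^sub>1) N\<^sub>1 n r = trig_monom (of_real (shifted_term m a u r) / of_real (bessel ((2 * pi * real m)\<^sup>2 * ((1 - a)\<^sup>2 - u\<^sup>2)))) (r * int N\<^sub>1)" for r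
  proof -
    have k: "of_int (n + r * int N\<^sub>1) / real N\<^sub>1 = of_int r + u" using N(2) by (simp add: u_def field_simps)
    have "\<beta>\<^sup>2 - (2 * pi * real m * (of_int (n + r * int N\<^sub>1) / real N\<^sub>1))\<^sup>2 = - ((2 * pi * real m)\<^sup>2 * ((of_int r + u)\<^sup>2 - (1 - a)\<^sup>2))"
      unfolding \<beta>_def k power_mult_distrib by (simp only: right_diff_distrib minus_diff_eq)
    moreover have "\<beta>\<^sup>2 - (2 * pi * real m * (of_int n / real N\<^sub>1))\<^sup>2 = (2 * pi * real m)\<^sup>2 * ((1 - a)\<^sup>2 - u\<^sup>2)"
      unfolding \<beta>_def u_def power_mult_distrib by (simp only: right_diff_distrib)
    ultimately show ?thesis unfolding alias_term_def ft shifted_term_def using C by simp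
  qed
  from normalised_series_bound[OF this] show ?thesis
    unfolding alias_norm_def a_def[symmetric] \<beta>_def[symmetric] by simp
qed

lemma index_set_finite_nonempty: "0 < N \<Longrightarrow> even N \<Longrightarrow> finite (index_set N) \<and> index_set N \<noteq> {}"
  by (auto simp: index_set_def)

lemma error_constant_sinh_window:
  assumes "2 \<le> m" "5 / 4 \<le> \<sigma>"
  shows "error_constant \<sigma> (sinh_window m (2 * pi * real m * (1 - 1 / (2 * \<sigma>)))) \<le> ereal (window_shift.alias_bound m (1 / (2 * \<sigma>)))"
  unfolding error_constant_def
proof (rule SUP_least, clarify)
  fix N N\<^sub>1 assume grid: "(N, N\<^sub>1) \<in> grid_sizes \<sigma>"
  then have "finite (index_set N)" "index_set N \<noteq> {}" using index_set_finite_nonempty by (auto simp: grid_sizes_def)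
  then show "error_constant_at N N\<^sub>1 (sinh_window m (2 * pi * real m * (1 - 1 / (2 * \<sigma>))) N\<^sub>1) \<le> ereal (window_shift.alias_bound m (1 / (2 * \<sigma>)))"
    unfolding error_constant_at_def by (subst Max_le_iff) (auto intro!: alias_norm_sinh_window[OF grid assms])
qed

text \<open>For \<open>\<bar>v\<bar> \<le> N / 2\<close> the quotient \<open>v / N\<^sub>1\<close> is at most \<open>a\<close>, and \<open>a \<le> 1 - a\<close>.\<close>

lemma sinh_window_in_class_grid:
  assumes grid: "(N, N\<^sub>1) \<in> grid_sizes \<sigma>" and m: "0 < m" and \<sigma>: "5 / 4 \<le> \<sigma>"
  shows "sinh_window m (2 * pi * real m * (1 - 1 / (2 * \<sigma>))) N\<^sub>1 \<in> window_class m N N\<^sub>1"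
proof (rule sinh_window_in_class)
  have N: "0 < N" "0 < N\<^sub>1" "real N\<^sub>1 = \<sigma> * real N" using grid by (auto simp: grid_sizes_def)
  have a: "1 / (2 * \<sigma>) \<le> 2 / 5" using \<sigma> by (simp add: field_simps)
  show "0 < m" "0 < N\<^sub>1" by fact+
  show "0 < 2 * pi * real m * (1 - 1 / (2 * \<sigma>))" using m a by (intro mult_pos_pos) auto
  fix v :: real assume v: "\<bar>v\<bar> \<le> real N / 2"
  have "\<bar>v / real N\<^sub>1\<bar> \<le> (real N / 2) / real N\<^sub>1" unfolding abs_divide abs_of_nat by (rule divide_right_mono[OF v]) simp
  also have "\<dots> = 1 / (2 * \<sigma>)" using N by simp
  finally have "\<bar>v / real N\<^sub>1\<bar> \<le> 1 - 1 / (2 * \<sigma>)" using a by linarith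
  then have "2 * pi * real m * \<bar>v / real N\<^sub>1\<bar> \<le> 2 * pi * real m * (1 - 1 / (2 * \<sigma>))" by (rule mult_left_mono) simp
  then have "\<bar>2 * pi * real m * (v / real N\<^sub>1)\<bar> \<le> 2 * pi * real m * (1 - 1 / (2 * \<sigma>))" by (simp only: abs_mult) simp
  then show "(2 * pi * real m * (v / real N\<^sub>1))\<^sup>2 \<le> (2 * pi * real m * (1 - 1 / (2 * \<sigma>)))\<^sup>2"
    by (rule abs_le_square_iff[THEN iffD1, OF order_trans]) simp
qed

text \<open>The exponent \<open>14 / 5\<close> is below \<open>2 * pi * sqrt (1 / 5)\<close>, the rate for the least oversampling \<open>\<sigma> = 5 / 4\<close>.\<close>

lemma alias_bound_le:
  assumes m: "2 \<le> m" and \<sigma>: "5 / 4 \<le> \<sigma>"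
  shows "window_shift.alias_bound m (1 / (2 * \<sigma>))
    \<le> (40 * real m powr (3 / 2) + 3 * (1 - 1 / (2 * \<sigma>)) powr (- 3 / 2))
        * (1 - 1 / \<sigma>) powr (3 / 4) * exp (- 2 * pi * real m * sqrt (1 - 1 / \<sigma>))"
    and "window_shift.alias_bound m (1 / (2 * \<sigma>)) \<le> 43 * (real m)\<^sup>2 * exp (- (14 / 5 * real m))"
proof -
  define s where "s = 1 - 1 / \<sigma>"
  have s: "1 / 5 \<le> s" "s < 1" using \<sigma> by (auto simp: s_def field_simps)
  interpret window_shift m "1 / (2 * \<sigma>)" 0 by unfold_locales (use m \<sigma> in \<open>auto simp: field_simps\<close>)
  have fb: "alias_bound = (40 * pow32 m + 3) * (sqrt s * sqrt (sqrt s)) * exp (- (2 * pi * real m * sqrt s))"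
    unfolding alias_bound_def by (simp add: s_def)
  have half: "x * sqrt x = x powr (3 / 2)" if "0 < x" for x :: real
    using powr_add[of x 1 "1 / 2"] that by (simp add: powr_half_sqrt)
  have qq: "sqrt s * sqrt (sqrt s) = s powr (3 / 4)"
    using s half[of "sqrt s"] by (simp add: powr_half_sqrt[symmetric] powr_powr)
  have mm: "pow32 m = real m powr (3 / 2)" using m by (simp add: half)
  have "(1 - 1 / (2 * \<sigma>)) powr 0 \<le> (1 - 1 / (2 * \<sigma>)) powr (- 3 / 2)"
    using \<sigma> by (intro powr_mono') (auto simp: field_simps)
  then have three: "3 \<le> 3 * (1 - 1 / (2 * \<sigma>)) powr (- 3 / 2)" using \<sigma> by (simp add: field_simps split: if_splits)
  have "alias_bound = (40 * real m powr (3 / 2) + 3) * (s powr (3 / 4) * exp (- (2 * pi * real m * sqrt s)))"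
    unfolding fb qq mm by simp
  also have "\<dots> \<le> (40 * real m powr (3 / 2) + 3 * (1 - 1 / (2 * \<sigma>)) powr (- 3 / 2)) * (s powr (3 / 4) * exp (- (2 * pi * real m * sqrt s)))"
    using three by (intro mult_right_mono) auto
  finally show "alias_bound \<le> (40 * real m powr (3 / 2) + 3 * (1 - 1 / (2 * \<sigma>)) powr (- 3 / 2))
        * (1 - 1 / \<sigma>) powr (3 / 4) * exp (- 2 * pi * real m * sqrt (1 - 1 / \<sigma>))"
    by (simp add: s_def mult.assoc)
  have m2: "2 \<le> real m" using m by simp
  have "sqrt (real m) \<le> real m" using m2 by (intro real_le_lsqrt) (auto simp: power2_eq_square)
  then have "pow32 m \<le> (real m)\<^sup>2" using m2 by (simp add: power2_eq_square)
  moreover have "1 \<le> (real m)\<^sup>2" using m2 by simp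
  ultimately have A: "40 * pow32 m + 3 \<le> 43 * (real m)\<^sup>2" by linarith
  have B: "sqrt s * sqrt (sqrt s) \<le> 1" using s by (intro mult_le_one) auto
  have "446 / 1000 \<le> sqrt s" using s by (intro real_le_rsqrt) (simp add: power_divide)
  then have "14 / 5 \<le> 2 * (314 / 100) * sqrt s" by simp
  also have "\<dots> \<le> 2 * pi * sqrt s" using pi_approx s by (intro mult_right_mono) auto
  finally have "14 / 5 * real m \<le> (2 * pi * sqrt s) * real m" by (rule mult_right_mono) simp
  then have C: "exp (- (2 * pi * real m * sqrt s)) \<le> exp (- (14 / 5 * real m))" by (simp add: mult_ac)
  show "alias_bound \<le> 43 * (real m)\<^sup>2 * exp (- (14 / 5 * real m))"
  proof -
    have "(40 * pow32 m + 3) * (sqrt s * sqrt (sqrt s)) \<le> 43 * (real m)\<^sup>2 * 1"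
      using A B s by (intro mult_mono) auto
    from mult_mono[OF this C] show ?thesis unfolding fb by simp
  qed
qed

text \<open>With \<open>x = exp (7 / 5 * m)\<close> the claim is \<open>43 * m\<^sup>2 < x\<^sup>2\<close>. Since \<open>6.56\<^sup>2 > 43\<close>, it suffices that \<open>x \<ge> 6.56 * m\<close>, which follows from the value at
\<open>m = 2\<close> and convexity.\<close>

lemma square_exp_less_one:
  assumes "2 \<le> m" shows "43 * (real m)\<^sup>2 * exp (- (14 / 5 * real m)) < 1"
proof -
  define x where "x = exp (7 / 5 * real m)"
  have m: "2 \<le> real m" using assms by simp
  have "1945 / 1000 \<le> exp (7 / 10 :: real)"
    using exp_lower_Taylor_quadratic[of "7 / 10"] by (simp add: power2_eq_square)
  then have "(1945 / 1000) ^ 4 \<le> exp (7 / 10 :: real) ^ 4" by (rule power_mono) simp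
  then have "143 / 10 \<le> exp (14 / 5 :: real)" by (simp add: exp_of_nat_mult[symmetric] power_divide)
  then have "143 / 10 * (1 + 7 / 5 * (real m - 2)) \<le> exp (14 / 5) * exp (7 / 5 * (real m - 2))"
    using m by (intro mult_mono exp_ge_add_one_self) auto
  also have "\<dots> = x"
  proof -
    have "14 / 5 + 7 / 5 * (real m - 2) = 7 / 5 * real m" by (simp add: field_simps)
    then show ?thesis unfolding x_def exp_add[symmetric] by simp
  qed
  finally have "656 / 100 * real m \<le> x" using m by (simp add: field_simps)
  then have "(656 / 100 * real m)\<^sup>2 \<le> x\<^sup>2" using m by (intro power_mono) auto
  moreover have "0 < (real m)\<^sup>2" using m by simp
  ultimately have "43 * (real m)\<^sup>2 < x\<^sup>2"
  proof -
    assume "(656 / 100 * real m)\<^sup>2 \<le> x\<^sup>2" "0 < (real m)\<^sup>2"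
    moreover have "(656 / 100 * real m)\<^sup>2 = 26896 / 625 * (real m)\<^sup>2" by (simp add: power_mult_distrib power_divide)
    ultimately show ?thesis by linarith
  qed
  then show ?thesis by (simp add: x_def exp_minus exp_of_nat_mult[symmetric] divide_less_eq field_simps)
qed

theorem theorem5p1:
  fixes N N\<^sub>1 m :: nat and \<sigma> :: real and \<beta> :: "nat \<Rightarrow> real"
  assumes "even N" and "8 \<le> N"
    and "5 / 4 \<le> \<sigma>"
    and "even N\<^sub>1" and "real N\<^sub>1 = \<sigma> * real N"
    and "2 \<le> m" and "2 * m < N\<^sub>1"
    and "\<And>k. \<beta> k = 2 * pi * real k * (1 - 1 / (2 * \<sigma>))"
  shows "error_constant \<sigma> (sinh_window m (\<beta> m))
           \<le> ereal ((40 * real m powr (3 / 2) + 3 * (1 - 1 / (2 * \<sigma>)) powr (- 3 / 2))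
                    * (1 - 1 / \<sigma>) powr (3 / 4) * exp (- 2 * pi * real m * sqrt (1 - 1 / \<sigma>)))
         \<and> convenient_for_NFFT 1 \<sigma> m (sinh_window m (\<beta> m))
         \<and> (\<forall>\<epsilon>>0. \<forall>\<^sub>F k in sequentially. convenient_for_NFFT \<epsilon> \<sigma> k (sinh_window k (\<beta> k)))"
proof -
  have \<sigma>: "5 / 4 \<le> \<sigma>" by fact
  define E where "E k = window_shift.alias_bound k (1 / (2 * \<sigma>))" for k
  have err: "error_constant \<sigma> (sinh_window k (\<beta> k)) \<le> ereal (E k)" if "2 \<le> k" for k
    unfolding assms(8) E_def by (rule error_constant_sinh_window[OF that \<sigma>])
  have conv: "convenient_for_NFFT \<epsilon> \<sigma> k (sinh_window k (\<beta> k))" if k: "2 \<le> k" and E: "E k < \<epsilon>" for \<epsilon> k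
    unfolding convenient_for_NFFT_def
  proof (intro conjI ballI)
    show "1 < \<sigma>" using \<sigma> by simp
    show "error_constant \<sigma> (sinh_window k (\<beta> k)) < ereal \<epsilon>"
      using err[OF k] E by (meson ereal_less(1) le_less_trans less_ereal.simps(1))
    fix p assume p: "p \<in> grid_sizes \<sigma>"
    show "case p of (N, N\<^sub>1) \<Rightarrow> sinh_window k (\<beta> k) N\<^sub>1 \<in> window_class k N N\<^sub>1"
      unfolding assms(8) using p k by (cases p) (auto intro!: sinh_window_in_class_grid[OF _ _ \<sigma>])
  qed
  have E: "E k \<le> 43 * (real k)\<^sup>2 * exp (- (14 / 5 * real k))" if "2 \<le> k" for k
    unfolding E_def by (rule alias_bound_le(2)[OF that \<sigma>])
  have "((\<lambda>k. 43 * (real k)\<^sup>2 * exp (- (14 / 5 * real k))) \<longlongrightarrow> 0) sequentially" by real_asymp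
  note tends = this
  have "\<forall>\<^sub>F k in sequentially. convenient_for_NFFT \<epsilon> \<sigma> k (sinh_window k (\<beta> k))" if "0 < \<epsilon>" for \<epsilon>
    using order_tendstoD(2)[OF tends that] eventually_ge_at_top[of "2::nat"]
  proof eventually_elim
    case (elim k)
    show ?case by (rule conv[OF elim(2) le_less_trans[OF E[OF elim(2)] elim(1)]])
  qed
  moreover have "convenient_for_NFFT 1 \<sigma> m (sinh_window m (\<beta> m))"
    using conv[OF \<open>2 \<le> m\<close>] E[OF \<open>2 \<le> m\<close>] square_exp_less_one[OF \<open>2 \<le> m\<close>] by simp
  moreover have "error_constant \<sigma> (sinh_window m (\<beta> m)) \<le> ereal ((40 * real m powr (3 / 2) + 3 * (1 - 1 / (2 * \<sigma>)) powr (- 3 / 2))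
                    * (1 - 1 / \<sigma>) powr (3 / 4) * exp (- 2 * pi * real m * sqrt (1 - 1 / \<sigma>)))"
    using err[OF \<open>2 \<le> m\<close>] alias_bound_le(1)[OF \<open>2 \<le> m\<close> \<sigma>] unfolding E_def by (meson ereal_less_eq(3) order_trans)
  ultimately show ?thesis by blast
qed

end
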